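(* Let $\pi=\{p_1,\ldots,p_n\}$ be a set of primes and $\pi'=\mathbb{P}\setminus\pi$. Let $G$ be a finite group. Suppose that $A$ is a modular subgroup of $G$ and there is a subgroup chain $A=A_0\le A_1\le\cdots\le A_m=G$ such that for every $i=1,\ldots,m$ either $A_{i-1}\trianglelefteq A_i$ or $A_i/(A_{i-1})_{A_i}$ is a $\pi_0$-group, where $\pi_0\in\{\pi,\pi'\}$ (possibly depending on $i$). Then the following statements hold: (i) For $\pi_0\in\{\pi,\pi'\}$: if $G$ possesses a Hall $\pi_0$-subgroup, then $A$ permutes with each Hall $\pi_0$-subgroup $V$ of $G$ (that is, $AV=VA$). (ii) The quotients $A^G/A_G$ and $G/C_G(A^G/A_G)$ are $\pi$-decomposable. (iii) For every chief factor $H/K$ of $G$ between $A^G$ and $A_G$ (that is, with $A_G\le K<H\le A^G$) the semidirect product $(H/K)\rtimes(G/C_G(H/K))$ is either a $\pi$-group or a $\pi'$-group.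
   Context: All groups are finite; $\mathbb{P}$ is the set of all primes. For a set of primes $\tau$, a $\tau$-group is a finite group whose order has all its prime divisors in $\tau$; a Hall $\tau$-subgroup of $G$ is a $\tau$-subgroup whose index in $G$ is divisible by no prime of $\tau$; $O_\tau(G)$ is the largest normal $\tau$-subgroup of $G$. A subgroup $A$ of $G$ is modular in $G$ if: (1) $\langle X, A\cap Z\rangle=\langle X,A\rangle\cap Z$ for all $X\le G$, $Z\le G$ with $X\le Z$; and (2) $\langle A, Y\cap Z\rangle=\langle A,Y\rangle\cap Z$ for all $Y\le G$, $Z\le G$ with $A\le Z$. For a subgroup $A\le G$: $A^G$ is the normal closure of $A$ in $G$ and $A_G$ is the normal core of $A$ in $G$ (the largest normal subgroup of $G$ contained in $A$); similarly $(A_{i-1})_{A_i}$ is the normal core of $A_{i-1}$ in $A_i$. For normal subgroups $K\le H$ of $G$, $C_G(H/K)$ is the kernel of the conjugation action of $G$ on $H/K$, and the semidirect product $(H/K)\rtimes(G/C_G(H/K))$ is taken with respect to the induced action. A group $G$ is $\pi$-decomposable if $G=O_\pi(G)\times O_{\pi'}(G)$. *)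

theory Defs
  imports
    "HOL-Algebra.Coset"
    "HOL-Algebra.Bij"
    "HOL-Algebra.Generated_Groups"
    "HOL-Algebra.SndIsomorphismGrp"
    "HOL-Computational_Algebra.Primes"
begin

text \<open>
  Subgroups are sets \<^term>\<open>H\<close> with \<^term>\<open>subgroup H G\<close>; viewed as a group in its own right
  such a subgroup is \<^term>\<open>G\<lparr>carrier := H\<rparr>\<close>, and the factor \<open>H/K\<close> is
  \<^term>\<open>G\<lparr>carrier := H\<rparr> Mod K\<close>.
\<close>

definition all_primes :: "nat set"
  where "all_primes = {p. prime p}"

definition tau_group :: "nat set \<Rightarrow> ('a, 'b) monoid_scheme \<Rightarrow> bool"
  where "tau_group \<tau> G \<longleftrightarrow>
    group G \<and> finite (carrier G) \<and> (\<forall>p. prime p \<longrightarrow> p dvd order G \<longrightarrow> p \<in> \<tau>)"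

definition hall_subgroup :: "nat set \<Rightarrow> ('a, 'b) monoid_scheme \<Rightarrow> 'a set \<Rightarrow> bool"
  where "hall_subgroup \<tau> G V \<longleftrightarrow>
    subgroup V G \<and> tau_group \<tau> (G\<lparr>carrier := V\<rparr>) \<and>
    (\<forall>p\<in>\<tau>. prime p \<longrightarrow> \<not> p dvd card (rcosets\<^bsub>G\<^esub> V))"

text \<open>
  \<open>GREATEST\<close> and \<open>LEAST\<close> below refer to inclusion of sets. That these extremal subgroups exist is
  shown in lemmas \<open>normal_core_greatest\<close>, \<open>normal_closure_least\<close> and \<open>tau_radical_greatest\<close>.
\<close>

definition tau_radical :: "nat set \<Rightarrow> ('a, 'b) monoid_scheme \<Rightarrow> 'a set"
  where "tau_radical \<tau> G = (GREATEST N. N \<lhd> G \<and> tau_group \<tau> (G\<lparr>carrier := N\<rparr>))"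

definition normal_core :: "('a, 'b) monoid_scheme \<Rightarrow> 'a set \<Rightarrow> 'a set"
  where "normal_core G A = (GREATEST N. N \<lhd> G \<and> N \<subseteq> A)"

definition normal_closure :: "('a, 'b) monoid_scheme \<Rightarrow> 'a set \<Rightarrow> 'a set"
  where "normal_closure G A = (LEAST N. N \<lhd> G \<and> A \<subseteq> N)"

definition internal_direct_product ::
    "('a, 'b) monoid_scheme \<Rightarrow> 'a set \<Rightarrow> 'a set \<Rightarrow> bool"
  where "internal_direct_product G M N \<longleftrightarrow>
    M \<lhd> G \<and> N \<lhd> G \<and> M \<inter> N = {\<one>\<^bsub>G\<^esub>} \<and> M <#>\<^bsub>G\<^esub> N = carrier G"

definition pi_decomposable :: "nat set \<Rightarrow> ('a, 'b) monoid_scheme \<Rightarrow> bool"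
  where "pi_decomposable \<pi> G \<longleftrightarrow>
    group G \<and> internal_direct_product G (tau_radical \<pi> G) (tau_radical (all_primes - \<pi>) G)"

definition modular_subgroup :: "('a, 'b) monoid_scheme \<Rightarrow> 'a set \<Rightarrow> bool"
  where "modular_subgroup G A \<longleftrightarrow>
    subgroup A G \<and>
    (\<forall>X Z. subgroup X G \<longrightarrow> subgroup Z G \<longrightarrow> X \<subseteq> Z \<longrightarrow>
       generate G (X \<union> (A \<inter> Z)) = generate G (X \<union> A) \<inter> Z) \<and>
    (\<forall>Y Z. subgroup Y G \<longrightarrow> subgroup Z G \<longrightarrow> A \<subseteq> Z \<longrightarrow>
       generate G (A \<union> (Y \<inter> Z)) = generate G (A \<union> Y) \<inter> Z)"

definition chief_factor :: "('a, 'b) monoid_scheme \<Rightarrow> 'a set \<Rightarrow> 'a set \<Rightarrow> bool"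
  where "chief_factor G H K \<longleftrightarrow>
    H \<lhd> G \<and> K \<lhd> G \<and> K \<subset> H \<and> (\<forall>N. N \<lhd> G \<longrightarrow> K \<subseteq> N \<longrightarrow> N \<subseteq> H \<longrightarrow> N = K \<or> N = H)"

text \<open>
  The conjugation action \<open>g \<mapsto> (X \<mapsto> g X g\<inverse>)\<close> of \<open>G\<close> on \<open>H/K\<close>; the inner function is restricted to
  the carrier because elements of \<^const>\<open>AutoGroup\<close> are extensional.
\<close>

definition conj_action ::
    "('a, 'b) monoid_scheme \<Rightarrow> 'a set \<Rightarrow> 'a set \<Rightarrow> 'a \<Rightarrow> 'a set \<Rightarrow> 'a set"
  where "conj_action G H K g =
    (\<lambda>X \<in> carrier (G\<lparr>carrier := H\<rparr> Mod K). (g <#\<^bsub>G\<^esub> X) #>\<^bsub>G\<^esub> (inv\<^bsub>G\<^esub> g))"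

definition factor_centralizer ::
    "('a, 'b) monoid_scheme \<Rightarrow> 'a set \<Rightarrow> 'a set \<Rightarrow> 'a set"
  where "factor_centralizer G H K =
    kernel G (AutoGroup (G\<lparr>carrier := H\<rparr> Mod K)) (conj_action G H K)"

definition semidirect_product ::
    "('a, 'm) monoid_scheme \<Rightarrow> ('b, 'n) monoid_scheme \<Rightarrow> ('b \<Rightarrow> 'a \<Rightarrow> 'a) \<Rightarrow> ('a \<times> 'b) monoid"
  where "semidirect_product N Q \<phi> =
    \<lparr>carrier = carrier N \<times> carrier Q,
     monoid.mult = (\<lambda>(n, q) (n', q'). (n \<otimes>\<^bsub>N\<^esub> \<phi> q n', q \<otimes>\<^bsub>Q\<^esub> q')),
     one = (\<one>\<^bsub>N\<^esub>, \<one>\<^bsub>Q\<^esub>)\<rparr>"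

text \<open>
  \<open>(H/K) \<rtimes> (G/C\<^sub>G(H/K))\<close>. The elements of a coset \<open>X\<close> of \<open>C\<^sub>G(H/K)\<close> all induce the same automorphism
  of \<open>H/K\<close>, and \<^const>\<open>the_elem\<close> picks it.
\<close>

definition factor_semidirect ::
    "('a, 'b) monoid_scheme \<Rightarrow> 'a set \<Rightarrow> 'a set \<Rightarrow> ('a set \<times> 'a set) monoid"
  where "factor_semidirect G H K =
    semidirect_product (G\<lparr>carrier := H\<rparr> Mod K) (G Mod factor_centralizer G H K)
      (\<lambda>X. the_elem (conj_action G H K ` X))"


subsection \<open>The notions above are well defined\<close>

lemma normal_core_greatest:
  fixes G (structure)
  assumes "group G" "subgroup A G"
  shows "normal_core G A \<lhd> G" "normal_core G A \<subseteq> A"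
    "\<And>N. N \<lhd> G \<Longrightarrow> N \<subseteq> A \<Longrightarrow> N \<subseteq> normal_core G A"
proof -
  interpret group G by fact
  define U where "U = \<Union>{N. N \<lhd> G \<and> N \<subseteq> A}"
  have UA: "U \<subseteq> A" by (auto simp: U_def)
  have UG: "U \<subseteq> carrier G"
    using UA assms(2) subgroup.subset by blast
  have n: "generate G U \<lhd> G"
    using UG by (rule normal_generateI) (auto simp: U_def dest: normal_invE(2))
  have a: "generate G U \<subseteq> A"
    by (rule generate_subgroup_incl[OF UA assms(2)])
  have g: "N \<subseteq> generate G U" if "N \<lhd> G" "N \<subseteq> A" for N
    using that by (auto simp: U_def intro: generate.incl)
  have "normal_core G A = generate G U"
    unfolding normal_core_def by (rule Greatest_equality) (use n a g in auto)
  with n a g show "normal_core G A \<lhd> G" "normal_core G A \<subseteq> A"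
    "\<And>N. N \<lhd> G \<Longrightarrow> N \<subseteq> A \<Longrightarrow> N \<subseteq> normal_core G A"
    by auto
qed

lemma normal_closure_least:
  fixes G (structure)
  assumes "group G" "A \<subseteq> carrier G"
  shows "normal_closure G A \<lhd> G" "A \<subseteq> normal_closure G A"
    "\<And>N. N \<lhd> G \<Longrightarrow> A \<subseteq> N \<Longrightarrow> normal_closure G A \<subseteq> N"
proof -
  interpret group G by fact
  define D where "D = \<Inter>{N. N \<lhd> G \<and> A \<subseteq> N}"
  have G: "carrier G \<lhd> G"
    by (rule normal_invI) (auto simp: subgroup_self)
  have sub: "subgroup D G"
    unfolding D_def by (rule subgroups_Inter) (use G assms(2) in \<open>auto dest: normal_imp_subgroup\<close>)
  have n: "D \<lhd> G"
    using sub by (rule normal_invI) (auto simp: D_def dest: normal_invE(2))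
  have "normal_closure G A = D"
    unfolding normal_closure_def by (rule Least_equality) (use n in \<open>auto simp: D_def\<close>)
  with n show "normal_closure G A \<lhd> G" "A \<subseteq> normal_closure G A"
    "\<And>N. N \<lhd> G \<Longrightarrow> A \<subseteq> N \<Longrightarrow> normal_closure G A \<subseteq> N"
    by (auto simp: D_def)
qed

lemma tau_group_set_mult:
  fixes G (structure)
  assumes "group G" "finite (carrier G)" "M \<lhd> G" "N \<lhd> G"
    and M: "tau_group \<tau> (G\<lparr>carrier := M\<rparr>)" and N: "tau_group \<tau> (G\<lparr>carrier := N\<rparr>)"
  shows "tau_group \<tau> (G\<lparr>carrier := M <#> N\<rparr>)"
proof -
  interpret group G by fact
  interpret second_isomorphism_grp M G N
    using assms normal_imp_subgroup
    by (simp add: second_isomorphism_grp_def second_isomorphism_grp_axioms_def)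
  let ?MN = "G\<lparr>carrier := M <#> N\<rparr>"
  let ?N = "G\<lparr>carrier := N\<rparr>"
  have sMN: "subgroup (M <#> N) G" by (rule normal_set_mult_subgroup)
  have gMN: "group ?MN" using sMN by (rule subgroup_imp_group)
  have gN: "group ?N" using N by (simp add: tau_group_def)
  have fin: "finite (M <#> N)"
    using assms(2) sMN subgroup.subset finite_subset by blast
  have finN: "finite N" using N by (simp add: tau_group_def)
  have sM: "subgroup M ?MN"
    using H_contained_in_set_mult sMN assms(3) normal_imp_subgroup subgroup_incl by blast
  have sI: "subgroup (M \<inter> N) ?N"
    using normal_subgrp_intersection_normal normal_imp_subgroup by (metis Int_commute)
  have 1: "card (rcosets\<^bsub>?MN\<^esub> M) * card M = card (M <#> N)"
    using group.lagrange_finite[OF gMN _ sM] fin by (simp add: order_def)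
  have 2: "card (rcosets\<^bsub>?N\<^esub> (M \<inter> N)) * card (M \<inter> N) = card N"
    using group.lagrange_finite[OF gN _ sI] finN by (simp add: order_def)
  have "bij_betw (\<lambda>X. the_elem ((#>) M ` X)) (carrier (?N Mod (M \<inter> N))) (carrier (?MN Mod M))"
    using normal_intersection_quotient_isom by (auto simp: iso_def)
  then have "card (rcosets\<^bsub>?N\<^esub> (M \<inter> N)) = card (rcosets\<^bsub>?MN\<^esub> M)"
    by (auto dest!: bij_betw_same_card simp: FactGroup_def)
  with 1 2 have dvd: "card (M <#> N) dvd card N * card M"
    by (metis dvd_triv_left mult.assoc mult.commute)
  show ?thesis
    unfolding tau_group_def
  proof (intro conjI allI impI)
    fix p :: nat assume p: "prime p" "p dvd order ?MN"
    with dvd have "p dvd card N * card M" by (auto simp: order_def intro: dvd_trans)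
    then have "p dvd card N \<or> p dvd card M" using p(1) by (simp add: prime_dvd_mult_iff)
    then show "p \<in> \<tau>" using p(1) M N by (auto simp: tau_group_def order_def)
  qed (use gMN fin in auto)
qed

lemma tau_radical_greatest:
  fixes G (structure)
  assumes "group G" "finite (carrier G)"
  shows "tau_radical \<tau> G \<lhd> G" "tau_group \<tau> (G\<lparr>carrier := tau_radical \<tau> G\<rparr>)"
    "\<And>N. N \<lhd> G \<Longrightarrow> tau_group \<tau> (G\<lparr>carrier := N\<rparr>) \<Longrightarrow> N \<subseteq> tau_radical \<tau> G"
proof -
  interpret group G by fact
  define S where "S = {N. N \<lhd> G \<and> tau_group \<tau> (G\<lparr>carrier := N\<rparr>)}"
  have sub: "N \<subseteq> carrier G" if "N \<in> S" for N
    using that by (auto simp: S_def dest: normal_imp_subgroup subgroup.subset)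
  have "finite S"
    by (rule finite_subset[of _ "Pow (carrier G)"]) (use sub assms(2) in auto)
  moreover have "tau_group \<tau> (G\<lparr>carrier := {\<one>}\<rparr>)"
    using subgroup_imp_group[OF triv_subgroup] by (auto simp: tau_group_def order_def)
  then have "{\<one>} \<in> S" using one_is_normal by (simp add: S_def)
  ultimately obtain N where N: "N \<in> S" "\<And>M. M \<in> S \<Longrightarrow> N \<subseteq> M \<Longrightarrow> M = N"
    using finite_has_maximal[of S] by blast
  have g: "M \<subseteq> N" if M: "M \<in> S" for M
  proof -
    interpret second_isomorphism_grp N G M
      using N(1) M normal_imp_subgroup[of M G]
      by (simp add: S_def second_isomorphism_grp_def second_isomorphism_grp_axioms_def)
    have "N <#> M \<in> S"
      using N(1) M tau_group_set_mult[OF assms] normal_subgroup_set_mult_closed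
      by (simp add: S_def)
    with N(2) H_contained_in_set_mult S_contained_in_set_mult show ?thesis by blast
  qed
  have "tau_radical \<tau> G = N"
    unfolding tau_radical_def by (rule Greatest_equality) (use N(1) g in \<open>auto simp: S_def\<close>)
  with N(1) g show "tau_radical \<tau> G \<lhd> G" "tau_group \<tau> (G\<lparr>carrier := tau_radical \<tau> G\<rparr>)"
    "\<And>N. N \<lhd> G \<Longrightarrow> tau_group \<tau> (G\<lparr>carrier := N\<rparr>) \<Longrightarrow> N \<subseteq> tau_radical \<tau> G"
    by (auto simp: S_def)
qed

lemma (in group) conj_coset:
  assumes "K \<lhd> G" "g \<in> carrier G" "x \<in> carrier G"
  shows "(g <# (K #> x)) #> inv g = K #> (g \<otimes> x \<otimes> inv g)"
proof -
  have K: "K \<subseteq> carrier G"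
    using assms(1) normal_imp_subgroup subgroup.subset by blast
  have "g <# (K #> x) = (g <# K) #> x"
    using K assms by (simp add: rcos_assoc_lcos lcos_m_assoc coset_assoc)
  also have "g <# K = K #> g"
    using assms normal.coset_eq by (metis)
  finally show ?thesis
    using K assms by (simp add: coset_mult_assoc)
qed

lemma conj_action_hom:
  fixes G (structure)
  assumes "group G" "H \<lhd> G" "K \<lhd> G" "K \<subseteq> H"
  shows "group_hom G (AutoGroup (G\<lparr>carrier := H\<rparr> Mod K)) (conj_action G H K)"
proof -
  interpret group G by fact
  interpret H: normal H G by fact
  interpret K: normal K G by fact
  let ?F = "G\<lparr>carrier := H\<rparr> Mod K"
  have KH: "K \<lhd> G\<lparr>carrier := H\<rparr>"
    by (rule normal_restrict_supergroup[OF H.subgroup_axioms assms(3) assms(4)])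
  have gF: "group ?F"
    using KH by (rule normal.factorgroup_is_group)
  have cF: "carrier ?F = (\<lambda>x. K #> x) ` H"
    by (auto simp: FactGroup_def RCOSETS_def r_coset_def)
  have val: "conj_action G H K g (K #> x) = K #> (g \<otimes> x \<otimes> inv g)"
    if "g \<in> carrier G" "x \<in> H" for g x
    using that conj_coset[OF assms(3)] H.subset unfolding conj_action_def cF by auto
  have clos: "g \<otimes> x \<otimes> inv g \<in> H" if "g \<in> carrier G" "x \<in> H" for g x
    using that by (rule H.inv_op_closed2)
  have ext: "conj_action G H K g \<in> extensional (carrier ?F)" for g
    unfolding conj_action_def by simp
  have cl: "conj_action G H K g X \<in> carrier ?F" if "g \<in> carrier G" "X \<in> carrier ?F" for g X
    using that clos by (auto simp: cF val)
  have comp: "conj_action G H K (g \<otimes> h) X = conj_action G H K g (conj_action G H K h X)"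
    if gh: "g \<in> carrier G" "h \<in> carrier G" and X: "X \<in> carrier ?F" for g h X
  proof -
    obtain x where x: "x \<in> H" "X = K #> x" using X by (auto simp: cF)
    then have "x \<in> carrier G" using H.subset by auto
    then have "(g \<otimes> h) \<otimes> x \<otimes> inv (g \<otimes> h) = g \<otimes> (h \<otimes> x \<otimes> inv h) \<otimes> inv g"
      using gh by (simp add: m_assoc inv_mult_group)
    then show ?thesis using x gh clos by (simp add: val)
  qed
  have one: "conj_action G H K \<one> X = X" if X: "X \<in> carrier ?F" for X
    using X H.subset by (auto simp: cF val subset_iff)
  have bij: "bij_betw (conj_action G H K g) (carrier ?F) (carrier ?F)" if g: "g \<in> carrier G" for g
  proof (rule bij_betw_byWitness[where f' = "conj_action G H K (inv g)"])
    show "\<forall>X\<in>carrier ?F. conj_action G H K (inv g) (conj_action G H K g X) = X"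
      using g comp[of "inv g" g] one by simp
    show "\<forall>X\<in>carrier ?F. conj_action G H K g (conj_action G H K (inv g) X) = X"
      using g comp[of g "inv g"] one by simp
  qed (use g cl in auto)
  have mult: "conj_action G H K g (X \<otimes>\<^bsub>?F\<^esub> Y) = conj_action G H K g X \<otimes>\<^bsub>?F\<^esub> conj_action G H K g Y"
    if g: "g \<in> carrier G" and X: "X \<in> carrier ?F" and Y: "Y \<in> carrier ?F" for g X Y
  proof -
    obtain x y where x: "x \<in> H" "X = K #> x" and y: "y \<in> H" "Y = K #> y"
      using X Y by (auto simp: cF)
    then have xG: "x \<in> carrier G" "y \<in> carrier G" using H.subset by auto
    have "g \<otimes> (x \<otimes> y) \<otimes> inv g = (g \<otimes> x \<otimes> inv g) \<otimes> (g \<otimes> y \<otimes> inv g)"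
    proof -
      have "(g \<otimes> x \<otimes> inv g) \<otimes> (g \<otimes> y \<otimes> inv g) = g \<otimes> x \<otimes> (inv g \<otimes> g) \<otimes> y \<otimes> inv g"
        using xG g by (simp only: m_assoc m_closed inv_closed)
      then show ?thesis using xG g by (simp add: m_assoc)
    qed
    then show ?thesis
      using x y xG g by (simp add: val K.rcos_sum)
  qed
  have auto: "conj_action G H K g \<in> auto ?F" if g: "g \<in> carrier G" for g
    unfolding auto_def Bij_def hom_def using ext bij[OF g] mult[OF g] cl[OF g] by auto
  have "conj_action G H K \<in> hom G (AutoGroup ?F)"
  proof (rule homI)
    fix g h assume gh: "g \<in> carrier G" "h \<in> carrier G"
    have B: "conj_action G H K g \<in> Bij (carrier ?F)" "conj_action G H K h \<in> Bij (carrier ?F)"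
      using gh auto by (auto simp: auto_def)
    have "conj_action G H K (g \<otimes> h)
        = compose (carrier ?F) (conj_action G H K g) (conj_action G H K h)"
      by (rule extensionalityI[OF ext])
        (use gh comp in \<open>auto simp: compose_def\<close>)
    with B show "conj_action G H K (g \<otimes> h)
        = conj_action G H K g \<otimes>\<^bsub>AutoGroup ?F\<^esub> conj_action G H K h"
      by (simp add: AutoGroup_def BijGroup_def)
  qed (simp add: AutoGroup_def auto)
  then show ?thesis
    using group.AutoGroup[OF gF] by (simp add: group_hom_def group_hom_axioms_def)
qed

lemma semidirect_product_group:
  assumes "group N" "group Q" "\<phi> \<in> hom Q (AutoGroup N)"
  shows "group (semidirect_product N Q \<phi>)"
proof -
  interpret N: group N by fact
  interpret Q: group Q by fact
  interpret \<phi>: group_hom Q "AutoGroup N" \<phi>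
    using assms N.AutoGroup by (simp add: group_hom_def group_hom_axioms_def)
  have au: "\<phi> q \<in> auto N" if "q \<in> carrier Q" for q
    using \<phi>.hom_closed[OF that] by (simp add: AutoGroup_def)
  have cl: "\<phi> q n \<in> carrier N" if "q \<in> carrier Q" "n \<in> carrier N" for q n
    using au[OF that(1)] that(2) by (auto simp: auto_def hom_def)
  have mu: "\<phi> q (n \<otimes>\<^bsub>N\<^esub> n') = \<phi> q n \<otimes>\<^bsub>N\<^esub> \<phi> q n'"
    if "q \<in> carrier Q" "n \<in> carrier N" "n' \<in> carrier N" for q n n'
    using au[OF that(1)] that(2,3) by (auto simp: auto_def hom_def)
  have co: "\<phi> (q \<otimes>\<^bsub>Q\<^esub> r) n = \<phi> q (\<phi> r n)"
    if "q \<in> carrier Q" "r \<in> carrier Q" "n \<in> carrier N" for q r n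
    using \<phi>.hom_mult[OF that(1,2)] that(3) au[OF that(1)] au[OF that(2)]
    by (simp add: AutoGroup_def BijGroup_def auto_def compose_def)
  have on: "\<phi> \<one>\<^bsub>Q\<^esub> n = n" if "n \<in> carrier N" for n
    using \<phi>.hom_one that by (simp add: AutoGroup_def BijGroup_def)
  show ?thesis
  proof (rule groupI)
    fix x assume "x \<in> carrier (semidirect_product N Q \<phi>)"
    then obtain n q where x: "x = (n, q)" "n \<in> carrier N" "q \<in> carrier Q"
      by (auto simp: semidirect_product_def)
    have "\<phi> (inv\<^bsub>Q\<^esub> q) (inv\<^bsub>N\<^esub> n) \<otimes>\<^bsub>N\<^esub> \<phi> (inv\<^bsub>Q\<^esub> q) n = \<phi> (inv\<^bsub>Q\<^esub> q) (inv\<^bsub>N\<^esub> n \<otimes>\<^bsub>N\<^esub> n)"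
      by (rule mu[symmetric]) (use x in auto)
    also have "\<dots> = \<one>\<^bsub>N\<^esub>"
    proof -
      have "\<phi> (inv\<^bsub>Q\<^esub> q) \<in> hom N N" using au[of "inv\<^bsub>Q\<^esub> q"] x(3) unfolding auto_def by (blast intro: Q.inv_closed)
      then have "\<phi> (inv\<^bsub>Q\<^esub> q) \<one>\<^bsub>N\<^esub> = \<one>\<^bsub>N\<^esub>" using hom_one assms(1) by blast
      then show ?thesis using x(2) by (simp only: N.l_inv)
    qed
    finally have inv: "\<phi> (inv\<^bsub>Q\<^esub> q) (inv\<^bsub>N\<^esub> n) \<otimes>\<^bsub>N\<^esub> \<phi> (inv\<^bsub>Q\<^esub> q) n = \<one>\<^bsub>N\<^esub>" .
    have "\<phi> (inv\<^bsub>Q\<^esub> q) (inv\<^bsub>N\<^esub> n) \<in> carrier N" by (rule cl) (use x in auto)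
    with inv show "\<exists>y\<in>carrier (semidirect_product N Q \<phi>).
        y \<otimes>\<^bsub>semidirect_product N Q \<phi>\<^esub> x = \<one>\<^bsub>semidirect_product N Q \<phi>\<^esub>"
      using x by (auto simp: semidirect_product_def simp del: \<phi>.hom_inv intro!: bexI[of _ "\<phi> (inv\<^bsub>Q\<^esub> q) (inv\<^bsub>N\<^esub> n)"] bexI[of _ "inv\<^bsub>Q\<^esub> q"])
  qed (auto simp: semidirect_product_def cl mu co on N.m_assoc Q.m_assoc
      simp del: \<phi>.hom_mult \<phi>.hom_one)
qed

lemma factor_semidirect_group:
  assumes "group G" "H \<lhd> G" "K \<lhd> G" "K \<subseteq> H"
  shows "group (factor_semidirect G H K)"
proof -
  interpret group_hom G "AutoGroup (G\<lparr>carrier := H\<rparr> Mod K)" "conj_action G H K"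
    by (rule conj_action_hom[OF assms])
  have "K \<lhd> G\<lparr>carrier := H\<rparr>"
    using assms G.normal_restrict_supergroup normal_imp_subgroup by blast
  then have "group (G\<lparr>carrier := H\<rparr> Mod K)"
    by (rule normal.factorgroup_is_group)
  moreover have "group (G Mod factor_centralizer G H K)"
    unfolding factor_centralizer_def by (rule normal.factorgroup_is_group[OF normal_kernel])
  ultimately show ?thesis
    unfolding factor_semidirect_def
    by (rule semidirect_product_group) (simp add: factor_centralizer_def FactGroup_hom)
qed

end

theory Submission
  imports Defs "HOL-Algebra.Sylow" "HOL-Algebra.Multiplicative_Group"
begin

text \<open>
  Let \<open>P\<close>, \<open>Q\<close> be \<open>\<pi>\<close> and \<open>\<pi>'\<close> in either order; the argument is symmetric in them. A \<open>P\<close>-element is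
  an element whose order has all its prime divisors in \<open>P\<close>; every element is the product of a
  \<open>P\<close>-element and a \<open>Q\<close>-element among its powers. Modularity enters in one form: a subgroup \<open>Z\<close> with
  \<open>A \<le> Z \<le> \<langle>A, H\<rangle>\<close> is generated by \<open>A\<close> and \<open>H \<inter> Z\<close>.

  Joins with \<open>P\<close>-groups. Let \<open>H\<close> be a \<open>P\<close>-subgroup and intersect the given chain with
  \<open>\<langle>A, H\<rangle>\<close>. Each term is generated by its predecessor and a subgroup of \<open>H\<close>. So a normal step has a
  \<open>P\<close>-quotient, and a step with a \<open>Q\<close>-quotient is no step at all. Hence \<open>|\<langle>A, H\<rangle> : A|\<close> is a
  \<open>P\<close>-number and all \<open>Q\<close>-elements of \<open>\<langle>A, H\<rangle>\<close> lie in \<open>A\<close> (\<open>join_tau_subgroup\<close>). If \<open>V\<close> is a Hall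
  \<open>P\<close>-subgroup, the indices of \<open>A\<close> and \<open>V\<close> in \<open>\<langle>A, V\<rangle>\<close> are coprime, so \<open>AV = \<langle>A, V\<rangle> = VA\<close>; this is (i).
  Moreover every \<open>P\<close>-element normalizes the subgroup \<open>X\<close> generated by the \<open>Q\<close>-elements of \<open>A\<close>;
  symmetrically every \<open>Q\<close>-element normalizes the subgroup \<open>Y\<close> generated by the \<open>P\<close>-elements of \<open>A\<close>.

  The core-free case. Let \<open>A\<^sub>G = 1\<close>. For \<open>g = vw\<close> with commuting parts \<open>v\<close>, \<open>w\<close> the same induction
  gives \<open>\<langle>A, g\<rangle> = \<langle>A, v\<rangle>\<langle>A, w\<rangle>\<close>, where the two factors meet in \<open>A\<close> and normalize \<open>X\<close> and \<open>Y\<close>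
  respectively. It follows that all conjugates of \<open>X \<inter> Y\<close> lie in \<open>A\<close> (\<open>tau_parts_conj_in\<close>), so
  \<open>X \<inter> Y = 1\<close> and \<open>A = X \<times> Y\<close> with a \<open>Q\<close>-group \<open>X\<close> and a \<open>P\<close>-group \<open>Y\<close>. The normal closure
  \<open>X\<^sup>G\<close> is still a \<open>Q\<close>-group (\<open>normal_closure_tau_elem\<close>): modulo a normal \<open>Q\<close>-subgroup it is a central
  extension of a \<open>P\<close>-group by a \<open>Q\<close>-group that is generated by \<open>Q\<close>-elements, and the transfer shows
  that the central \<open>P\<close>-group is trivial. The heart of the proof is that \<open>P\<close>-elements centralize
  \<open>X\<^sup>G\<close>: if \<open>v\<close> is a \<open>p\<close>-element with \<open>p \<in> P\<close>, the Frattini argument writes each conjugate of \<open>X\<close> as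
  \<open>X\<^sup>s\<close> with a \<open>Q\<close>-element \<open>s\<close> normalizing a Sylow \<open>p\<close>-subgroup that contains \<open>v\<close>, and modularity of
  \<open>A\<close> in \<open>\<langle>A, s\<rangle>\<close> forces \<open>[v, X\<^sup>s] \<le> X\<close> (\<open>commutator_in_tau_part\<close>). So all conjugates of \<open>[v, x]\<close>
  lie in \<open>A\<close>, whence \<open>[v, x] = 1\<close>.

  Conclusion. Applied to \<open>G/A\<^sub>G\<close> this yields normal subgroups \<open>L\<close>, \<open>M\<close> of \<open>G\<close> with \<open>A\<^sup>G = LM\<close> such that
  \<open>L/A\<^sub>G\<close> is a \<open>Q\<close>-group centralized by all \<open>P\<close>-elements of \<open>G\<close> and \<open>M/A\<^sub>G\<close> is a \<open>P\<close>-group centralized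
  by all \<open>Q\<close>-elements (\<open>normal_closure_structure\<close>). So \<open>A\<^sup>G/A\<^sub>G\<close> is decomposable; \<open>G/C\<^sub>G(L/A\<^sub>G)\<close> is a
  \<open>Q\<close>-group and \<open>G/C\<^sub>G(M/A\<^sub>G)\<close> a \<open>P\<close>-group, which gives the second half of (ii). A chief factor between
  \<open>A\<^sub>G\<close> and \<open>A\<^sup>G\<close> is covered by \<open>L\<close> or by \<open>M\<close>, and inherits the centralizing elements; this is (iii).
\<close>

section \<open>Numbers and elements with prescribed prime divisors\<close>

definition tau_number :: "nat set \<Rightarrow> nat \<Rightarrow> bool"
  where "tau_number \<tau> n \<longleftrightarrow> n > 0 \<and> (\<forall>p. prime p \<longrightarrow> p dvd n \<longrightarrow> p \<in> \<tau>)"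

definition complementary :: "nat set \<Rightarrow> nat set \<Rightarrow> bool"
  where "complementary P Q \<longleftrightarrow> (\<forall>p. prime p \<longrightarrow> p \<in> P \<longleftrightarrow> p \<notin> Q)"

lemma complementary_sym: "complementary P Q \<Longrightarrow> complementary Q P"
  by (auto simp: complementary_def)

lemma tau_number_1 [simp]: "tau_number \<tau> (Suc 0)"
  by (auto simp: tau_number_def)

lemma tau_number_mult: "tau_number \<tau> m \<Longrightarrow> tau_number \<tau> n \<Longrightarrow> tau_number \<tau> (m * n)"
  by (auto simp: tau_number_def prime_dvd_mult_iff)

lemma tau_number_dvd: "tau_number \<tau> n \<Longrightarrow> m dvd n \<Longrightarrow> tau_number \<tau> m"
  by (auto simp: tau_number_def intro: dvd_trans)

lemma tau_number_coprime:
  assumes "complementary P Q" "tau_number P a" "tau_number Q b"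
  shows "coprime a b"
proof (rule ccontr)
  assume "\<not> coprime a b"
  then obtain p where "prime p" "p dvd a" "p dvd b"
    using prime_factor_nat[of "gcd a b"] by (auto simp: coprime_iff_gcd_eq_1)
  with assms show False by (auto simp: complementary_def tau_number_def)
qed

lemma tau_number_factorization:
  assumes "complementary P Q" "n > 0"
  shows "\<exists>a b. n = a * b \<and> tau_number P a \<and> tau_number Q b"
  using assms(2)
proof (induction n rule: less_induct)
  case (less n)
  show ?case
  proof (cases "n = 1")
    case True
    then show ?thesis by (intro exI[of _ 1]) auto
  next
    case False
    then obtain p where p: "prime p" "p dvd n" using prime_factor_nat by blast
    then obtain k where k: "n = p * k" by auto
    with less.prems p(1) have "k < n" "0 < k" by (auto dest: prime_gt_1_nat)
    then obtain a b where ab: "k = a * b" "tau_number P a" "tau_number Q b"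
      using less.IH by blast
    have tp: "tau_number \<tau> p" if "p \<in> \<tau>" for \<tau>
      using p(1) that by (auto simp: tau_number_def prime_gt_0_nat dest: primes_dvd_imp_eq)
    have "p \<in> P \<or> p \<in> Q" using assms(1) p(1) by (auto simp: complementary_def)
    then show ?thesis
    proof
      assume "p \<in> P"
      with ab k tp show ?thesis
        by (intro exI[of _ "p * a"] exI[of _ b]) (auto intro: tau_number_mult)
    next
      assume "p \<in> Q"
      with ab k tp show ?thesis
        by (intro exI[of _ a] exI[of _ "p * b"]) (auto intro: tau_number_mult)
    qed
  qed
qed

text \<open>
  If \<open>K\<close> is normal, \<open>x\<close> satisfies this predicate iff the order of its coset in the quotient by \<open>K\<close> has
  all its prime divisors in \<open>\<tau>\<close>. Working with powers avoids forming the quotient.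
\<close>

definition tau_elem_mod :: "('a, 'b) monoid_scheme \<Rightarrow> nat set \<Rightarrow> 'a set \<Rightarrow> 'a \<Rightarrow> bool"
  where "tau_elem_mod G \<tau> K x \<longleftrightarrow> x \<in> carrier G \<and> (\<exists>k. tau_number \<tau> k \<and> x [^]\<^bsub>G\<^esub> k \<in> K)"

abbreviation tau_elem :: "('a, 'b) monoid_scheme \<Rightarrow> nat set \<Rightarrow> 'a \<Rightarrow> bool"
  where "tau_elem G \<tau> \<equiv> tau_elem_mod G \<tau> {\<one>\<^bsub>G\<^esub>}"

text \<open>
  For a subgroup \<open>K\<close> of a finite group this is the normalizer of \<open>K\<close>, since conjugation is injective.
  That \<open>T\<close> normalizes \<open>K\<close> becomes the inclusion \<open>T \<subseteq> normalizing G K\<close>.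
\<close>

definition normalizing :: "('a, 'b) monoid_scheme \<Rightarrow> 'a set \<Rightarrow> 'a set"
  where "normalizing G K = {x \<in> carrier G. \<forall>y\<in>K. x \<otimes>\<^bsub>G\<^esub> y \<otimes>\<^bsub>G\<^esub> inv\<^bsub>G\<^esub> x \<in> K}"

lemma tau_elem_mod_carrier: "tau_elem_mod G \<tau> K x \<Longrightarrow> x \<in> carrier G"
  by (simp add: tau_elem_mod_def)

lemma tau_elem_mod_mono: "tau_elem_mod G \<tau> K x \<Longrightarrow> K \<subseteq> L \<Longrightarrow> tau_elem_mod G \<tau> L x"
  by (auto simp: tau_elem_mod_def)

lemma tau_elem_in_subset: "tau_elem G \<tau> x \<Longrightarrow> \<tau> \<subseteq> \<sigma> \<Longrightarrow> tau_elem G \<sigma> x"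
  unfolding tau_elem_mod_def tau_number_def by blast

lemma tau_elem_mod_restrict:
  assumes "H \<subseteq> carrier G"
  shows "tau_elem_mod (G\<lparr>carrier := H\<rparr>) \<tau> K x \<longleftrightarrow> x \<in> H \<and> tau_elem_mod G \<tau> K x"
  using assms by (auto simp: tau_elem_mod_def nat_pow_def)

lemma normalizingD: "x \<in> normalizing G K \<Longrightarrow> y \<in> K \<Longrightarrow> x \<otimes>\<^bsub>G\<^esub> y \<otimes>\<^bsub>G\<^esub> inv\<^bsub>G\<^esub> x \<in> K"
  by (simp add: normalizing_def)

locale finite_group = group +
  assumes fin [simp]: "finite (carrier G)"

context finite_group
begin

lemma cancel_left_inv:
  assumes "x \<in> carrier G" "y \<in> carrier G"
  shows "x \<otimes> (inv x \<otimes> y) = y" "inv x \<otimes> (x \<otimes> y) = y"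
  using assms by (simp_all add: m_assoc[symmetric])

lemma commutator_one_imp_commute:
  assumes "x \<in> carrier G" "y \<in> carrier G" "x \<otimes> y \<otimes> inv x \<otimes> inv y = \<one>"
  shows "x \<otimes> y = y \<otimes> x"
proof -
  have "x \<otimes> y \<otimes> inv x \<otimes> inv y \<otimes> (y \<otimes> x) = y \<otimes> x" using assms by simp
  then show ?thesis using assms(1,2) by (simp add: m_assoc cancel_left_inv)
qed

lemma set_multI: "x \<in> H \<Longrightarrow> y \<in> K \<Longrightarrow> x \<otimes> y \<in> H <#> K"
  by (auto simp: set_mult_def)

lemma finite_subgroupI:
  assumes "S \<subseteq> carrier G" "\<one> \<in> S"
    and mult: "\<And>x y. x \<in> S \<Longrightarrow> y \<in> S \<Longrightarrow> x \<otimes> y \<in> S"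
  shows "subgroup S G"
proof (rule subgroupI)
  fix x assume x: "x \<in> S"
  then have xG: "x \<in> carrier G" using assms(1) by auto
  have pw: "x [^] k \<in> S" for k :: nat
    by (induction k) (use x assms in auto)
  obtain n where n: "order G = Suc n"
    using fin order_gt_0_iff_finite by (metis Suc_pred')
  have "x [^] n \<otimes> x = \<one>"
    using pow_order_eq_1[OF xG] by (simp add: n)
  then have "inv x = x [^] n"
    using xG by (metis inv_equality nat_pow_closed)
  with pw show "inv x \<in> S" by simp
qed (use assms in auto)

lemma subgroup_pow_closed: "subgroup H G \<Longrightarrow> x \<in> H \<Longrightarrow> x [^] (k::nat) \<in> H"
  by (induction k) (auto simp: subgroup.one_closed subgroup.m_closed)

lemma coprime_pow_in_subgroup:
  assumes K: "subgroup K G" and x: "x \<in> carrier G"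
    and "x [^] (a::nat) \<in> K" "x [^] (b::nat) \<in> K" "coprime a b"
  shows "x \<in> K"
proof (cases "a = 0")
  case True
  with assms show ?thesis by auto
next
  case False
  then obtain i j where ij: "a * i = b * j + 1"
    using bezout_nat[of a b] assms(5) by auto
  have "x [^] (a * i) \<in> K" "x [^] (b * j) \<in> K"
    using assms x by (auto simp flip: nat_pow_pow intro: subgroup_pow_closed)
  moreover have "x = inv (x [^] (b * j)) \<otimes> x [^] (a * i)"
    unfolding ij using x by (simp add: inv_solve_left)
  ultimately show ?thesis
    using K by (metis subgroup.m_closed subgroup.m_inv_closed)
qed

lemma complementary_elem_in:
  assumes "complementary P Q" "subgroup K G" "tau_elem_mod G P K x" "tau_elem_mod G Q K x"
  shows "x \<in> K"
proof -
  obtain a b where "tau_number P a" "x [^] a \<in> K" "tau_number Q b" "x [^] b \<in> K"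
    using assms unfolding tau_elem_mod_def by blast
  moreover have "x \<in> carrier G" using assms by (simp add: tau_elem_mod_def)
  ultimately show ?thesis
    using coprime_pow_in_subgroup[OF assms(2)] tau_number_coprime[OF assms(1)] by blast
qed

lemma complementary_elem_one:
  assumes "complementary P Q" "tau_elem G P x" "tau_elem G Q x"
  shows "x = \<one>"
  using complementary_elem_in[OF assms(1) triv_subgroup] assms by auto

lemma tau_elem_in:
  assumes "complementary P Q" "subgroup K G" "tau_elem_mod G P K x" "tau_elem G Q x"
  shows "x \<in> K"
  using assms complementary_elem_in tau_elem_mod_mono[OF assms(4), of K]
  by (simp add: subgroup.one_closed)

lemma conj_pow:
  assumes "g \<in> carrier G" "x \<in> carrier G"
  shows "(g \<otimes> x \<otimes> inv g) [^] (k::nat) = g \<otimes> x [^] k \<otimes> inv g"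
proof (induction k)
  case (Suc k)
  have "g \<otimes> x [^] k \<otimes> inv g \<otimes> (g \<otimes> x \<otimes> inv g) = g \<otimes> x [^] k \<otimes> (inv g \<otimes> g) \<otimes> x \<otimes> inv g"
    using assms by (simp only: m_assoc m_closed inv_closed nat_pow_closed)
  then show ?case using Suc assms by (simp add: m_assoc)
qed (use assms in simp)

lemma tau_elem_one: "tau_elem G \<tau> \<one>"
  using tau_number_1 unfolding tau_elem_mod_def by fastforce

lemma tau_elem_conj:
  assumes "g \<in> carrier G" "tau_elem G \<tau> x"
  shows "tau_elem G \<tau> (g \<otimes> x \<otimes> inv g)"
  using assms unfolding tau_elem_mod_def by (auto simp: conj_pow)

lemma generate_singleton_tau_elem:
  assumes x: "tau_elem G \<tau> x" and y: "y \<in> generate G {x}"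
  shows "tau_elem G \<tau> y"
proof -
  have xG: "x \<in> carrier G" using x by (rule tau_elem_mod_carrier)
  obtain k where k: "tau_number \<tau> k" "x [^] k = \<one>" using x by (auto simp: tau_elem_mod_def)
  obtain i :: int where i: "y = x [^] i" using y generate_pow[OF xG] by auto
  have "y [^] k = (x [^] k) [^] i" using xG unfolding i
    by (metis int_pow_int int_pow_pow mult.commute)
  with k xG i show ?thesis by (auto simp: tau_elem_mod_def)
qed

lemma tau_elem_mod_trans:
  assumes "tau_elem_mod G \<tau> K x" "\<And>y. y \<in> K \<Longrightarrow> tau_elem_mod G \<tau> M y"
  shows "tau_elem_mod G \<tau> M x"
proof -
  obtain k where k: "x \<in> carrier G" "tau_number \<tau> k" "x [^] k \<in> K"
    using assms(1) by (auto simp: tau_elem_mod_def)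
  then obtain l where l: "tau_number \<tau> l" "(x [^] k) [^] l \<in> M"
    using assms(2) by (auto simp: tau_elem_mod_def)
  with k show ?thesis
  by (auto simp: tau_elem_mod_def nat_pow_pow intro!: exI[of _ "k * l"] tau_number_mult)
qed

lemma tau_elem_mult:
  assumes "tau_elem G \<tau> x" "tau_elem G \<tau> y" "x \<otimes> y = y \<otimes> x"
  shows "tau_elem G \<tau> (x \<otimes> y)"
proof -
  obtain k l where kl: "tau_number \<tau> k" "x [^] k = \<one>" "tau_number \<tau> l" "y [^] l = \<one>"
    "x \<in> carrier G" "y \<in> carrier G"
    using assms by (auto simp: tau_elem_mod_def)
  have "x [^] (k * l) = (x [^] k) [^] l" "y [^] (k * l) = (y [^] l) [^] k"
    using kl(5,6) by (simp_all add: nat_pow_pow mult.commute)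
  then have "(x \<otimes> y) [^] (k * l) = \<one>"
    using kl pow_mult_distrib[OF assms(3)] by simp
  with kl show ?thesis by (auto simp: tau_elem_mod_def intro!: exI[of _ "k * l"] tau_number_mult)
qed

text \<open>
  Bezout for the coprime factors \<open>a\<close> (a \<open>P\<close>-number) and \<open>b\<close> (a \<open>Q\<close>-number) of the group order. Both parts
  are powers of \<open>x\<close>, so they commute and lie in every subgroup that contains \<open>x\<close>.
\<close>

lemma tau_elem_factorization:
  assumes "complementary P Q" "x \<in> carrier G"
  obtains i j :: nat where "x = x [^] i \<otimes> x [^] j" "tau_elem G P (x [^] i)" "tau_elem G Q (x [^] j)"
proof -
  define n where "n = order G"
  have n: "n > 0" using fin order_gt_0_iff_finite by (simp add: n_def)
  have xn: "x [^] (n * k) = \<one>" for k :: nat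
    using pow_order_eq_1[OF assms(2)] assms(2) by (simp add: n_def flip: nat_pow_pow)
  obtain a b where ab: "n = a * b" "tau_number P a" "tau_number Q b"
    using tau_number_factorization[OF assms(1) n] by blast
  have "coprime a b" "a \<noteq> 0" using ab tau_number_coprime[OF assms(1)] by (auto simp: tau_number_def)
  then obtain i j where ij: "a * i = b * j + 1"
    using bezout_nat[of a b] by auto
  \<comment> \<open>Bezout gives \<open>a i - b j = 1\<close>; the factor \<open>n - 1\<close> replaces the exponent \<open>- b j\<close> by a
    nonnegative one that is congruent to it modulo \<open>n\<close>.\<close>
  let ?v = "b * j * (n - 1)" and ?w = "a * i"
  have "?v + ?w = n * (b * j) + 1"
    using n ij by (cases n) (auto simp: algebra_simps)
  then have 1: "x [^] ?v \<otimes> x [^] ?w = x"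
    using assms(2) by (simp add: nat_pow_mult xn)
  have "(x [^] ?v) [^] a = x [^] (n * (j * (n - 1)))" "(x [^] ?w) [^] b = x [^] (n * i)"
    using assms(2) ab(1) by (simp_all add: nat_pow_pow algebra_simps)
  then have "(x [^] ?v) [^] a = \<one>" "(x [^] ?w) [^] b = \<one>"
    by (simp_all only: xn)
  with ab assms(2) have "tau_elem G P (x [^] ?v)" "tau_elem G Q (x [^] ?w)"
    unfolding tau_elem_mod_def by (blast intro: nat_pow_closed)+
  with that[of ?v ?w] 1 show ?thesis by simp
qed

text \<open>
  If \<open>C\<close> contains all \<open>Q\<close>-elements, an exponent killing the \<open>P\<close>-part of \<open>x\<close> moves \<open>x\<close> into \<open>C\<close>. For normal \<open>C\<close>
  this says that the quotient by \<open>C\<close> is a \<open>P\<close>-group.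
\<close>

lemma tau_elem_mod_of_complement:
  assumes PQ: "complementary P Q" and C: "subgroup C G" "\<And>w. tau_elem G Q w \<Longrightarrow> w \<in> C"
    and x: "x \<in> carrier G"
  shows "tau_elem_mod G P C x"
proof -
  obtain i j :: nat where ij: "x = x [^] i \<otimes> x [^] j" "tau_elem G P (x [^] i)" "tau_elem G Q (x [^] j)"
    using tau_elem_factorization[OF PQ x] by blast
  obtain k where k: "tau_number P k" "(x [^] i) [^] k = \<one>"
    using ij(2) by (auto simp: tau_elem_mod_def)
  have "x [^] k = (x [^] i \<otimes> x [^] j) [^] k" using ij(1) by simp
  also have "\<dots> = (x [^] i) [^] k \<otimes> (x [^] j) [^] k"
    using x by (intro pow_mult_distrib) (auto simp: nat_pow_mult add.commute)
  also have "\<dots> = (x [^] j) [^] k" using k(2) x by simp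
  also have "\<dots> \<in> C" by (rule subgroup_pow_closed[OF C(1) C(2)[OF ij(3)]])
  finally show ?thesis using k(1) x by (auto simp: tau_elem_mod_def)
qed

lemma normalizing_subset: "normalizing G K \<subseteq> carrier G"
  by (auto simp: normalizing_def)

lemma normalizing_subgroup:
  assumes "K \<subseteq> carrier G"
  shows "subgroup (normalizing G K) G"
proof (rule finite_subgroupI)
  fix x y assume xy: "x \<in> normalizing G K" "y \<in> normalizing G K"
  have "x \<otimes> y \<otimes> k \<otimes> inv (x \<otimes> y) = x \<otimes> (y \<otimes> k \<otimes> inv y) \<otimes> inv x" if "k \<in> K" for k
    using that xy assms by (simp add: normalizing_def m_assoc inv_mult_group subset_iff)
  with xy show "x \<otimes> y \<in> normalizing G K" by (auto simp: normalizing_def)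
qed (use assms in \<open>auto simp: normalizing_def\<close>)

lemma subgroup_normalizing: "subgroup K G \<Longrightarrow> K \<subseteq> normalizing G K"
  by (auto simp: normalizing_def subgroup.mem_carrier subgroup.m_closed subgroup.m_inv_closed)

lemma normal_normalizing: "K \<lhd> G \<longleftrightarrow> subgroup K G \<and> carrier G \<subseteq> normalizing G K"
  by (auto simp: normal_inv_iff normalizing_def)

lemma normal_restrict_iff:
  assumes "subgroup S G"
  shows "K \<lhd> G\<lparr>carrier := S\<rparr> \<longleftrightarrow> subgroup K G \<and> K \<subseteq> S \<and> S \<subseteq> normalizing G K"
proof -
  interpret S: group "G\<lparr>carrier := S\<rparr>" using assms by (rule subgroup_imp_group)
  have "subgroup K (G\<lparr>carrier := S\<rparr>) \<longleftrightarrow> subgroup K G \<and> K \<subseteq> S"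
  proof
    assume K: "subgroup K (G\<lparr>carrier := S\<rparr>)"
    show "subgroup K G \<and> K \<subseteq> S"
      using incl_subgroup[OF assms K] subgroup.subset[OF K] by simp
  next
    assume "subgroup K G \<and> K \<subseteq> S"
    then show "subgroup K (G\<lparr>carrier := S\<rparr>)"
      using subgroup_incl[OF _ assms] by blast
  qed
  moreover have "inv\<^bsub>G\<lparr>carrier := S\<rparr>\<^esub> x = inv x" if "x \<in> S" for x
    using m_inv_consistent[OF assms that] by simp
  ultimately show ?thesis
    using subgroup.subset[OF assms] by (auto simp: S.normal_inv_iff normalizing_def)
qed

lemma normalizing_generateI:
  assumes "S \<subseteq> carrier G" "x \<in> carrier G"
    and "\<And>y. y \<in> S \<Longrightarrow> x \<otimes> y \<otimes> inv x \<in> generate G S"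
  shows "x \<in> normalizing G (generate G S)"
proof -
  interpret gs: subgroup "generate G S" G using assms(1) by (rule generate_is_subgroup)
  have "x \<otimes> y \<otimes> inv x \<in> generate G S" if "y \<in> generate G S" for y
    using that
  proof (induction rule: generate.induct)
    case (inv h)
    have "x \<otimes> inv h \<otimes> inv x = inv (x \<otimes> h \<otimes> inv x)"
      using inv assms by (auto simp: inv_mult_group m_assoc subset_iff)
    with inv assms show ?case by auto
  next
    case (eng h1 h2)
    then have h: "h1 \<in> carrier G" "h2 \<in> carrier G" using gs.subset by auto
    have "(x \<otimes> h1 \<otimes> inv x) \<otimes> (x \<otimes> h2 \<otimes> inv x) = x \<otimes> h1 \<otimes> (inv x \<otimes> x) \<otimes> h2 \<otimes> inv x"
      using h assms by (simp only: m_assoc m_closed inv_closed)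
    then have "x \<otimes> (h1 \<otimes> h2) \<otimes> inv x = (x \<otimes> h1 \<otimes> inv x) \<otimes> (x \<otimes> h2 \<otimes> inv x)"
      using h assms by (simp add: m_assoc)
    with eng show ?case by simp
  qed (use assms in auto)
  with assms(2) show ?thesis by (simp add: normalizing_def)
qed

lemma set_mult_normalized:
  assumes K: "subgroup K G" and T: "subgroup T G" and n: "T \<subseteq> normalizing G K"
  shows "subgroup (K <#> T) G" "K \<subseteq> K <#> T" "T \<subseteq> K <#> T" "T <#> K = K <#> T"
proof -
  interpret K: subgroup K G by fact
  interpret T: subgroup T G by fact
  have n': "t \<otimes> k \<otimes> inv t \<in> K" "inv t \<otimes> k \<otimes> t \<in> K" if "t \<in> T" "k \<in> K" for t k
    using n that normalizingD[of t G K k] normalizingD[of "inv t" G K k] by auto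
  show eq: "T <#> K = K <#> T"
  proof (intro equalityI subsetI)
    fix z assume "z \<in> T <#> K"
    then obtain t k where z: "t \<in> T" "k \<in> K" "z = t \<otimes> k" by (auto simp: set_mult_def)
    then have "z = (t \<otimes> k \<otimes> inv t) \<otimes> t" by (simp add: m_assoc)
    then show "z \<in> K <#> T" using z n' by (metis set_multI)
  next
    fix z assume "z \<in> K <#> T"
    then obtain t k where z: "t \<in> T" "k \<in> K" "z = k \<otimes> t" by (auto simp: set_mult_def)
    then have "z = t \<otimes> (inv t \<otimes> k \<otimes> t)" by (simp add: m_assoc cancel_left_inv)
    then show "z \<in> T <#> K" using z n' by (metis set_multI)
  qed
  show "subgroup (K <#> T) G"
  proof (rule finite_subgroupI)
    fix x y assume "x \<in> K <#> T" "y \<in> K <#> T"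
    then obtain a b c d where x: "x = a \<otimes> b" "y = c \<otimes> d" "a \<in> K" "b \<in> T" "c \<in> K" "d \<in> T"
      by (auto simp: set_mult_def)
    then have "x \<otimes> y = (a \<otimes> (b \<otimes> c \<otimes> inv b)) \<otimes> (b \<otimes> d)"
      by (simp add: m_assoc cancel_left_inv)
    then show "x \<otimes> y \<in> K <#> T"
      using x n'(1)[of b c] by (simp add: set_multI)
  next
    show "\<one> \<in> K <#> T" using set_multI[OF K.one_closed T.one_closed] by simp
  qed (auto simp: set_mult_def)
  show "K \<subseteq> K <#> T" "T \<subseteq> K <#> T"
  proof -
    show "K \<subseteq> K <#> T"
    proof
      fix x assume "x \<in> K"
      then show "x \<in> K <#> T" using set_multI[of x K \<one> T] by simp
    qed
    show "T \<subseteq> K <#> T"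
    proof
      fix x assume "x \<in> T"
      then show "x \<in> K <#> T" using set_multI[of \<one> K x T] by simp
    qed
  qed
qed

lemma coset_pow:
  assumes K: "subgroup K G" and d: "d \<in> normalizing G K" and x: "x \<in> K"
  shows "\<exists>y\<in>K. (x \<otimes> d) [^] (k::nat) = y \<otimes> d [^] k"
proof (induction k)
  case 0
  then show ?case using subgroup.one_closed[OF K] by (intro bexI[of _ \<one>]) auto
next
  case (Suc k)
  then obtain y where y: "y \<in> K" "(x \<otimes> d) [^] k = y \<otimes> d [^] k" by blast
  note [simp] = subgroup.mem_carrier[OF K]
  have dG: "d \<in> carrier G" using d normalizing_subset by blast
  have "d [^] k \<in> normalizing G K"
    using normalizing_subgroup[OF subgroup.subset[OF K]] d by (rule subgroup_pow_closed)
  then have "d [^] k \<otimes> x \<otimes> inv (d [^] k) \<in> K" using x by (rule normalizingD)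
  moreover have "(x \<otimes> d) [^] Suc k = (y \<otimes> (d [^] k \<otimes> x \<otimes> inv (d [^] k))) \<otimes> d [^] Suc k"
    using x y dG by (simp add: m_assoc) (simp add: m_assoc[symmetric])
  ultimately show ?case using y(1) subgroup.m_closed[OF K] by blast
qed

lemma tau_elem_mod_mult:
  assumes K: "subgroup K G" and d: "d \<in> normalizing G K" "tau_elem_mod G \<tau> K d" and x: "x \<in> K"
  shows "tau_elem_mod G \<tau> K (x \<otimes> d)"
proof -
  obtain k where k: "tau_number \<tau> k" "d [^] k \<in> K" using d(2) by (auto simp: tau_elem_mod_def)
  obtain y where y: "y \<in> K" "(x \<otimes> d) [^] k = y \<otimes> d [^] k"
    using coset_pow[OF K d(1) x] by blast
  have "(x \<otimes> d) [^] k \<in> K" unfolding y(2) using y(1) k(2) by (rule subgroup.m_closed[OF K])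
  moreover have "x \<otimes> d \<in> carrier G"
    using subgroup.mem_carrier[OF K x] tau_elem_mod_carrier[OF d(2)] by simp
  ultimately show ?thesis using k(1) by (auto simp: tau_elem_mod_def)
qed

lemma tau_elem_in_normal_factor:
  assumes PQ: "complementary P Q" and L: "L \<lhd> G"
    and M: "\<And>m. m \<in> M \<Longrightarrow> tau_elem_mod G P L m"
    and x: "x \<in> L <#> M" "tau_elem G Q x"
  shows "x \<in> L"
proof -
  obtain l m where lm: "l \<in> L" "m \<in> M" "x = l \<otimes> m" using x(1) by (auto simp: set_mult_def)
  have sL: "subgroup L G" using L by (rule normal_imp_subgroup)
  have "m \<in> normalizing G L"
    using L tau_elem_mod_carrier[OF M[OF lm(2)]] by (auto simp: normal_normalizing)
  then have "tau_elem_mod G P L x" unfolding lm(3)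
    using M[OF lm(2)] lm(1) by (rule tau_elem_mod_mult[OF sL])
  then show ?thesis using x(2) by (rule tau_elem_in[OF PQ sL])
qed

end

section \<open>Indices, Sylow subgroups and the Frattini argument\<close>

lemma (in finite_group) finite_group_restrict: "subgroup H G \<Longrightarrow> finite_group (G\<lparr>carrier := H\<rparr>)"
  using subgroup.subset[of H G] finite_subset[OF _ fin, of H]
  by (simp add: finite_group_def finite_group_axioms_def subgroup_imp_group)

lemma (in finite_group) finite_group_Mod:
  assumes "K \<lhd> G" shows "finite_group (G Mod K)"
  using normal.factorgroup_is_group[OF assms]
  by (simp add: finite_group_def finite_group_axioms_def carrier_FactGroup)

lemma (in finite_group) finite_subgroup: "subgroup H G \<Longrightarrow> finite H"
  using subgroup.subset finite_subset[OF _ fin] by blast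

lemma (in finite_group) card_subgroup_pos: "subgroup H G \<Longrightarrow> card H > 0"
  using finite_subgroup[of H] subgroup.one_closed[of H G] card_gt_0_iff by blast

lemma (in finite_group) cauchy:
  assumes "prime p" "p dvd order G"
  obtains x where "x \<in> carrier G" "x \<noteq> \<one>" "x [^] p = \<one>"
proof -
  obtain m where "order G = p ^ 1 * m" using assms(2) by auto
  then obtain H where H: "subgroup H G" "card H = p"
    using sylow_thm[OF assms(1) is_group _ fin, of 1 m] by auto
  interpret H: finite_group "G\<lparr>carrier := H\<rparr>" using H(1) by (rule finite_group_restrict)
  have "\<exists>x\<in>H. x \<noteq> \<one>"
  proof (rule ccontr)
    assume "\<not> ?thesis"
    then have "H \<subseteq> {\<one>}" by auto
    then have "card H \<le> 1" using card_mono[of "{\<one>}" H] by simp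
    with H(2) prime_gt_1_nat[OF assms(1)] show False by simp
  qed
  then obtain x where x: "x \<in> H" "x \<noteq> \<one>" by auto
  moreover have "x [^] p = \<one>"
    using H.pow_order_eq_1[of x] x H(2) nat_pow_consistent[of x p H] by (simp add: order_def)
  ultimately show ?thesis using that subgroup.mem_carrier[OF H(1)] by blast
qed

lemma (in finite_group) card_subgroup_dvd:
  assumes "subgroup H G" "subgroup K G" "H \<subseteq> K"
  shows "card H dvd card K"
proof -
  interpret K: finite_group "G\<lparr>carrier := K\<rparr>" using assms(2) by (rule finite_group_restrict)
  show ?thesis
    using K.lagrange_finite[OF K.fin subgroup_incl[OF assms]] by (auto simp: order_def dest: sym)
qed

lemma (in finite_group) subgroup_pow_card:
  assumes "subgroup H G" "x \<in> H"
  shows "x [^] card H = \<one>"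
proof -
  interpret H: finite_group "G\<lparr>carrier := H\<rparr>" using assms(1) by (rule finite_group_restrict)
  show ?thesis
    using H.pow_order_eq_1[of x] assms(2) nat_pow_consistent[of x "card H" H]
    by (simp add: order_def)
qed

lemma (in finite_group) tau_elem_card:
  assumes "subgroup H G" "tau_number \<tau> (card H)" "x \<in> H"
  shows "tau_elem G \<tau> x"
  using assms subgroup_pow_card subgroup.mem_carrier unfolding tau_elem_mod_def by fastforce

text \<open>
  By Cauchy's theorem: a prime divisor \<open>p\<close> of the index outside \<open>\<tau>\<close> would give an element of order \<open>p\<close> in
  the quotient, but an exponent prime to \<open>p\<close> kills every element there.
\<close>

lemma (in finite_group) normal_index_tau_number:
  assumes S: "subgroup S G" and K: "subgroup K G" "K \<subseteq> S" "S \<subseteq> normalizing G K"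
    and el: "\<And>x. x \<in> S \<Longrightarrow> tau_elem_mod G \<tau> K x"
  shows "\<exists>n. tau_number \<tau> n \<and> card S = n * card K"
proof -
  let ?S = "G\<lparr>carrier := S\<rparr>"
  interpret S: finite_group ?S using S by (rule finite_group_restrict)
  have N: "K \<lhd> ?S" using normal_restrict_iff[OF S] K by simp
  interpret K: normal K ?S by fact
  interpret F: finite_group "?S Mod K" using N by (rule S.finite_group_Mod)
  have c: "card S = order (?S Mod K) * card K"
    using S.lagrange_finite[OF S.fin K.subgroup_axioms] by (simp add: order_def FactGroup_def)
  have "p \<in> \<tau>" if p: "prime p" "p dvd order (?S Mod K)" for p
  proof (rule ccontr)
    assume np: "p \<notin> \<tau>"
    obtain X where X: "X \<in> carrier (?S Mod K)" "X \<noteq> \<one>\<^bsub>?S Mod K\<^esub>" "X [^]\<^bsub>?S Mod K\<^esub> p = \<one>\<^bsub>?S Mod K\<^esub>"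
      using F.cauchy[OF p] by blast
    obtain x where x: "x \<in> S" "X = K #>\<^bsub>?S\<^esub> x" using X(1) by (auto simp: carrier_FactGroup)
    have "K #>\<^bsub>?S\<^esub> (x [^] p) = K"
      using X(3) K.FactGroup_pow[of x p] x by (simp flip: nat_pow_consistent)
    then have xp: "x [^] p \<in> K"
      using x S.coset_join1[OF _ _ K.subgroup_axioms, of "x [^] p"] K subgroup_pow_closed[OF S, of x p]
      by simp
    obtain k where k: "tau_number \<tau> k" "x [^] k \<in> K"
      using el[OF x(1)] by (auto simp: tau_elem_mod_def)
    have "coprime p k" using np k(1) p(1) by (auto simp: tau_number_def intro: prime_imp_coprime)
    then have "x \<in> K"
      using coprime_pow_in_subgroup[OF K(1) _ xp k(2)] x subgroup.mem_carrier[OF S] by blast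
    then have "X = K" using x S.coset_join2[OF _ K.subgroup_axioms, of x] by simp
    with X(2) show False by simp
  qed
  then have "tau_number \<tau> (order (?S Mod K))"
    using F.order_gt_0_iff_finite by (simp add: tau_number_def)
  with c show ?thesis by blast
qed

lemma (in finite_group) card_tau_number:
  assumes S: "subgroup S G" and "\<And>x. x \<in> S \<Longrightarrow> tau_elem G \<tau> x"
  shows "tau_number \<tau> (card S)"
proof -
  have "S \<subseteq> normalizing G {\<one>}" using subgroup.subset[OF S] by (auto simp: normalizing_def)
  then have "\<exists>n. tau_number \<tau> n \<and> card S = n * card {\<one>}"
    using assms subgroup.one_closed[OF S]
    by (intro normal_index_tau_number) (auto simp: triv_subgroup)
  then show ?thesis by auto
qed

lemma (in finite_group) card_subgroup_mult:
  assumes H: "subgroup H G" and K: "subgroup K G"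
  shows "card (H <#> K) * card (H \<inter> K) = card H * card K"
proof -
  interpret H: subgroup H G by fact
  interpret K: subgroup K G by fact
  let ?f = "\<lambda>z. fst z \<otimes> snd z"
  have im: "?f ` (H \<times> K) = H <#> K" by (force simp: set_mult_def)
  have fib: "card {z \<in> H \<times> K. ?f z = y} = card (H \<inter> K)" if y: "y \<in> H <#> K" for y
  proof -
    obtain h k where hk: "h \<in> H" "k \<in> K" "y = h \<otimes> k" using y by (auto simp: set_mult_def)
    have "bij_betw (\<lambda>d. (h \<otimes> d, inv d \<otimes> k)) (H \<inter> K) {z \<in> H \<times> K. ?f z = y}"
    proof (rule bij_betw_byWitness[where f' = "\<lambda>z. inv h \<otimes> fst z"])
      show "\<forall>d\<in>H \<inter> K. inv h \<otimes> fst (h \<otimes> d, inv d \<otimes> k) = d"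
        using hk by (auto simp: m_assoc[symmetric])
      show "(\<lambda>d. (h \<otimes> d, inv d \<otimes> k)) ` (H \<inter> K) \<subseteq> {z \<in> H \<times> K. ?f z = y}"
        using hk by (auto simp: m_assoc) (simp add: m_assoc[symmetric])
      have 1: "inv h \<otimes> a = k \<otimes> inv b \<and> inv (inv h \<otimes> a) \<otimes> k = b" if "a \<in> H" "b \<in> K" "a \<otimes> b = h \<otimes> k" for a b
      proof -
        have "inv h \<otimes> (a \<otimes> b) = k" using that hk by (simp add: m_assoc[symmetric])
        then have e: "inv h \<otimes> a \<otimes> b = k" using that hk by (simp add: m_assoc)
        then have "inv h \<otimes> a = k \<otimes> inv b" using that hk by (simp add: inv_solve_right)
        moreover have "inv (inv h \<otimes> a) \<otimes> k = b" unfolding e[symmetric]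
          using that(1,2) hk by (simp add: inv_mult_group m_assoc cancel_left_inv)
        ultimately show ?thesis by simp
      qed
      have 2: "h \<otimes> (inv h \<otimes> a) = a" if "a \<in> H" for a using that hk by (simp add: m_assoc[symmetric])
      show "\<forall>z\<in>{z \<in> H \<times> K. ?f z = y}. (h \<otimes> (inv h \<otimes> fst z), inv (inv h \<otimes> fst z) \<otimes> k) = z"
        using 1 2 hk by auto
      show "(\<lambda>z. inv h \<otimes> fst z) ` {z \<in> H \<times> K. ?f z = y} \<subseteq> H \<inter> K"
      proof
        fix d assume "d \<in> (\<lambda>z. inv h \<otimes> fst z) ` {z \<in> H \<times> K. ?f z = y}"
        then obtain a b where ab: "a \<in> H" "b \<in> K" "a \<otimes> b = h \<otimes> k" "d = inv h \<otimes> a" using hk by auto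
        with 1[of a b] hk have "d = k \<otimes> inv b" by simp
        with ab hk show "d \<in> H \<inter> K"
        by (metis H.m_closed H.m_inv_closed IntI K.m_closed K.m_inv_closed)
      qed
    qed
    then show ?thesis by (rule bij_betw_same_card[symmetric])
  qed
  have "card H * card K = (\<Sum>z\<in>H \<times> K. 1)" by (simp add: card_cartesian_product)
  also have "\<dots> = (\<Sum>y\<in>?f ` (H \<times> K). \<Sum>z\<in>{z \<in> H \<times> K. ?f z = y}. 1)"
    using assms finite_subgroup by (intro sum.image_gen) auto
  also have "\<dots> = (\<Sum>y\<in>H <#> K. card (H \<inter> K))"
    unfolding im by (intro sum.cong) (auto simp del: mem_Collect_eq simp: fib)
  finally show ?thesis by simp
qed

lemma (in group) subgroup_conj_image:
  assumes "subgroup H G" "g \<in> carrier G"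
  shows "subgroup ((\<lambda>x. g \<otimes> x \<otimes> inv g) ` H) G"
proof -
  have "(\<lambda>x. g \<otimes> x \<otimes> inv g) \<in> hom G G"
  proof (rule homI)
    fix x y assume xy: "x \<in> carrier G" "y \<in> carrier G"
    have "(g \<otimes> x \<otimes> inv g) \<otimes> (g \<otimes> y \<otimes> inv g) = g \<otimes> x \<otimes> (inv g \<otimes> g) \<otimes> y \<otimes> inv g"
      using xy assms(2) by (simp only: m_assoc m_closed inv_closed)
    then show "g \<otimes> (x \<otimes> y) \<otimes> inv g = (g \<otimes> x \<otimes> inv g) \<otimes> (g \<otimes> y \<otimes> inv g)"
      using xy assms(2) by (simp add: m_assoc)
  qed (use assms in auto)
  then interpret group_hom G G "\<lambda>x. g \<otimes> x \<otimes> inv g"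
    by (simp add: group_hom_def group_hom_axioms_def is_group)
  show ?thesis using subgroup_img_is_subgroup[OF assms(1)] .
qed

lemma (in group) card_conj_image:
  assumes "H \<subseteq> carrier G" "g \<in> carrier G"
  shows "card ((\<lambda>x. g \<otimes> x \<otimes> inv g) ` H) = card H"
  by (rule card_image) (use assms in \<open>auto simp: inj_on_def subset_iff\<close>)


text \<open>
  The double cosets \<open>W x V\<close> partition \<open>G\<close>, and \<open>|W x V| = |V| |W : W \<inter> x V x\<inverse>|\<close>. If no conjugate of \<open>V\<close>
  contained the \<open>p\<close>-group \<open>W\<close>, all these indices would be divisible by \<open>p\<close>, and so would \<open>|G : V|\<close>.
\<close>

lemma (in finite_group) sylow_conjugate:
  assumes p: "prime p" and V: "subgroup V G" and m: "order G = card V * m" "\<not> p dvd m"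
    and W: "subgroup W G" "tau_number {p} (card W)"
  obtains g where "g \<in> carrier G" "W \<subseteq> (\<lambda>x. g \<otimes> x \<otimes> inv g) ` V"
proof (rule ccontr)
  note [simp] = subgroup.mem_carrier[OF V] subgroup.mem_carrier[OF W(1)]
  assume no: "\<not> thesis"
  define r where "r = {(x, y). x \<in> carrier G \<and> y \<in> carrier G \<and> (\<exists>w\<in>W. \<exists>v\<in>V. y = w \<otimes> x \<otimes> v)}"
  have "equiv (carrier G) r"
  proof (rule equivI)
    show "r \<subseteq> carrier G \<times> carrier G" by (auto simp: r_def)
    show "refl_on (carrier G) r"
    proof (rule refl_onI)
      fix x assume "x \<in> carrier G"
      then have "x = \<one> \<otimes> x \<otimes> \<one>" by simp
      with \<open>x \<in> carrier G\<close> show "(x, x) \<in> r"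
        unfolding r_def using subgroup.one_closed[OF V] subgroup.one_closed[OF W(1)] by blast
    qed
    show "sym r"
    proof (rule symI)
      fix x y assume "(x, y) \<in> r"
      then obtain w v where wv: "x \<in> carrier G" "y \<in> carrier G" "w \<in> W" "v \<in> V" "y = w \<otimes> x \<otimes> v"
        by (auto simp: r_def)
      then have "x = inv w \<otimes> y \<otimes> inv v" by (simp add: m_assoc cancel_left_inv)
      with wv show "(y, x) \<in> r"
        unfolding r_def using subgroup.m_inv_closed[OF V] subgroup.m_inv_closed[OF W(1)] by blast
    qed
    show "trans r"
    proof (rule transI)
      fix x y z assume "(x, y) \<in> r" "(y, z) \<in> r"
      then obtain w v w' v' where wv: "x \<in> carrier G" "z \<in> carrier G" "w \<in> W" "v \<in> V" "w' \<in> W" "v' \<in> V"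
        "z = w' \<otimes> (w \<otimes> x \<otimes> v) \<otimes> v'"
        by (auto simp: r_def)
      then have "z = (w' \<otimes> w) \<otimes> x \<otimes> (v \<otimes> v')" by (simp add: m_assoc)
      with wv show "(x, z) \<in> r"
        unfolding r_def using subgroup.m_closed[OF V] subgroup.m_closed[OF W(1)] by blast
    qed
  qed
  then have "p * card V dvd card (carrier G)"
  proof (rule equiv_imp_dvd_card[OF fin])
    fix C assume "C \<in> carrier G // r"
    then obtain x where x: "x \<in> carrier G" "C = r `` {x}" by (auto elim: quotientE)
    let ?V = "(\<lambda>v. x \<otimes> v \<otimes> inv x) ` V"
    have sV: "subgroup ?V G" using V x(1) by (rule subgroup_conj_image)
    have cV: "card ?V = card V" using subgroup.subset[OF V] x(1) by (rule card_conj_image)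
    have "C = (\<lambda>y. y \<otimes> x) ` (W <#> ?V)"
    proof -
      have "w \<otimes> (x \<otimes> v \<otimes> inv x) \<otimes> x = w \<otimes> x \<otimes> v" if "w \<in> W" "v \<in> V" for w v
        using that x(1) by (simp add: m_assoc)
      then show ?thesis using x by (force simp: r_def set_mult_def image_iff)
    qed
    moreover have "inj_on (\<lambda>y. y \<otimes> x) (W <#> ?V)"
      using x(1) sV W(1) by (intro inj_onI) (auto simp: set_mult_def dest: subgroup.mem_carrier)
    ultimately have C: "card C = card (W <#> ?V)" by (simp add: card_image)
    have sI: "subgroup (W \<inter> ?V) G" using W(1) sV by (rule subgroups_Inter_pair)
    have "card (W \<inter> ?V) dvd card W" using sI W(1) by (rule card_subgroup_dvd) simp
    then obtain k where k: "card W = card (W \<inter> ?V) * k" by auto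
    have "\<not> W \<subseteq> ?V" using no that x(1) by blast
    then have "W \<inter> ?V \<subset> W" by blast
    then have "card (W \<inter> ?V) < card W"
      using finite_subgroup[OF W(1)] by (simp add: psubset_card_mono)
    with k have "k \<noteq> 1" by auto
    then obtain q where q: "prime q" "q dvd k" using prime_factor_nat by blast
    with k W(2) have "q = p" by (auto simp: tau_number_def)
    with q have "p dvd k" by simp
    have "card (W <#> ?V) * card (W \<inter> ?V) = card W * card V"
      using card_subgroup_mult[OF W(1) sV] by (simp add: cV)
    moreover have "card (W \<inter> ?V) > 0" using card_subgroup_pos[OF sI] .
    ultimately have "card (W <#> ?V) = k * card V" using k by simp
    with \<open>p dvd k\<close> C show "p * card V dvd card C" by simp
  qed
  moreover have "card V > 0" using card_subgroup_pos[OF V] .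
  ultimately show False using m by (simp add: order_def mult.commute)
qed

text \<open>
  \<open>V\<close> is a Sylow \<open>p\<close>-subgroup of \<open>R\<close>. A conjugate of it under \<open>G\<close> is again one of \<open>R\<close>, hence a conjugate
  under \<open>R\<close>.
\<close>

lemma (in finite_group) frattini:
  assumes R: "R \<lhd> G" and p: "prime p" and x: "x \<in> R" "tau_elem G {p} x"
  obtains V where "subgroup V G" "V \<subseteq> R" "x \<in> V" "tau_number {p} (card V)"
    "\<And>g. g \<in> carrier G \<Longrightarrow> \<exists>r\<in>R. \<exists>n\<in>normalizing G V. g = r \<otimes> n"
proof -
  let ?R = "G\<lparr>carrier := R\<rparr>"
  interpret R: normal R G by fact
  interpret R': finite_group ?R using R.subgroup_axioms by (rule finite_group_restrict)
  have Rinv: "inv\<^bsub>?R\<^esub> r = inv r" if "r \<in> R" for r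
    using m_inv_consistent[OF R.subgroup_axioms that] by simp
  have sub: "subgroup H ?R \<longleftrightarrow> subgroup H G \<and> H \<subseteq> R" for H
    using incl_subgroup[OF R.subgroup_axioms] subgroup_incl[OF _ R.subgroup_axioms] subgroup.subset[of H ?R]
    by auto
  have "card R > 0" using R'.order_gt_0_iff_finite finite_subgroup[OF R.subgroup_axioms]
    by (simp add: order_def)
  then obtain a m where am: "card R = p ^ a * m" "\<not> p dvd m"
    using multiplicity_decompose'[of "card R" p] p by (metis not_gr0 not_prime_unit)
  obtain V0 where V0: "subgroup V0 ?R" "card V0 = p ^ a"
    using sylow_thm[OF p R'.is_group, of a m] am finite_subgroup[OF R.subgroup_axioms]
    by (auto simp: order_def)
  let ?X = "generate G {x}"
  have xG: "x \<in> carrier G" using x(1) by simp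
  have X: "subgroup ?X G" using xG by (intro generate_is_subgroup) auto
  have Xp: "tau_elem G {p} y" if "y \<in> ?X" for y
    using x(2) that by (rule generate_singleton_tau_elem)
  have XR: "?X \<subseteq> R" using x(1) by (intro generate_subgroup_incl[OF _ R.subgroup_axioms]) auto
  have conj: "\<exists>r\<in>R. W \<subseteq> (\<lambda>v. r \<otimes> v \<otimes> inv r) ` V"
    if WV: "subgroup W G" "W \<subseteq> R" "tau_number {p} (card W)" "subgroup V G" "V \<subseteq> R" "card V = p ^ a" for W V
  proof -
    obtain r where "r \<in> R" "W \<subseteq> (\<lambda>v. r \<otimes>\<^bsub>?R\<^esub> v \<otimes>\<^bsub>?R\<^esub> inv\<^bsub>?R\<^esub> r) ` V"
      using R'.sylow_conjugate[OF p, of V m W] WV sub am by (auto simp: order_def)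
    then show ?thesis by (auto simp: Rinv)
  qed
  obtain r where r: "r \<in> R" "?X \<subseteq> (\<lambda>v. r \<otimes> v \<otimes> inv r) ` V0"
    using conj[OF X XR card_tau_number[OF X Xp]] V0 sub by blast
  define V where "V = (\<lambda>v. r \<otimes> v \<otimes> inv r) ` V0"
  have V0G: "subgroup V0 G" "V0 \<subseteq> R" using V0 sub by auto
  have V: "subgroup V G" unfolding V_def using V0G(1) r by (intro subgroup_conj_image) auto
  have VR: "V \<subseteq> R" using r(1) V0G(2) by (auto simp: V_def)
  have cV: "card V = p ^ a"
    unfolding V_def using V0 r(1) subgroup.subset[OF V0G(1)] by (subst card_conj_image) auto
  have tp: "tau_number {p} (p ^ a)"
    using p by (auto simp: tau_number_def prime_gt_0_nat dest: prime_dvd_power primes_dvd_imp_eq)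
  show ?thesis
  proof (rule that[OF V VR])
    show "x \<in> V" using r(2) by (auto simp: V_def intro: generate.incl)
    show "tau_number {p} (card V)" using tp cV by simp
    fix g assume g: "g \<in> carrier G"
    let ?W = "(\<lambda>v. g \<otimes> v \<otimes> inv g) ` V"
    have "?W \<subseteq> R" using VR g R.inv_op_closed2 by auto
    moreover have "card ?W = p ^ a" using cV subgroup.subset[OF V] g by (simp add: card_conj_image)
    ultimately obtain r where r: "r \<in> R" "?W \<subseteq> (\<lambda>v. r \<otimes> v \<otimes> inv r) ` V"
      using conj[OF subgroup_conj_image[OF V g]] tp V VR cV by metis
    have "inv r \<otimes> g \<in> normalizing G V"
      unfolding normalizing_def
    proof (intro CollectI conjI ballI)
      fix v assume v: "v \<in> V"
      then obtain u where u: "u \<in> V" "g \<otimes> v \<otimes> inv g = r \<otimes> u \<otimes> inv r" using r(2) by auto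
      have G: "u \<in> carrier G" "v \<in> carrier G" "r \<in> carrier G"
        using u v r subgroup.mem_carrier[OF V] by auto
      have "inv r \<otimes> g \<otimes> v \<otimes> inv (inv r \<otimes> g) = inv r \<otimes> (g \<otimes> v \<otimes> inv g) \<otimes> r"
        using G g by (simp add: m_assoc inv_mult_group)
      also have "\<dots> = u" unfolding u(2) using G by (simp add: m_assoc cancel_left_inv)
      finally show "inv r \<otimes> g \<otimes> v \<otimes> inv (inv r \<otimes> g) \<in> V" using u(1) by simp
    qed (use r g in auto)
    moreover have "g = r \<otimes> (inv r \<otimes> g)" using r g by (simp add: cancel_left_inv)
    ultimately show "\<exists>r\<in>R. \<exists>n\<in>normalizing G V. g = r \<otimes> n" using r(1) by blast
  qed
qed

section \<open>Quotients of finite groups\<close>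

lemma (in group_hom) tau_elem_mod_hom:
  "tau_elem_mod G \<tau> K x \<Longrightarrow> tau_elem_mod H \<tau> (h ` K) (h x)"
  unfolding tau_elem_mod_def by (auto simp: hom_nat_pow[symmetric])

lemma (in finite_group) tau_group_iff:
  assumes "subgroup H G"
  shows "tau_group \<tau> (G\<lparr>carrier := H\<rparr>) \<longleftrightarrow> (\<forall>x\<in>H. tau_elem G \<tau> x)"
proof -
  interpret H: finite_group "G\<lparr>carrier := H\<rparr>" using assms by (rule finite_group_restrict)
  have "tau_group \<tau> (G\<lparr>carrier := H\<rparr>) \<longleftrightarrow> tau_number \<tau> (card H)"
    using H.order_gt_0_iff_finite H.is_group finite_subgroup[OF assms]
    by (auto simp: tau_group_def tau_number_def order_def)
  then show ?thesis using tau_elem_card[OF assms] card_tau_number[OF assms] by blast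
qed

text \<open>
  A surjective homomorphism \<open>h\<close> with kernel \<open>N\<close>. It is kept apart from the concrete map \<open>x \<mapsto> N x\<close> so that
  cosets are handled as elements of a group and not as sets.
\<close>

locale finite_quotient = group_hom G H h + finite_group G
  for G (structure) and H :: "('c, 'd) monoid_scheme" (structure) and h +
  fixes N
  assumes surj: "h ` carrier G = carrier H"
    and N: "N \<lhd> G"
    and ker: "\<And>x. x \<in> carrier G \<Longrightarrow> h x = \<one>\<^bsub>H\<^esub> \<longleftrightarrow> x \<in> N"
begin

lemma finite_group_image: "finite_group H"
  using surj fin by (simp add: finite_group_def finite_group_axioms_def flip: surj)

lemma eq_imp_mult:
  assumes "x \<in> carrier G" "y \<in> carrier G" "h x = h y"
  shows "\<exists>n\<in>N. x = n \<otimes> y"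
proof -
  have "h (x \<otimes> inv y) = \<one>\<^bsub>H\<^esub>" using assms by simp
  then have "x \<otimes> inv y \<in> N" using ker[of "x \<otimes> inv y"] assms by simp
  moreover have "x = (x \<otimes> inv y) \<otimes> y" using assms by (simp add: G.m_assoc)
  ultimately show ?thesis by blast
qed

lemma commutator_in:
  assumes "x \<in> carrier G" "y \<in> carrier G" "h x \<otimes>\<^bsub>H\<^esub> h y = h y \<otimes>\<^bsub>H\<^esub> h x"
  shows "x \<otimes> y \<otimes> inv x \<otimes> inv y \<in> N"
proof -
  have "h (x \<otimes> y) = h (y \<otimes> x)" using assms by simp
  then obtain n where n: "n \<in> N" "x \<otimes> y = n \<otimes> (y \<otimes> x)"
    using eq_imp_mult[of "x \<otimes> y" "y \<otimes> x"] assms by auto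
  have "n \<in> carrier G" using n(1) N normal_imp_subgroup subgroup.mem_carrier by metis
  then have "x \<otimes> y \<otimes> inv x \<otimes> inv y = n" unfolding n(2)
    using assms by (simp add: G.m_assoc cancel_left_inv)
  with n(1) show ?thesis by simp
qed

lemma commute_image:
  assumes "x \<in> carrier G" "y \<in> carrier G" "x \<otimes> y \<otimes> inv x \<otimes> inv y \<in> N"
  shows "h x \<otimes>\<^bsub>H\<^esub> h y = h y \<otimes>\<^bsub>H\<^esub> h x"
proof -
  have c: "x \<otimes> y \<otimes> inv x \<otimes> inv y \<in> carrier G" using assms by simp
  have "x \<otimes> y = (x \<otimes> y \<otimes> inv x \<otimes> inv y) \<otimes> (y \<otimes> x)"
    using assms(1,2) by (simp add: G.m_assoc cancel_left_inv)
  then have "h (x \<otimes> y) = h (x \<otimes> y \<otimes> inv x \<otimes> inv y) \<otimes>\<^bsub>H\<^esub> h (y \<otimes> x)"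
    using hom_mult[OF c, of "y \<otimes> x"] assms(1,2) by simp
  moreover have "h (x \<otimes> y \<otimes> inv x \<otimes> inv y) = \<one>\<^bsub>H\<^esub>" using ker[OF c] assms(3) by simp
  ultimately show ?thesis using assms(1,2) by simp
qed

lemma image_saturated:
  assumes S: "subgroup S G" "N \<subseteq> S" and x: "x \<in> carrier G" "h x \<in> h ` S"
  shows "x \<in> S"
proof -
  obtain s where s: "s \<in> S" "h x = h s" using x(2) by auto
  then obtain n where "n \<in> N" "x = n \<otimes> s"
    using eq_imp_mult[OF x(1) subgroup.mem_carrier[OF S(1)]] by blast
  with s S show ?thesis by (auto intro: subgroup.m_closed)
qed

lemma tau_elem_iff:
  assumes "x \<in> carrier G"
  shows "tau_elem H \<tau> (h x) \<longleftrightarrow> tau_elem_mod G \<tau> N x"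
  using assms by (auto simp: tau_elem_mod_def ker simp flip: hom_nat_pow)

definition preimage :: "'c set \<Rightarrow> 'a set"
  where "preimage S = {x \<in> carrier G. h x \<in> S}"

lemma preimage_subgroup: "subgroup S H \<Longrightarrow> subgroup (preimage S) G"
  unfolding preimage_def
  by (rule finite_subgroupI) (auto simp: subgroup.one_closed subgroup.m_closed)

lemma preimage_normal:
  assumes "S \<lhd> H" shows "preimage S \<lhd> G"
proof (rule G.normal_invI)
  show "subgroup (preimage S) G" using assms by (intro preimage_subgroup normal_imp_subgroup)
qed (auto simp: preimage_def normal.inv_op_closed2[OF assms])

lemma N_subset_preimage: "subgroup S H \<Longrightarrow> N \<subseteq> preimage S"
  using ker[THEN iffD2] subgroup.subset[OF normal_imp_subgroup[OF N]] subgroup.one_closed[of S H]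
  by (auto simp: preimage_def subset_iff)

lemma image_preimage:
  assumes "S \<subseteq> carrier H" shows "h ` preimage S = S"
proof
  show "S \<subseteq> h ` preimage S"
  proof
    fix y assume y: "y \<in> S"
    then have "y \<in> h ` carrier G" using assms surj by blast
    then show "y \<in> h ` preimage S" using y by (auto simp: preimage_def)
  qed
qed (auto simp: preimage_def)

lemma image_normal:
  assumes "S \<lhd> G" shows "h ` S \<lhd> H"
proof -
  interpret H: finite_group H by (rule finite_group_image)
  interpret S: normal S G by fact
  show ?thesis
  proof (rule H.normal_invI)
    show "subgroup (h ` S) H" using S.subgroup_axioms by (rule subgroup_img_is_subgroup)
    fix g x assume gx: "g \<in> carrier H" "x \<in> h ` S"
    then obtain a s where "a \<in> carrier G" "g = h a" "s \<in> S" "x = h s" by (auto simp flip: surj)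
    moreover from this have "h (a \<otimes> s \<otimes> inv a) \<in> h ` S" by (intro imageI S.inv_op_closed2)
    ultimately show "g \<otimes>\<^bsub>H\<^esub> x \<otimes>\<^bsub>H\<^esub> inv\<^bsub>H\<^esub> g \<in> h ` S" by simp
  qed
qed

lemma image_normalizing:
  assumes "T \<subseteq> normalizing G S" "S \<subseteq> carrier G"
  shows "h ` T \<subseteq> normalizing H (h ` S)"
proof
  fix t assume "t \<in> h ` T"
  then obtain a where a: "a \<in> T" "t = h a" by auto
  have aG: "a \<in> carrier G" using a assms(1) by (auto simp: normalizing_def)
  have "h a \<otimes>\<^bsub>H\<^esub> h s \<otimes>\<^bsub>H\<^esub> inv\<^bsub>H\<^esub> h a \<in> h ` S" if s: "s \<in> S" for s
  proof -
    have "h (a \<otimes> s \<otimes> inv a) \<in> h ` S" using assms(1) a(1) s by (blast intro: normalizingD)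
    then show ?thesis using s aG assms(2) by (auto simp: subset_iff)
  qed
  then show "t \<in> normalizing H (h ` S)" using a aG by (auto simp: normalizing_def)
qed

end

lemma (in finite_group) quotient_hom:
  assumes "N \<lhd> G"
  shows "finite_quotient G (G Mod N) (\<lambda>x. N #> x) N"
proof -
  interpret N: normal N G by fact
  have "group_hom G (G Mod N) (\<lambda>x. N #> x)"
    using N.r_coset_hom_Mod N.factorgroup_is_group is_group
    by (simp add: group_hom_def group_hom_axioms_def)
  moreover have "N #> x = \<one>\<^bsub>G Mod N\<^esub> \<longleftrightarrow> x \<in> N" if "x \<in> carrier G" for x
    using that coset_join1[of N x] coset_join2[of x N] N.subset N.subgroup_axioms by auto
  ultimately show ?thesis
    using assms finite_group_axioms
    by (intro finite_quotient.intro finite_quotient_axioms.intro) (auto simp: carrier_FactGroup)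
qed

lemma (in finite_group) tau_group_Mod_iff:
  assumes "N \<lhd> G"
  shows "tau_group \<tau> (G Mod N) \<longleftrightarrow> (\<forall>x\<in>carrier G. tau_elem_mod G \<tau> N x)"
proof -
  define F where "F = G Mod N"
  define h where "h = (\<lambda>x. N #> x)"
  interpret F: finite_group F unfolding F_def using assms by (rule finite_group_Mod)
  interpret finite_quotient G F h N unfolding F_def h_def using assms by (rule quotient_hom)
  have "tau_group \<tau> F \<longleftrightarrow> (\<forall>x\<in>carrier F. tau_elem F \<tau> x)"
    using F.tau_group_iff[OF F.subgroup_self, of \<tau>] by simp
  also have "\<dots> \<longleftrightarrow> (\<forall>x\<in>carrier G. tau_elem_mod G \<tau> N x)"
    unfolding surj[symmetric] by (simp add: tau_elem_iff)
  finally show ?thesis unfolding F_def .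
qed

section \<open>Transfer, and the normal closure of a subgroup normalized by all elements of coprime order\<close>

text \<open>
  The transfer. For representatives \<open>t c\<close> of the right cosets of \<open>Z\<close>, the element \<open>t c \<otimes> g \<otimes> inv (t (c #>
  g))\<close> lies in \<open>Z\<close>, and the product of these elements over all cosets depends multiplicatively on \<open>g\<close>.
  For central \<open>g\<close> the coset \<open>c\<close> is fixed and each factor equals \<open>g\<close>.
\<close>

lemma (in finite_group) transfer_to_central_subgroup:
  assumes Z: "subgroup Z G" and central: "\<And>z x. z \<in> Z \<Longrightarrow> x \<in> carrier G \<Longrightarrow> z \<otimes> x = x \<otimes> z"
  obtains f where "\<And>x. x \<in> carrier G \<Longrightarrow> f x \<in> Z"
    "\<And>x y. x \<in> carrier G \<Longrightarrow> y \<in> carrier G \<Longrightarrow> f (x \<otimes> y) = f x \<otimes> f y"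
    "\<And>z. z \<in> Z \<Longrightarrow> f z = z [^] card (rcosets Z)"
proof -
  interpret Z: subgroup Z G by fact
  let ?Z = "G\<lparr>carrier := Z\<rparr>"
  interpret ZZ: comm_group ?Z
    using central Z.subset
    by (intro group.group_comm_groupI subgroup_imp_group[OF Z]) (auto simp: subset_iff)
  define C where "C = rcosets Z"
  have finC: "finite C" unfolding C_def RCOSETS_def by simp
  define t :: "'a set \<Rightarrow> 'a" where "t = (\<lambda>c. SOME x. x \<in> c)"
  have t: "t c \<in> c" "t c \<in> carrier G" if c: "c \<in> C" for c
  proof -
    obtain a where a: "a \<in> carrier G" "c = Z #> a" using c by (auto simp: C_def RCOSETS_def)
    then have "a \<in> c" using rcos_self[OF a(1) Z] by simp
    then show "t c \<in> c" unfolding t_def by (rule someI)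
    then show "t c \<in> carrier G" using a r_coset_subset_G[OF Z.subset a(1)] by blast
  qed
  have cg: "c #> g \<in> C" if c: "c \<in> C" and g: "g \<in> carrier G" for c g
  proof -
    obtain a where a: "a \<in> carrier G" "c = Z #> a" using c by (auto simp: C_def RCOSETS_def)
    then show ?thesis using g by (auto simp: C_def coset_mult_assoc Z.subset intro: rcosetsI)
  qed
  have csub: "c \<subseteq> carrier G" if c: "c \<in> C" for c
    using c Z.subset r_coset_subset_G by (auto simp: C_def RCOSETS_def)
  have assoc: "c #> (g \<otimes> h) = (c #> g) #> h" if "c \<in> C" "g \<in> carrier G" "h \<in> carrier G" for c g h
    using that csub[OF that(1)] by (simp add: coset_mult_assoc)
  define u where "u = (\<lambda>g c. t c \<otimes> g \<otimes> inv (t (c #> g)))"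
  have u: "u g c \<in> Z" if c: "c \<in> C" and g: "g \<in> carrier G" for g c
  proof -
    obtain a where a: "a \<in> carrier G" "c #> g = Z #> a"
      using cg[OF c g] by (auto simp: C_def RCOSETS_def)
    have "t c \<otimes> g \<in> Z #> a" using t(1)[OF c] a by (auto simp: r_coset_def simp flip: a(2))
    moreover have "t (c #> g) \<in> Z #> a" using t(1)[OF cg[OF c g]] a by simp
    ultimately obtain y z where "y \<in> Z" "t c \<otimes> g = y \<otimes> a" "z \<in> Z" "t (c #> g) = z \<otimes> a"
      by (auto simp: r_coset_def)
    then have "u g c = y \<otimes> inv z" "y \<in> Z" "z \<in> Z"
      using a(1) by (auto simp: u_def inv_mult_group m_assoc cancel_left_inv)
    then show ?thesis by simp
  qed
  define f where "f = (\<lambda>g. finprod ?Z (u g) C)"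
  show ?thesis
  proof (rule that[of f])
    show fZ: "f x \<in> Z" if "x \<in> carrier G" for x
      using ZZ.finprod_closed[of "u x" C] u that by (auto simp: f_def)
    fix x y assume x: "x \<in> carrier G" and y: "y \<in> carrier G"
    have "c #> x #> inv x = c" if "c \<in> C" for c
      using csub[OF that] x by (simp add: coset_mult_assoc coset_mult_one)
    then have inj: "inj_on (\<lambda>c. c #> x) C" by (rule inj_on_inverseI)
    have "(\<lambda>c. c #> x) ` C = C"
      using inj finC cg x by (intro endo_inj_surj) auto
    then have re: "finprod ?Z (u y) C = finprod ?Z (\<lambda>c. u y (c #> x)) C"
      using ZZ.finprod_reindex[of "u y" "\<lambda>c. c #> x" C] inj u y by auto
    have "u (x \<otimes> y) c = u x c \<otimes> u y (c #> x)" if c: "c \<in> C" for c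
      using c x y t cg by (simp add: u_def assoc m_assoc cancel_left_inv)
    then have "f (x \<otimes> y) = finprod ?Z (\<lambda>c. u x c \<otimes>\<^bsub>?Z\<^esub> u y (c #> x)) C"
      unfolding f_def using u cg x y by (intro ZZ.finprod_cong) (auto simp: simp_implies_def)
    also have "\<dots> = f x \<otimes> f y"
      unfolding f_def re using u cg x y by (subst ZZ.finprod_multf) auto
    finally show "f (x \<otimes> y) = f x \<otimes> f y" .
  next
    fix z assume z: "z \<in> Z"
    have "u z c = z" if c: "c \<in> C" for c
    proof -
      obtain a where a: "a \<in> carrier G" "c = Z #> a" using c by (auto simp: C_def RCOSETS_def)
      have "c #> z = Z #> (z \<otimes> a)"
        using a z central[OF z a(1)] by (simp add: coset_mult_assoc Z.subset)
      also have "\<dots> = c"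
        using a z coset_mult_assoc[of Z z a] coset_join2[OF _ Z z] by (simp add: Z.subset)
      finally have "u z c = t c \<otimes> z \<otimes> inv (t c)" by (simp add: u_def)
      also have "\<dots> = z \<otimes> t c \<otimes> inv (t c)" using central[OF z t(2)[OF c]] by simp
      also have "\<dots> = z" using z t(2)[OF c] by (simp add: m_assoc)
      finally show ?thesis .
    qed
    then have "f z = finprod ?Z (\<lambda>_. z) C"
      unfolding f_def using z by (intro ZZ.finprod_cong) (auto simp: simp_implies_def)
    also have "\<dots> = z [^] card C"
      using ZZ.finprod_const[of z C] z nat_pow_consistent[of z "card C" Z] by simp
    finally show "f z = z [^] card (rcosets Z)" by (simp add: C_def)
  qed
qed

text \<open>
  The transfer maps \<open>Q\<close>-elements to \<open>Q\<close>-elements of the \<open>P\<close>-group \<open>Z\<close>, so it is trivial on a group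
  generated by \<open>Q\<close>-elements. On \<open>Z\<close> it is the power map whose exponent is the index of \<open>Z\<close>, a \<open>Q\<close>-number,
  which is injective there.
\<close>

lemma (in finite_group) central_complementary_trivial:
  assumes PQ: "complementary P Q"
    and Z: "subgroup Z G" "\<And>z x. z \<in> Z \<Longrightarrow> x \<in> carrier G \<Longrightarrow> z \<otimes> x = x \<otimes> z"
    and ZP: "\<And>z. z \<in> Z \<Longrightarrow> tau_elem G P z"
    and ZQ: "\<And>x. x \<in> carrier G \<Longrightarrow> tau_elem_mod G Q Z x"
    and gen: "generate G S = carrier G" "\<And>x. x \<in> S \<Longrightarrow> tau_elem G Q x"
  shows "Z = {\<one>}"
proof -
  interpret Z: subgroup Z G by fact
  obtain f where f: "\<And>x. x \<in> carrier G \<Longrightarrow> f x \<in> Z"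
    "\<And>x y. x \<in> carrier G \<Longrightarrow> y \<in> carrier G \<Longrightarrow> f (x \<otimes> y) = f x \<otimes> f y"
    "\<And>z. z \<in> Z \<Longrightarrow> f z = z [^] card (rcosets Z)"
    using transfer_to_central_subgroup[OF Z] by blast
  have "f \<in> hom G G" using f(1,2) by (auto intro!: homI)
  then interpret f: group_hom G G f by (simp add: group_hom_def group_hom_axioms_def is_group)
  have SG: "h \<in> carrier G" if "h \<in> S" for h using gen(2)[OF that] by (rule tau_elem_mod_carrier)
  have fS: "f h = \<one>" if h: "h \<in> S" for h
  proof -
    obtain k where k: "tau_number Q k" "h [^] k = \<one>"
      using gen(2)[OF h] by (auto simp: tau_elem_mod_def)
    have "f h [^] k = \<one>" using k(2) SG[OF h] f.hom_nat_pow[of h k] by simp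
    then have "tau_elem G Q (f h)" using k(1) SG[OF h] by (auto simp: tau_elem_mod_def)
    then show ?thesis using complementary_elem_one[OF PQ ZP[OF f(1)[OF SG[OF h]]]] by simp
  qed
  have "f x = \<one>" if "x \<in> carrier G" for x
    using that unfolding gen(1)[symmetric]
    by (induction rule: generate.induct) (simp_all add: fS SG gen(1))
  moreover
  have "x \<otimes> z \<otimes> inv x \<in> Z" if "x \<in> carrier G" "z \<in> Z" for x z
    using that Z(2)[of z x] by (simp add: m_assoc flip: Z(2)[of z x])
  then have central: "carrier G \<subseteq> normalizing G Z" by (auto simp: normalizing_def)
  obtain n where n: "tau_number Q n" "card (carrier G) = n * card Z"
    using normal_index_tau_number[of "carrier G" Z Q] Z(1) ZQ subgroup_self central Z.subset
    by blast
  have "card Z > 0" using card_subgroup_pos[OF Z(1)] .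
  then have "card (rcosets Z) = n"
    using lagrange_finite[OF fin Z(1)] n(2) by (simp add: order_def)
  ultimately have "z [^] n = \<one>" if "z \<in> Z" for z using f(3)[OF that] that by simp
  then have "tau_elem G Q z" if "z \<in> Z" for z using n(1) that by (auto simp: tau_elem_mod_def)
  then have "z = \<one>" if "z \<in> Z" for z using complementary_elem_one[OF PQ ZP] that by blast
  then show ?thesis using Z.one_closed by auto
qed


lemma (in finite_group) normalizing_conj_image:
  assumes R: "R \<lhd> G" and n: "R \<subseteq> normalizing G K" "K \<subseteq> carrier G" and g: "g \<in> carrier G"
  shows "R \<subseteq> normalizing G ((\<lambda>x. g \<otimes> x \<otimes> inv g) ` K)"
proof
  interpret R: normal R G by fact
  fix r assume r: "r \<in> R"
  have "r \<otimes> (g \<otimes> x \<otimes> inv g) \<otimes> inv r \<in> (\<lambda>x. g \<otimes> x \<otimes> inv g) ` K" if x: "x \<in> K" for x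
  proof -
    define r' where "r' = inv g \<otimes> r \<otimes> g"
    have r': "r' \<in> R" using R.inv_op_closed1[OF g r] by (simp add: r'_def)
    have c: "x \<in> carrier G" "r \<in> carrier G" using n(2) x r by auto
    then have "r \<otimes> (g \<otimes> x \<otimes> inv g) \<otimes> inv r = g \<otimes> (r' \<otimes> x \<otimes> inv r') \<otimes> inv g"
      using g unfolding r'_def by (simp add: m_assoc inv_mult_group cancel_left_inv)
    moreover have "r' \<otimes> x \<otimes> inv r' \<in> K" using n(1) r' x by (auto dest: normalizingD)
    ultimately show ?thesis by auto
  qed
  with r show "r \<in> normalizing G ((\<lambda>x. g \<otimes> x \<otimes> inv g) ` K)" by (auto simp: normalizing_def)
qed

lemma (in group) normal_closure_eq_generate:
  assumes "X \<subseteq> carrier G"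
  shows "normal_closure G X = generate G (\<Union>g\<in>carrier G. (\<lambda>x. g \<otimes> x \<otimes> inv g) ` X)"
proof
  let ?S = "\<Union>g\<in>carrier G. (\<lambda>x. g \<otimes> x \<otimes> inv g) ` X"
  note nc = normal_closure_least[OF is_group assms]
  have S: "?S \<subseteq> carrier G" using assms by auto
  have "generate G ?S \<lhd> G"
  proof (rule normal_generateI[OF S])
    fix s g assume "s \<in> ?S" "g \<in> carrier G"
    then obtain a x where a: "a \<in> carrier G" "x \<in> X" "s = a \<otimes> x \<otimes> inv a" by auto
    with \<open>g \<in> carrier G\<close> assms have "g \<otimes> s \<otimes> inv g = (g \<otimes> a) \<otimes> x \<otimes> inv (g \<otimes> a)"
      by (auto simp: m_assoc inv_mult_group)
    with a \<open>g \<in> carrier G\<close> show "g \<otimes> s \<otimes> inv g \<in> ?S" by blast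
  qed
  moreover have "X \<subseteq> generate G ?S"
  proof
    fix x assume "x \<in> X"
    with assms have "x \<in> ?S" by (intro UN_I[of \<one>]) (auto simp: image_iff intro!: bexI[of _ x])
    then show "x \<in> generate G ?S" by (rule generate.incl)
  qed
  ultimately show "normal_closure G X \<subseteq> generate G ?S" by (rule nc(3))
  have "?S \<subseteq> normal_closure G X" using nc(1,2) normal.inv_op_closed2 by fastforce
  then show "generate G ?S \<subseteq> normal_closure G X"
    using generate_subgroup_incl normal_imp_subgroup[OF nc(1)] by blast
qed

lemma (in finite_group) tau_elems_generate_normal:
  "generate G {v. tau_elem G \<tau> v} \<lhd> G"
proof (rule normal_generateI)
  show "{v. tau_elem G \<tau> v} \<subseteq> carrier G" by (auto simp: tau_elem_mod_def)
qed (use tau_elem_conj in simp)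

text \<open>
  Let \<open>R\<close> be generated by the \<open>P\<close>-elements and \<open>L\<close> the normal closure of \<open>X\<close>. Each conjugate \<open>X\<^sup>g\<close> is
  normalized by \<open>R\<close>, so \<open>X\<^sup>g \<inter> R\<close> is a normal \<open>Q\<close>-subgroup of \<open>R\<close>, and \<open>[X\<^sup>g, R] \<le> X\<^sup>g \<inter> R \<le> T\<close> where \<open>T\<close> is the
  intersection of \<open>L\<close> with the largest normal \<open>Q\<close>-subgroup of \<open>R\<close>. So modulo \<open>T\<close> the group \<open>L \<inter> R\<close> is central
  in \<open>L\<close>; it is a \<open>P\<close>-group there because its \<open>Q\<close>-elements form a normal subgroup; and \<open>L/(L \<inter> R)\<close> is a
  \<open>Q\<close>-group because \<open>G/R\<close> is one. Hence \<open>L \<inter> R = T\<close> by the transfer argument.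
\<close>

lemma (in finite_group) normal_closure_tau_elem:
  assumes PQ: "complementary P Q"
    and X: "subgroup X G" "\<And>x. x \<in> X \<Longrightarrow> tau_elem G Q x"
    and norm: "\<And>v. tau_elem G P v \<Longrightarrow> v \<in> normalizing G X"
    and x: "x \<in> normal_closure G X"
  shows "tau_elem G Q x"
proof -
  define R where "R = generate G {v. tau_elem G P v}"
  define L where "L = normal_closure G X"
  interpret R: normal R G unfolding R_def by (rule tau_elems_generate_normal)
  interpret X: subgroup X G by (rule X)
  let ?R = "G\<lparr>carrier := R\<rparr>"
  interpret R': finite_group ?R using R.subgroup_axioms by (rule finite_group_restrict)
  define S where "S = (\<Union>g\<in>carrier G. (\<lambda>x. g \<otimes> x \<otimes> inv g) ` X)"
  interpret L: normal L G
    unfolding L_def using subgroup.subset[OF X(1)] by (rule normal_closure_least(1)[OF is_group])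
  have LS: "L = generate G S" unfolding L_def S_def
    using subgroup.subset[OF X(1)] by (rule normal_closure_eq_generate)
  have SL: "S \<subseteq> L" unfolding LS by (auto intro: generate.incl)
  have RX: "R \<subseteq> normalizing G X"
    unfolding R_def using norm normalizing_subgroup[OF subgroup.subset[OF X(1)]]
    by (intro generate_subgroup_incl) auto
  define Xg where "Xg = (\<lambda>g. (\<lambda>x. g \<otimes> x \<otimes> inv g) ` X)"
  have Xg: "subgroup (Xg g) G" "Xg g \<subseteq> L" "R \<subseteq> normalizing G (Xg g)" "\<And>x. x \<in> Xg g \<Longrightarrow> tau_elem G Q x"
    if g: "g \<in> carrier G" for g
  proof -
    show "subgroup (Xg g) G" unfolding Xg_def using X(1) g by (rule subgroup_conj_image)
    show "Xg g \<subseteq> L" using SL g by (auto simp: S_def Xg_def)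
    show "tau_elem G Q x" if "x \<in> Xg g" for x
      using that X(2) tau_elem_conj[OF g] by (auto simp: Xg_def)
    show "R \<subseteq> normalizing G (Xg g)"
      unfolding Xg_def using R.normal_axioms RX X.subset g by (rule normalizing_conj_image)
  qed
  define O0 where "O0 = tau_radical Q ?R"
  note rad = tau_radical_greatest[OF R'.is_group R'.fin, where \<tau> = Q, folded O0_def]
  have O0: "subgroup O0 G" "O0 \<subseteq> R" "R \<subseteq> normalizing G O0"
    using rad(1) normal_restrict_iff[OF R.subgroup_axioms] by auto
  have O0Q: "tau_elem G Q y" if "y \<in> O0" for y
    using rad(2) tau_group_iff[OF O0(1)] that by simp
  have max: "N \<subseteq> O0" if "subgroup N G" "N \<subseteq> R" "R \<subseteq> normalizing G N" "\<And>y. y \<in> N \<Longrightarrow> tau_elem G Q y" for N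
    using rad(3)[of N] that normal_restrict_iff[OF R.subgroup_axioms, of N] tau_group_iff[OF that(1)]
    by simp
  have RR: "R \<subseteq> normalizing G R" using R.subgroup_axioms by (rule subgroup_normalizing)
  \<comment> \<open>\<open>O0\<close> is characteristic in the normal subgroup \<open>R\<close>: its conjugates are again normal
    \<open>Q\<close>-subgroups of \<open>R\<close>.\<close>
  have O0n: "O0 \<lhd> G"
  proof (rule normal_invI[OF O0(1)])
    fix g y assume g: "g \<in> carrier G" and y: "y \<in> O0"
    have "(\<lambda>x. g \<otimes> x \<otimes> inv g) ` O0 \<subseteq> O0"
    proof (rule max)
      show "subgroup ((\<lambda>x. g \<otimes> x \<otimes> inv g) ` O0) G" using O0(1) g by (rule subgroup_conj_image)
      show "(\<lambda>x. g \<otimes> x \<otimes> inv g) ` O0 \<subseteq> R" using O0(2) R.inv_op_closed2[OF g] by auto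
      show "tau_elem G Q y" if "y \<in> (\<lambda>x. g \<otimes> x \<otimes> inv g) ` O0" for y
        using that O0Q tau_elem_conj[OF g] by auto
      show "R \<subseteq> normalizing G ((\<lambda>x. g \<otimes> x \<otimes> inv g) ` O0)"
        using R.normal_axioms O0(3) subgroup.subset[OF O0(1)] g by (rule normalizing_conj_image)
    qed
    with y show "g \<otimes> y \<otimes> inv g \<in> O0" by blast
  qed
  define T where "T = O0 \<inter> L"
  have T: "T \<lhd> G" unfolding T_def using O0n L.normal_axioms by (rule normal_subgroup_intersect)
  interpret T: normal T G by fact
  have TR: "T \<subseteq> R" "T \<subseteq> L" using O0(2) by (auto simp: T_def)
  have TQ: "tau_elem G Q y" if "y \<in> T" for y using O0Q that by (simp add: T_def)
  have XT: "Xg g \<inter> R \<subseteq> T" if g: "g \<in> carrier G" for g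
  proof -
    have "R \<subseteq> normalizing G (Xg g \<inter> R)" using Xg(3)[OF g] RR by (auto simp: normalizing_def)
    then have "Xg g \<inter> R \<subseteq> O0"
      using Xg(1,4)[OF g] R.subgroup_axioms by (intro max) (auto intro: subgroups_Inter_pair)
    then show ?thesis using Xg(2)[OF g] by (auto simp: T_def)
  qed
  \<comment> \<open>The elements commuting with \<open>R\<close> modulo \<open>T\<close> form a subgroup that contains all conjugates of
    \<open>X\<close>.\<close>
  have comm: "l \<otimes> r \<otimes> inv l \<otimes> inv r \<in> T" if "l \<in> L" "r \<in> R" for l r
  proof -
    define D where "D = {l \<in> carrier G. \<forall>r\<in>R. l \<otimes> r \<otimes> inv l \<otimes> inv r \<in> T}"
    have "subgroup D G"
    proof (rule finite_subgroupI)
      show "D \<subseteq> carrier G" "\<one> \<in> D" by (auto simp: D_def)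
      fix a b assume ab: "a \<in> D" "b \<in> D"
      have "a \<otimes> b \<otimes> r \<otimes> inv (a \<otimes> b) \<otimes> inv r \<in> T" if r: "r \<in> R" for r
      proof -
        have G: "a \<in> carrier G" "b \<in> carrier G" using ab by (auto simp: D_def)
        have "a \<otimes> b \<otimes> r \<otimes> inv (a \<otimes> b) \<otimes> inv r
            = (a \<otimes> (b \<otimes> r \<otimes> inv b \<otimes> inv r) \<otimes> inv a) \<otimes> (a \<otimes> r \<otimes> inv a \<otimes> inv r)"
          using G r by (simp add: m_assoc inv_mult_group cancel_left_inv)
        with ab r show ?thesis by (simp add: D_def T.inv_op_closed2)
      qed
      with ab show "a \<otimes> b \<in> D" by (simp add: D_def)
    qed
    moreover have "S \<subseteq> D"
    proof
      fix s assume "s \<in> S"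
      then obtain g where g: "g \<in> carrier G" "s \<in> Xg g" by (auto simp: S_def Xg_def)
      interpret Xg: subgroup "Xg g" G using Xg(1)[OF g(1)] .
      have "s \<otimes> r \<otimes> inv s \<otimes> inv r \<in> T" if r: "r \<in> R" for r
      proof -
        have "r \<otimes> inv s \<otimes> inv r \<in> Xg g" using Xg(3)[OF g(1)] r g(2) by (auto dest: normalizingD)
        then have "s \<otimes> (r \<otimes> inv s \<otimes> inv r) \<in> Xg g" using g(2) by simp
        moreover have "(s \<otimes> r \<otimes> inv s) \<otimes> inv r \<in> R"
          using r R.inv_op_closed2[of s r] Xg.mem_carrier[OF g(2)] by simp
        ultimately have "s \<otimes> r \<otimes> inv s \<otimes> inv r \<in> Xg g \<inter> R"
          using r Xg.mem_carrier[OF g(2)] by (simp add: m_assoc)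
        then show ?thesis using XT[OF g(1)] by blast
      qed
      then show "s \<in> D" using Xg.mem_carrier[OF g(2)] by (simp add: D_def)
    qed
    ultimately have "L \<subseteq> D" unfolding LS by (intro generate_subgroup_incl)
    with that show ?thesis by (auto simp: D_def)
  qed
  define QT where "QT = G Mod T"
  interpret Q: finite_group QT unfolding QT_def using T by (rule finite_group_Mod)
  define h where "h = (\<lambda>x. T #> x)"
  interpret h: finite_quotient G QT h T
    unfolding h_def QT_def using T by (rule quotient_hom)
  define Z where "Z = L \<inter> R"
  have sZ: "subgroup Z G" unfolding Z_def
    using L.subgroup_axioms R.subgroup_axioms by (rule subgroups_Inter_pair)
  interpret Z: subgroup Z G by fact
  have hcomm: "h z \<otimes>\<^bsub>QT\<^esub> h l = h l \<otimes>\<^bsub>QT\<^esub> h z" if "z \<in> R" "l \<in> L" for z l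
    using that comm[OF that(2,1)] by (intro h.commute_image[symmetric]) auto
  have LZ: "tau_elem_mod G Q Z y" if y: "y \<in> L" for y
  proof -
    have "tau_elem_mod G Q R y"
      using y by (intro tau_elem_mod_of_complement[OF complementary_sym[OF PQ] R.subgroup_axioms])
        (auto simp: R_def intro: generate.incl)
    then show ?thesis
      using subgroup_pow_closed[OF L.subgroup_axioms y] by (auto simp: tau_elem_mod_def Z_def)
  qed
  \<comment> \<open>The \<open>Q\<close>-elements modulo \<open>T\<close> of the group \<open>Z\<close>, which is abelian modulo \<open>T\<close>, form a normal
    \<open>Q\<close>-subgroup of \<open>R\<close>, so they already lie in \<open>T\<close>.\<close>
  define N where "N = {y \<in> Z. tau_elem QT Q (h y)}"
  have "N \<subseteq> O0"
  proof (rule max)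
    show "subgroup N G"
    proof (rule finite_subgroupI)
      show "N \<subseteq> carrier G" by (auto simp: N_def)
      show "\<one> \<in> N"
        using h.tau_elem_iff[of \<one> Q]
        by (auto simp: N_def tau_elem_mod_def intro!: exI[of _ 1] tau_number_1[unfolded One_nat_def])
      fix a b assume ab: "a \<in> N" "b \<in> N"
      then have "tau_elem QT Q (h a \<otimes>\<^bsub>QT\<^esub> h b)"
        by (intro Q.tau_elem_mult hcomm) (auto simp: N_def Z_def)
      with ab show "a \<otimes> b \<in> N" by (auto simp: N_def)
    qed
    show "N \<subseteq> R" by (auto simp: N_def Z_def)
    show "R \<subseteq> normalizing G N"
    proof
      fix r assume r: "r \<in> R"
      have "r \<otimes> y \<otimes> inv r \<in> N" if y: "y \<in> N" for y
      proof -
        have "tau_elem QT Q (h r \<otimes>\<^bsub>QT\<^esub> h y \<otimes>\<^bsub>QT\<^esub> inv\<^bsub>QT\<^esub> h r)"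
          using y r by (intro Q.tau_elem_conj) (auto simp: N_def)
        moreover have "r \<otimes> y \<otimes> inv r \<in> Z"
          using y r L.inv_op_closed2[of r y] by (auto simp: N_def Z_def)
        ultimately show ?thesis using y r by (auto simp: N_def)
      qed
      with r show "r \<in> normalizing G N" by (auto simp: normalizing_def)
    qed
    show "tau_elem G Q y" if "y \<in> N" for y
      using that TQ h.tau_elem_iff[of y Q] by (auto simp: N_def intro: tau_elem_mod_trans)
  qed
  then have NT: "N \<subseteq> T" by (auto simp: T_def N_def Z_def)
  have sLb: "subgroup (h ` L) QT" using L.subgroup_axioms by (rule h.subgroup_img_is_subgroup)
  let ?M = "QT\<lparr>carrier := h ` L\<rparr>"
  interpret M: finite_group ?M using sLb by (rule Q.finite_group_restrict)
  have "h ` Z = {\<one>\<^bsub>?M\<^esub>}"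
  proof (rule M.central_complementary_trivial[OF PQ])
    show "subgroup (h ` Z) ?M"
      using h.subgroup_img_is_subgroup[OF sZ] sLb by (intro Q.subgroup_incl) (auto simp: Z_def)
    show "z \<otimes>\<^bsub>?M\<^esub> y = y \<otimes>\<^bsub>?M\<^esub> z" if "z \<in> h ` Z" "y \<in> carrier ?M" for z y
      using that hcomm by (auto simp: Z_def)
    show "tau_elem ?M P z" if z: "z \<in> h ` Z" for z
    proof -
      obtain y where y: "y \<in> Z" "z = h y" using z by auto
      obtain i j :: nat where ij: "y = y [^] i \<otimes> y [^] j" "tau_elem G P (y [^] i)" "tau_elem G Q (y [^] j)"
        using tau_elem_factorization[OF PQ Z.mem_carrier[OF y(1)]] by blast
      have "y [^] j \<in> N"
        using y ij(3) subgroup_pow_closed[OF sZ y(1)] h.tau_elem_iff[of "y [^] j" Q] tau_elem_mod_mono[OF ij(3), of T]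
        by (auto simp: N_def)
      then have "h (y [^] j) = \<one>\<^bsub>QT\<^esub>" using NT h.ker[of "y [^] j"] y by auto
      moreover have "h y = h (y [^] i \<otimes> y [^] j)" by (rule arg_cong[OF ij(1)])
      moreover have "h (y [^] i \<otimes> y [^] j) = h (y [^] i) \<otimes>\<^bsub>QT\<^esub> h (y [^] j)"
        using y(1) by (intro h.hom_mult) auto
      ultimately have "h y = h (y [^] i)" using y(1) by (simp del: h.hom_nat_pow)
      then have "tau_elem QT P z"
        using y h.tau_elem_iff[of "y [^] i" P] tau_elem_mod_mono[OF ij(2), of T] by auto
      then show ?thesis
        using tau_elem_mod_restrict[OF subgroup.subset[OF sLb]] y by (auto simp: Z_def)
    qed
    show "tau_elem_mod ?M Q (h ` Z) y" if y: "y \<in> carrier ?M" for y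
    proof -
      obtain x where x: "x \<in> L" "y = h x" using y by auto
      have "tau_elem_mod G Q Z x" using LZ[OF x(1)] .
      then show ?thesis
        using h.tau_elem_mod_hom x tau_elem_mod_restrict[OF subgroup.subset[OF sLb]] by auto
    qed
    show "generate ?M (h ` S) = carrier ?M"
      using Q.generate_consistent[OF image_mono[OF SL] sLb] h.generate_img[OF subset_trans[OF SL L.subset]]
      by (simp add: LS)
    show "tau_elem ?M Q y" if y: "y \<in> h ` S" for y
    proof -
      obtain s where s: "s \<in> S" "y = h s" using y by auto
      then have "tau_elem G Q s" using Xg(4) by (auto simp: S_def Xg_def)
      then have "tau_elem QT Q y"
        using s SL L.subset h.tau_elem_iff[of s Q] tau_elem_mod_mono[of G Q "{\<one>}" s T] by auto
      then show ?thesis using tau_elem_mod_restrict[OF subgroup.subset[OF sLb]] s SL by auto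
    qed
  qed
  then have "h z = \<one>\<^bsub>QT\<^esub>" if "z \<in> Z" for z using that by auto
  then have "Z \<subseteq> T" using h.ker[OF Z.mem_carrier] by blast
  then have "tau_elem_mod G Q T x"
    using tau_elem_mod_mono[OF LZ[OF x[folded L_def]]] by blast
  then show ?thesis using TQ by (rule tau_elem_mod_trans)
qed

section \<open>Subgroup chains and joins with a modular subgroup\<close>

text \<open>
  One link of the chain in the theorem. Instead of the core of \<open>S\<close> in \<open>T\<close>, any normal subgroup \<open>K\<close> of \<open>T\<close>
  inside \<open>S\<close> is allowed; this makes the condition visibly stable under intersections and
  homomorphisms.
\<close>

definition sigma_step ::
    "('a, 'b) monoid_scheme \<Rightarrow> nat set \<Rightarrow> nat set \<Rightarrow> 'a set \<Rightarrow> 'a set \<Rightarrow> bool"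
  where "sigma_step G P Q S T \<longleftrightarrow>
    subgroup S G \<and> subgroup T G \<and> S \<subseteq> T \<and>
    (T \<subseteq> normalizing G S \<or>
     (\<exists>\<tau>\<in>{P, Q}. \<exists>K. subgroup K G \<and> K \<subseteq> S \<and> T \<subseteq> normalizing G K \<and>
        (\<forall>x\<in>T. tau_elem_mod G \<tau> K x)))"

inductive sigma_subnormal ::
    "('a, 'b) monoid_scheme \<Rightarrow> nat set \<Rightarrow> nat set \<Rightarrow> 'a set \<Rightarrow> 'a set \<Rightarrow> bool"
  for G :: "('a, 'b) monoid_scheme" and P Q :: "nat set" and A :: "'a set"
  where
    base: "subgroup A G \<Longrightarrow> sigma_subnormal G P Q A A"
  | step: "sigma_subnormal G P Q A S \<Longrightarrow> sigma_step G P Q S T \<Longrightarrow> sigma_subnormal G P Q A T"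

lemma sigma_step_cases:
  assumes "sigma_step G P Q S T"
  obtains (normal) "T \<subseteq> normalizing G S"
    | (P_quotient) K where "subgroup K G" "K \<subseteq> S" "T \<subseteq> normalizing G K" "\<And>x. x \<in> T \<Longrightarrow> tau_elem_mod G P K x"
    | (Q_quotient) K where "subgroup K G" "K \<subseteq> S" "T \<subseteq> normalizing G K" "\<And>x. x \<in> T \<Longrightarrow> tau_elem_mod G Q K x"
proof -
  from assms have "T \<subseteq> normalizing G S \<or>
     (\<exists>\<tau>\<in>{P, Q}. \<exists>K. subgroup K G \<and> K \<subseteq> S \<and> T \<subseteq> normalizing G K \<and> (\<forall>x\<in>T. tau_elem_mod G \<tau> K x))"
    by (simp add: sigma_step_def)
  then show ?thesis
  proof (elim disjE bexE exE conjE)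
    fix \<tau> K assume K: "subgroup K G" "K \<subseteq> S" "T \<subseteq> normalizing G K" "\<forall>x\<in>T. tau_elem_mod G \<tau> K x" "\<tau> \<in> {P, Q}"
    then consider "\<tau> = P" | "\<tau> = Q" by auto
    then show ?thesis using K that(2)[OF K(1-3)] that(3)[OF K(1-3)] by cases auto
  qed (rule that(1))
qed

lemma sigma_step_sym: "sigma_step G P Q S T \<Longrightarrow> sigma_step G Q P S T"
  unfolding sigma_step_def by (simp add: insert_commute)

lemma sigma_subnormal_sym: "sigma_subnormal G P Q A T \<Longrightarrow> sigma_subnormal G Q P A T"
  by (induction rule: sigma_subnormal.induct)
    (auto intro: sigma_subnormal.intros dest: sigma_step_sym)

lemma sigma_subnormal_subset: "sigma_subnormal G P Q A T \<Longrightarrow> A \<subseteq> T"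
  by (induction rule: sigma_subnormal.induct) (auto simp: sigma_step_def)

context finite_group
begin

lemma sigma_step_Int:
  assumes "sigma_step G P Q S T" and U: "subgroup U G"
  shows "sigma_step G P Q (S \<inter> U) (T \<inter> U)"
proof -
  interpret U: subgroup U G by fact
  have n: "T \<inter> U \<subseteq> normalizing G (K \<inter> U)" if "T \<subseteq> normalizing G K" for K
    using that by (auto simp: normalizing_def)
  have ST: "subgroup S G" "subgroup T G" "S \<subseteq> T" using assms(1) by (auto simp: sigma_step_def)
  have sub: "subgroup (S \<inter> U) G" "subgroup (T \<inter> U) G" "S \<inter> U \<subseteq> T \<inter> U"
    using ST U by (auto intro: subgroups_Inter_pair)
  consider "T \<subseteq> normalizing G S"
    | \<tau> K where "\<tau> \<in> {P, Q}" "subgroup K G" "K \<subseteq> S" "T \<subseteq> normalizing G K" "\<forall>x\<in>T. tau_elem_mod G \<tau> K x"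
    using assms(1) unfolding sigma_step_def by blast
  then show ?thesis
  proof cases
    case 1
    with sub n[of S] show ?thesis by (simp add: sigma_step_def)
  next
    case (2 \<tau> K)
    have "tau_elem_mod G \<tau> (K \<inter> U) x" if "x \<in> T \<inter> U" for x
      using that 2(5) subgroup_pow_closed[OF U] by (auto simp: tau_elem_mod_def)
    moreover have "subgroup (K \<inter> U) G" using 2(2) U by (rule subgroups_Inter_pair)
    moreover have "K \<inter> U \<subseteq> S \<inter> U" using 2(3) by blast
    ultimately have "\<exists>K'. subgroup K' G \<and> K' \<subseteq> S \<inter> U \<and> T \<inter> U \<subseteq> normalizing G K' \<and>
        (\<forall>x\<in>T \<inter> U. tau_elem_mod G \<tau> K' x)"
      using n[OF 2(4)] by blast
    with sub 2(1) show ?thesis unfolding sigma_step_def by blast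
  qed
qed

lemma sigma_subnormal_Int:
  assumes "sigma_subnormal G P Q A T" and U: "subgroup U G" "A \<subseteq> U"
  shows "sigma_subnormal G P Q A (T \<inter> U)"
  using assms(1)
proof (induction rule: sigma_subnormal.induct)
  case base
  then show ?case using U(2) by (auto simp: Int_absorb2 intro: sigma_subnormal.base)
next
  case (step S T)
  then show ?case using sigma_step_Int[OF _ U(1)] by (blast intro: sigma_subnormal.step)
qed

end

text \<open>
  The subgroups \<open>Z\<close> between \<open>A\<close> and \<open>\<langle>A, H\<rangle>\<close> come from \<open>H\<close>: this consequence of modularity and the chain
  from \<open>A\<close> to \<open>G\<close> are the two sources of information about \<open>A\<close>.
\<close>

locale modular_sigma_subnormal = finite_group +
  fixes P Q :: "nat set" and A :: "'a set"
  assumes PQ: "complementary P Q"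
    and A: "subgroup A G"
    and subnormal: "sigma_subnormal G P Q A (carrier G)"
    and modular: "\<And>H Z. subgroup H G \<Longrightarrow> subgroup Z G \<Longrightarrow> A \<subseteq> Z \<Longrightarrow> Z \<subseteq> generate G (A \<union> H)
      \<Longrightarrow> Z \<subseteq> generate G (A \<union> (H \<inter> Z))"
begin

lemma swap: "modular_sigma_subnormal G Q P A"
  using complementary_sym[OF PQ] A sigma_subnormal_sym[OF subnormal] modular
  by (intro modular_sigma_subnormal.intro finite_group_axioms modular_sigma_subnormal_axioms.intro)

lemma A_subset: "A \<subseteq> carrier G"
  using A by (rule subgroup.subset)

lemma join:
  assumes "H \<subseteq> carrier G"
  shows "subgroup (generate G (A \<union> H)) G" "A \<subseteq> generate G (A \<union> H)" "H \<subseteq> generate G (A \<union> H)"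
  using assms A_subset by (auto intro: generate_is_subgroup generate.incl)

lemma join_least:
  assumes "subgroup T G" "A \<subseteq> T" "H \<subseteq> T"
  shows "generate G (A \<union> H) \<subseteq> T"
  using assms by (intro generate_subgroup_incl) auto

text \<open>
  Intersecting the chain with \<open>\<langle>A, H\<rangle>\<close> gives a chain from \<open>A\<close> to \<open>\<langle>A, H\<rangle>\<close>, and modularity adds that every
  term \<open>T\<close> is generated by \<open>A\<close> and \<open>H \<inter> T\<close>.
\<close>

lemma join_induct [consumes 1, case_names base step]:
  assumes H: "subgroup H G"
    and base: "R A"
    and step: "\<And>S T. sigma_step G P Q S T \<Longrightarrow> A \<subseteq> S \<Longrightarrow> R S \<Longrightarrow> T \<subseteq> generate G (A \<union> (H \<inter> T)) \<Longrightarrow> R T"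
  shows "R (generate G (A \<union> H))"
proof -
  let ?J = "generate G (A \<union> H)"
  note J = join[OF subgroup.subset[OF H]]
  have "sigma_subnormal G P Q A (carrier G \<inter> ?J)"
    using subnormal J(1,2) by (rule sigma_subnormal_Int)
  then have "sigma_subnormal G P Q A ?J" using subgroup.subset[OF J(1)] by (simp add: Int_absorb1)
  moreover have "T \<subseteq> ?J \<longrightarrow> R T" if "sigma_subnormal G P Q A T" for T
    using that
  proof (induction rule: sigma_subnormal.induct)
    case base
    show ?case using assms(2) by simp
  next
    case (step S T)
    have ST: "S \<subseteq> T" "subgroup T G" using step(2) by (auto simp: sigma_step_def)
    have AS: "A \<subseteq> S" using step(1) by (rule sigma_subnormal_subset)
    show ?case
    proof
      assume TJ: "T \<subseteq> ?J"
      with ST step(3) have "R S" by auto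
      with step(2) AS show "R T"
        using modular[OF H ST(2) _ TJ] ST(1) by (intro assms(3)[of S T]) auto
    qed
  qed
  ultimately show ?thesis by blast
qed

text \<open>
  Along the chain below \<open>\<langle>A, H\<rangle>\<close>, in which \<open>T\<close> is generated by its predecessor \<open>S\<close> and the \<open>P\<close>-group \<open>H \<inter> T\<close>:
  if \<open>S\<close> is normal in \<open>T\<close>, then \<open>T/S\<close> is a quotient of \<open>H \<inter> T\<close>; and if \<open>T/K\<close> is a \<open>Q\<close>-group, then \<open>H \<inter> T \<le> K \<le> S\<close>
  and so \<open>T = S\<close>. In every case some \<open>K \<le> S\<close> is normal in \<open>T\<close> with a \<open>P\<close>-quotient, which forces the
  \<open>Q\<close>-elements of \<open>T\<close> into \<open>K\<close>.
\<close>

lemma join_tau_subgroup: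
  assumes H: "subgroup H G" "\<And>h. h \<in> H \<Longrightarrow> tau_elem G P h"
  shows "(\<forall>x\<in>generate G (A \<union> H). tau_elem G Q x \<longrightarrow> x \<in> A) \<and>
    (\<exists>n. tau_number P n \<and> card (generate G (A \<union> H)) = n * card A)"
  using H(1)
proof (induction rule: join_induct)
  case base
  show ?case using tau_number_1[of P] by (auto intro!: exI[of _ 1])
next
  case (step S T)
  interpret S: subgroup S G using step.hyps(1) by (simp add: sigma_step_def)
  interpret T: subgroup T G using step.hyps(1) by (simp add: sigma_step_def)
  interpret H: subgroup H G by fact
  have ST: "S \<subseteq> T" using step.hyps(1) by (simp add: sigma_step_def)
  have HT: "subgroup (H \<inter> T) G" using H(1) T.subgroup_axioms by (rule subgroups_Inter_pair)
  have SQ: "\<And>x. x \<in> S \<Longrightarrow> tau_elem G Q x \<Longrightarrow> x \<in> A" using step.IH by simp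
  have main: ?case
    if K: "subgroup K G" "K \<subseteq> S" "T \<subseteq> normalizing G K" "\<And>x. x \<in> T \<Longrightarrow> tau_elem_mod G P K x" for K
  proof -
    have "x \<in> A" if "x \<in> T" "tau_elem G Q x" for x
    proof -
      have "x \<in> K" using tau_elem_in[OF PQ K(1) K(4)[OF that(1)] that(2)] .
      then have "x \<in> S" using K(2) by (rule subsetD[rotated])
      then show ?thesis using SQ that(2) by simp
    qed
    moreover obtain n where n: "tau_number P n" "card T = n * card K"
      using normal_index_tau_number[OF T.subgroup_axioms K(1) _ K(3,4)] K(2) ST by blast
    moreover obtain k where k: "card S = card K * k"
      using card_subgroup_dvd[OF K(1) S.subgroup_axioms K(2)] by auto
    moreover obtain l where l: "card T = card S * l"
      using card_subgroup_dvd[OF S.subgroup_axioms T.subgroup_axioms ST] by auto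
    moreover obtain m where m: "tau_number P m" "card S = m * card A" using step.IH by blast
    moreover have "card K > 0" using card_subgroup_pos[OF K(1)] .
    ultimately have "n = k * l" by simp
    then have "tau_number P l" using n(1) by (auto intro: tau_number_dvd)
    then have "tau_number P (l * m)" "card T = l * m * card A"
      using m l by (simp_all add: tau_number_mult)
    with \<open>\<And>x. x \<in> T \<Longrightarrow> tau_elem G Q x \<Longrightarrow> x \<in> A\<close> show ?thesis by blast
  qed
  from step.hyps(1) show ?case
  proof (cases rule: sigma_step_cases)
    case normal
    have TS: "H \<inter> T \<subseteq> normalizing G S" using normal by blast
    note SH = set_mult_normalized[OF S.subgroup_axioms HT TS]
    have "T \<subseteq> S <#> (H \<inter> T)" using step.hyps(2,3) join_least[OF SH(1)] SH(2,3) by blast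
    moreover have "tau_elem_mod G P S x" if x: "x \<in> S <#> (H \<inter> T)" for x
    proof -
      obtain s h where sh: "s \<in> S" "h \<in> H \<inter> T" "x = s \<otimes> h" using x by (auto simp: set_mult_def)
      have "tau_elem G P h" using H(2) sh(2) by simp
      then have hS: "tau_elem_mod G P S h" by (rule tau_elem_mod_mono) simp
      have "h \<in> normalizing G S" using TS sh(2) by (rule subsetD)
      then show ?thesis
        unfolding sh(3) using hS sh(1) by (rule tau_elem_mod_mult[OF S.subgroup_axioms])
    qed
    ultimately show ?thesis using normal S.subgroup_axioms by (intro main[of S]) auto
  next
    case (P_quotient K)
    then show ?thesis by (rule main)
  next
    case (Q_quotient K)
    have "h \<in> K" if "h \<in> H \<inter> T" for h
      using that Q_quotient(4) H(2) tau_elem_in[OF complementary_sym[OF PQ] Q_quotient(1), of h]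
      by blast
    then have "T \<subseteq> S"
      using step.hyps(2,3) join_least[OF S.subgroup_axioms, of "H \<inter> T"] Q_quotient(2) by blast
    with ST step.IH show ?thesis by simp
  qed
qed

definition tau_part :: "nat set \<Rightarrow> 'a set"
  where "tau_part \<tau> = generate G {x \<in> A. tau_elem G \<tau> x}"

lemma tau_part: "subgroup (tau_part \<tau>) G" "tau_part \<tau> \<subseteq> A"
proof -
  have S: "{x \<in> A. tau_elem G \<tau> x} \<subseteq> A" by blast
  show "subgroup (tau_part \<tau>) G" "tau_part \<tau> \<subseteq> A"
    unfolding tau_part_def
    using generate_is_subgroup[OF subset_trans[OF S A_subset]] generate_subgroup_incl[OF S A]
    by auto
qed

lemma tau_part_incl: "x \<in> A \<Longrightarrow> tau_elem G \<tau> x \<Longrightarrow> x \<in> tau_part \<tau>"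
  by (auto simp: tau_part_def intro: generate.incl)

text \<open>
  The generators of \<open>tau_part Q\<close> are all the \<open>Q\<close>-elements of the whole join \<open>\<langle>A, H\<rangle>\<close>, so conjugation by
  elements of the join permutes them.
\<close>

lemma join_normalizes_tau_part:
  assumes H: "subgroup H G" "\<And>h. h \<in> H \<Longrightarrow> tau_elem G P h"
  shows "generate G (A \<union> H) \<subseteq> normalizing G (tau_part Q)"
proof
  note J = join[OF subgroup.subset[OF H(1)]]
  interpret J: subgroup "generate G (A \<union> H)" G by (rule J(1))
  fix t assume t: "t \<in> generate G (A \<union> H)"
  have tG: "t \<in> carrier G" using J(1) t by (rule subgroup.mem_carrier)
  show "t \<in> normalizing G (tau_part Q)"
    unfolding tau_part_def
  proof (rule normalizing_generateI[OF _ tG])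
    fix y assume y: "y \<in> {x \<in> A. tau_elem G Q x}"
    have "t \<otimes> y \<otimes> inv t \<in> generate G (A \<union> H)"
      using t y J(2) by (intro J.m_closed J.m_inv_closed) auto
    moreover have "tau_elem G Q (t \<otimes> y \<otimes> inv t)" using tG y by (intro tau_elem_conj) auto
    ultimately have "t \<otimes> y \<otimes> inv t \<in> A" using join_tau_subgroup[OF H] by blast
    with \<open>tau_elem G Q (t \<otimes> y \<otimes> inv t)\<close> show "t \<otimes> y \<otimes> inv t \<in> generate G {x \<in> A. tau_elem G Q x}"
      by (intro generate.incl) simp
  qed (use A_subset in auto)
qed

lemma tau_elem_normalizes_tau_part:
  assumes v: "tau_elem G P v"
  shows "v \<in> normalizing G (tau_part Q)"
proof -
  have vG: "v \<in> carrier G" using v by (rule tau_elem_mod_carrier)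
  have H: "subgroup (generate G {v}) G" using vG by (intro generate_is_subgroup) auto
  have "v \<in> generate G (A \<union> generate G {v})"
    using join(3)[OF subgroup.subset[OF H]] by (auto intro: generate.incl)
  then show ?thesis
    using join_normalizes_tau_part[OF H generate_singleton_tau_elem[OF v]] by blast
qed

text \<open>
  Let \<open>HP\<close>, \<open>HQ\<close> be the sets of \<open>P\<close>- and \<open>Q\<close>-elements of the cyclic group \<open>H = \<langle>g\<rangle>\<close>, and \<open>V = \<langle>A, HP\<rangle>\<close>, \<open>W = \<langle>A, HQ\<rangle>\<close>.
  Climbing the chain shows \<open>\<langle>A, H\<rangle> = V W\<close>, and modularity shows \<open>V \<inter> W = A\<close>. Now \<open>W\<close> normalizes \<open>tau_part P\<close>
  and \<open>V\<close> normalizes \<open>tau_part Q\<close>. So if \<open>g = v w\<close>, conjugation by \<open>w\<close> keeps \<open>d\<close> in \<open>A\<close> and then \<open>v\<close> keeps it in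
  \<open>V\<close>; writing \<open>g = w' v'\<close> instead shows that the conjugate is also in \<open>W\<close>.
\<close>

lemma tau_parts_conj_in:
  assumes d: "d \<in> tau_part P" "d \<in> tau_part Q" and g: "g \<in> carrier G"
  shows "g \<otimes> d \<otimes> inv g \<in> A"
proof -
  interpret sw: modular_sigma_subnormal G Q P A by (rule swap)
  define H where "H = generate G {g}"
  have H: "subgroup H G" unfolding H_def using g by (intro generate_is_subgroup) auto
  interpret H: subgroup H G by fact
  have Hc: "x \<otimes> y = y \<otimes> x" if "x \<in> H" "y \<in> H" for x y
    using that g generate_pow[OF g] by (auto simp: H_def int_pow_mult[symmetric] add.commute)
  define HP where "HP = {x \<in> H. tau_elem G P x}"
  define HQ where "HQ = {x \<in> H. tau_elem G Q x}"
  have HP: "subgroup HP G" "\<And>x. x \<in> HP \<Longrightarrow> tau_elem G P x" and HQ: "subgroup HQ G" "\<And>x. x \<in> HQ \<Longrightarrow> tau_elem G Q x"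
    unfolding HP_def HQ_def using Hc by (auto intro!: finite_subgroupI tau_elem_mult tau_elem_one)
  let ?V = "generate G (A \<union> HP)" and ?W = "generate G (A \<union> HQ)" and ?T = "generate G (A \<union> H)"
  interpret V: subgroup ?V G using join(1)[OF subgroup.subset[OF HP(1)]] .
  interpret W: subgroup ?W G using join(1)[OF subgroup.subset[OF HQ(1)]] .
  interpret T: subgroup ?T G using join(1)[OF H.subset] .
  have AV: "A \<subseteq> ?V" "HP \<subseteq> ?V" and AW: "A \<subseteq> ?W" "HQ \<subseteq> ?W" and AT: "A \<subseteq> ?T" "H \<subseteq> ?T"
    by (auto intro: generate.incl)
  have H_split: "\<exists>v w. h = v \<otimes> w \<and> v \<in> HP \<inter> S \<and> w \<in> HQ \<inter> S" if h: "h \<in> H" "h \<in> S" "subgroup S G" for h S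
  proof -
    obtain i j :: nat where "h = h [^] i \<otimes> h [^] j" "tau_elem G P (h [^] i)" "tau_elem G Q (h [^] j)"
      using tau_elem_factorization[OF PQ H.mem_carrier[OF h(1)]] by blast
    then show ?thesis
      using subgroup_pow_closed[OF H h(1)] subgroup_pow_closed[OF h(3,2)]
      by (auto simp: HP_def HQ_def)
  qed
  have VW: "v \<otimes> x \<otimes> w \<in> ?V <#> ?W" if vxw: "v \<in> ?V" "x \<in> ?V <#> ?W" "w \<in> ?W" for v x w
  proof -
    obtain a b where ab: "a \<in> ?V" "b \<in> ?W" "x = a \<otimes> b" using vxw(2) by (auto simp: set_mult_def)
    then have "v \<otimes> x \<otimes> w = (v \<otimes> a) \<otimes> (b \<otimes> w)" using vxw by (simp add: m_assoc)
    moreover have "v \<otimes> a \<in> ?V" "b \<otimes> w \<in> ?W" using ab vxw by auto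
    ultimately show ?thesis by (simp add: set_multI)
  qed
  have TVW: "?T \<subseteq> ?V <#> ?W"
    using H
  proof (induction rule: join_induct)
    case base
    show ?case
    proof
      fix a assume "a \<in> A"
      then show "a \<in> ?V <#> ?W" using set_multI[of a ?V \<one> ?W] AV A_subset by auto
    qed
  next
    case (step S U)
    interpret S: subgroup S G using step.hyps(1) by (simp add: sigma_step_def)
    interpret U: subgroup U G using step.hyps(1) by (simp add: sigma_step_def)
    have HU: "subgroup (H \<inter> U) G" using H U.subgroup_axioms by (rule subgroups_Inter_pair)
    have factor: "U \<subseteq> K <#> generate G (A \<union> (E \<inter> U))" "U \<subseteq> generate G (A \<union> (E \<inter> U)) <#> K"
      if K: "subgroup K G" "U \<subseteq> normalizing G K" and E: "HP \<inter> U \<subseteq> K \<union> E" "HQ \<inter> U \<subseteq> K \<union> E" for K E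
    proof -
      let ?C = "generate G (A \<union> (E \<inter> U))"
      have EU: "E \<inter> U \<subseteq> carrier G" by auto
      note C = join[OF EU]
      have CU: "?C \<subseteq> U" using step.hyps(1,2) by (intro join_least) (auto simp: sigma_step_def)
      note KC = set_mult_normalized[OF K(1) C(1) subset_trans[OF CU K(2)]]
      have HKC: "H \<inter> U \<subseteq> K <#> ?C"
      proof
        fix h assume "h \<in> H \<inter> U"
        then obtain v w where vw: "h = v \<otimes> w" "v \<in> HP \<inter> U" "w \<in> HQ \<inter> U"
          using H_split[OF _ _ U.subgroup_axioms, of h] by blast
        have "v \<in> K <#> ?C" using E(1) vw(2) C(3) KC(2,3) by blast
        moreover have "w \<in> K <#> ?C" using E(2) vw(3) C(3) KC(2,3) by blast
        ultimately show "h \<in> K <#> ?C" unfolding vw(1) by (intro subgroup.m_closed[OF KC(1)])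
      qed
      show "U \<subseteq> K <#> ?C"
        using step.hyps(3) join_least[OF KC(1) subset_trans[OF C(2) KC(3)] HKC]
        by (rule subset_trans)
      then show "U \<subseteq> ?C <#> K" using KC(4) by simp
    qed
    from step.hyps(1) show ?case
    proof (cases rule: sigma_step_cases)
      case normal
      have US: "H \<inter> U \<subseteq> normalizing G S" using normal by blast
      note SH = set_mult_normalized[OF S.subgroup_axioms HU US]
      show ?thesis
      proof
        fix u assume "u \<in> U"
        then have "u \<in> S <#> (H \<inter> U)" using step.hyps(2,3) join_least[OF SH(1)] SH(2,3) by blast
        then obtain s h where sh: "s \<in> S" "h \<in> H" "h \<in> U" "u = s \<otimes> h" by (auto simp: set_mult_def)
        obtain v w where vw: "h = v \<otimes> w" "v \<in> HP" "v \<in> U" "w \<in> HQ"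
          using H_split[OF sh(2,3) U.subgroup_axioms] by blast
        have c: "v \<in> carrier G" "w \<in> carrier G" "s \<in> carrier G"
          using vw sh subgroup.mem_carrier[OF HP(1)] subgroup.mem_carrier[OF HQ(1)] by auto
        \<comment> \<open>As \<open>S\<close> is normalized by \<open>v\<close> and \<open>h = v w\<close>, the element \<open>s h\<close> is \<open>v (v\<inverse> s v) w\<close> with middle factor
          in \<open>S \<subseteq> V W\<close>.\<close>
        have "inv v \<otimes> s \<otimes> inv (inv v) \<in> S"
          using normal U.m_inv_closed[OF vw(3)] sh(1) by (blast intro: normalizingD)
        then have "inv v \<otimes> s \<otimes> v \<in> S" using c by simp
        then have "v \<otimes> (inv v \<otimes> s \<otimes> v) \<otimes> w \<in> ?V <#> ?W"
          using vw step.IH AV AW by - (rule VW, auto)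
        moreover have "u = v \<otimes> (inv v \<otimes> s \<otimes> v) \<otimes> w"
          using c unfolding sh(4) vw(1) by (simp add: m_assoc cancel_left_inv)
        ultimately show "u \<in> ?V <#> ?W" by simp
      qed
    next
      case (P_quotient K)
      have "w \<in> K" if "w \<in> HQ \<inter> U" for w
        using that P_quotient(4) HQ(2) tau_elem_in[OF PQ P_quotient(1), of w] by blast
      then have U: "U \<subseteq> generate G (A \<union> (HP \<inter> U)) <#> K"
        using P_quotient(1,3) by (intro factor) auto
      have CV: "generate G (A \<union> (HP \<inter> U)) \<subseteq> ?V" by (intro mono_generate) auto
      show ?thesis
      proof
        fix u assume "u \<in> U"
        with U obtain c k where ck: "c \<in> generate G (A \<union> (HP \<inter> U))" "k \<in> K" "u = c \<otimes> k"
          by (auto simp: set_mult_def)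
        then have "c \<otimes> k \<otimes> \<one> \<in> ?V <#> ?W" using CV P_quotient(2) step.IH by - (rule VW, auto)
        moreover have "c \<in> carrier G" "k \<in> carrier G"
          using ck(1,2) CV V.subset P_quotient(2) S.subset by blast+
        ultimately show "u \<in> ?V <#> ?W" using ck(3) by simp
      qed
    next
      case (Q_quotient K)
      have "v \<in> K" if "v \<in> HP \<inter> U" for v
        using that Q_quotient(4) HP(2) tau_elem_in[OF complementary_sym[OF PQ] Q_quotient(1), of v]
        by blast
      then have U: "U \<subseteq> K <#> generate G (A \<union> (HQ \<inter> U))"
        using Q_quotient(1,3) by (intro factor) auto
      have CV: "generate G (A \<union> (HQ \<inter> U)) \<subseteq> ?W" by (intro mono_generate) auto
      show ?thesis
      proof
        fix u assume "u \<in> U"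
        with U obtain c k where ck: "c \<in> generate G (A \<union> (HQ \<inter> U))" "k \<in> K" "u = k \<otimes> c"
          by (auto simp: set_mult_def)
        then have "\<one> \<otimes> k \<otimes> c \<in> ?V <#> ?W" using CV Q_quotient(2) step.IH by - (rule VW, auto)
        moreover have "c \<in> carrier G" "k \<in> carrier G"
          using ck(1,2) CV W.subset Q_quotient(2) S.subset by blast+
        ultimately show "u \<in> ?V <#> ?W" using ck(3) by simp
      qed
    qed
  qed
  have VWA: "x \<in> A" if x: "x \<in> ?V" "x \<in> ?W" for x
  proof -
    have sI: "subgroup (?V \<inter> ?W) G"
      using V.subgroup_axioms W.subgroup_axioms by (rule subgroups_Inter_pair)
    have "?V \<inter> ?W \<subseteq> generate G (A \<union> (HP \<inter> (?V \<inter> ?W)))"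
      using AV AW by (intro modular[OF HP(1) sI]) auto
    moreover have "y \<in> A" if "y \<in> HP \<inter> (?V \<inter> ?W)" for y
      using sw.join_tau_subgroup[OF HQ] HP(2) that by blast
    then have "generate G (A \<union> (HP \<inter> (?V \<inter> ?W))) \<subseteq> A" by (intro join_least A) auto
    ultimately show ?thesis using x by blast
  qed
  have dA: "d \<in> A" using d(1) tau_part(2) by blast
  have inV: "t \<otimes> d \<otimes> inv t \<in> ?V" if "t = v \<otimes> w" "v \<in> ?V" "w \<in> ?W" for t v w
  proof -
    have "w \<in> normalizing G (sw.tau_part P)"
      using sw.join_normalizes_tau_part[OF HQ] that(3) by blast
    then have "w \<otimes> d \<otimes> inv w \<in> A"
      using d(1) tau_part(2)[of P] unfolding sw.tau_part_def tau_part_def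
      by (blast dest: normalizingD)
    then have "v \<otimes> (w \<otimes> d \<otimes> inv w) \<otimes> inv v \<in> ?V" using that AV by auto
    moreover have "t \<otimes> d \<otimes> inv t = v \<otimes> (w \<otimes> d \<otimes> inv w) \<otimes> inv v"
      using that A_subset dA by (auto simp: m_assoc inv_mult_group)
    ultimately show ?thesis by simp
  qed
  have inW: "t \<otimes> d \<otimes> inv t \<in> ?W" if "t = w \<otimes> v" "v \<in> ?V" "w \<in> ?W" for t v w
  proof -
    have "v \<in> normalizing G (tau_part Q)" using join_normalizes_tau_part[OF HP] that(2) by blast
    then have "v \<otimes> d \<otimes> inv v \<in> A"
      using d(2) tau_part(2)[of Q] by (blast dest: normalizingD)
    then have "w \<otimes> (v \<otimes> d \<otimes> inv v) \<otimes> inv w \<in> ?W" using that AW by auto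
    moreover have "t \<otimes> d \<otimes> inv t = w \<otimes> (v \<otimes> d \<otimes> inv v) \<otimes> inv w"
      using that A_subset dA by (auto simp: m_assoc inv_mult_group)
    ultimately show ?thesis by simp
  qed
  have gT: "g \<in> ?T" using AT(2) by (auto simp: H_def intro: generate.incl)
  then obtain v w where vw: "v \<in> ?V" "w \<in> ?W" "g = v \<otimes> w" using TVW by (auto simp: set_mult_def)
  have "inv g \<in> ?T" using gT by simp
  then obtain v' w' where vw': "v' \<in> ?V" "w' \<in> ?W" "inv g = v' \<otimes> w'"
    using TVW by (auto simp: set_mult_def)
  then have "g = inv (v' \<otimes> w')" using g by (metis inv_inv)
  then have "g = inv w' \<otimes> inv v'" using vw' by (simp add: inv_mult_group)
  then show ?thesis using VWA inV[OF vw(3,1,2)] inW[of g "inv w'" "inv v'"] vw' by simp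
qed

end

section \<open>Core-free modular subgroups\<close>

text \<open>
  Induction on an exponent of \<open>v\<close>: if it is \<open>p ^ a * m\<close> with \<open>p\<close> prime to \<open>m\<close>, the subgroup contains the
  \<open>p\<close>-element \<open>v ^ m\<close> and, by induction, \<open>v ^ (p ^ a)\<close>.
\<close>

lemma (in finite_group) tau_elem_by_prime_elems:
  assumes C: "subgroup C G"
    and prime: "\<And>p v. prime p \<Longrightarrow> p \<in> \<tau> \<Longrightarrow> tau_elem G {p} v \<Longrightarrow> v \<in> C"
    and v: "tau_elem G \<tau> v"
  shows "v \<in> C"
proof -
  have "v \<in> C" if "tau_number \<tau> k" "v \<in> carrier G" "v [^] k = \<one>" for k v
    using that
  proof (induction k arbitrary: v rule: less_induct)
    case (less k)
    show ?case
    proof (cases "k = 1")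
      case True
      with less.prems have "v = \<one>" by simp
      then show ?thesis using subgroup.one_closed[OF C] by simp
    next
      case False
      then obtain p where p: "prime p" "p dvd k" using prime_factor_nat by blast
      have k0: "k > 0" using less.prems(1) by (simp add: tau_number_def)
      obtain a m where am: "k = p ^ a * m" "\<not> p dvd m"
        using multiplicity_decompose'[of k p] p(1) k0 by (metis not_gr0 not_prime_unit)
      have a0: "a \<noteq> 0" using am p(2) by (cases a) auto
      have pt: "p \<in> \<tau>" using less.prems(1) p by (simp add: tau_number_def)
      have "tau_number {p} (p ^ a)"
        using p(1) by (auto simp: tau_number_def prime_gt_0_nat dest: prime_dvd_power primes_dvd_imp_eq)
      moreover have "(v [^] m) [^] (p ^ a) = \<one>" "(v [^] (p ^ a)) [^] m = \<one>"
        using less.prems(2,3) am(1) by (simp_all add: nat_pow_pow mult.commute)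
      ultimately have "tau_elem G {p} (v [^] m)"
        using less.prems(2) by (auto simp: tau_elem_mod_def)
      then have 1: "v [^] m \<in> C" using prime[OF p(1) pt] by simp
      have "p ^ a > 1" using one_less_power[OF prime_gt_1_nat[OF p(1)], of a] a0 by simp
      moreover have "m > 0" using am(1) k0 by (cases m) auto
      ultimately have "m < k" using am(1) by simp
      moreover have "tau_number \<tau> m" using less.prems(1) am(1) by (auto intro: tau_number_dvd)
      ultimately have 2: "v [^] (p ^ a) \<in> C"
        using less.IH[of m "v [^] (p ^ a)"] less.prems(2) \<open>(v [^] (p ^ a)) [^] m = \<one>\<close> by simp
      have "coprime (p ^ a) m" using am(2) p(1) by (simp add: prime_imp_coprime)
      then show ?thesis using coprime_pow_in_subgroup[OF C less.prems(2) 2 1] by simp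
    qed
  qed
  with v show ?thesis by (auto simp: tau_elem_mod_def)
qed

lemma (in finite_group) commuting_subgroup:
  assumes "K \<subseteq> carrier G"
  shows "subgroup {u \<in> carrier G. \<forall>y\<in>K. u \<otimes> y = y \<otimes> u} G"
proof (rule finite_subgroupI)
  fix a b assume ab: "a \<in> {u \<in> carrier G. \<forall>y\<in>K. u \<otimes> y = y \<otimes> u}" "b \<in> {u \<in> carrier G. \<forall>y\<in>K. u \<otimes> y = y \<otimes> u}"
  have "a \<otimes> b \<otimes> y = y \<otimes> (a \<otimes> b)" if y: "y \<in> K" for y
  proof -
    have c: "a \<in> carrier G" "b \<in> carrier G" "y \<in> carrier G" using ab y assms by auto
    have "a \<otimes> b \<otimes> y = a \<otimes> (y \<otimes> b)" using ab y c by (simp add: m_assoc)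
    also have "\<dots> = (a \<otimes> y) \<otimes> b" using c by (simp add: m_assoc)
    also have "\<dots> = y \<otimes> (a \<otimes> b)" using ab y c by (simp add: m_assoc)
    finally show ?thesis .
  qed
  with ab show "a \<otimes> b \<in> {u \<in> carrier G. \<forall>y\<in>K. u \<otimes> y = y \<otimes> u}" by simp
qed (use assms in auto)

text \<open>
  The commutator of \<open>h\<close> and \<open>k\<close> lies in the \<open>P\<close>-group \<open>K\<close> and in the \<open>Q\<close>-group \<open>L\<close>.
\<close>

lemma (in finite_group) coprime_normal_commute:
  assumes PQ: "complementary P Q"
    and L: "L \<lhd> G" "\<And>l. l \<in> L \<Longrightarrow> tau_elem G Q l"
    and K: "subgroup K G" "\<And>k. k \<in> K \<Longrightarrow> tau_elem G P k"
    and h: "h \<in> L" "h \<in> normalizing G K" and k: "k \<in> K"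
  shows "h \<otimes> k = k \<otimes> h"
proof -
  interpret L: normal L G by fact
  interpret K: subgroup K G by fact
  have c: "h \<in> carrier G" "k \<in> carrier G" using h k by auto
  have "h \<otimes> k \<otimes> inv h \<otimes> inv k \<in> K" using normalizingD[OF h(2) k] k by simp
  moreover have "h \<otimes> (k \<otimes> inv h \<otimes> inv k) \<in> L"
    using h(1) L.inv_op_closed2[OF c(2), of "inv h"] by simp
  then have "h \<otimes> k \<otimes> inv h \<otimes> inv k \<in> L" using c by (simp add: m_assoc)
  ultimately have "h \<otimes> k \<otimes> inv h \<otimes> inv k = \<one>"
    using complementary_elem_one[OF PQ K(2) L(2)] by simp
  then show ?thesis by (rule commutator_one_imp_commute[OF c])
qed

locale core_free_modular = modular_sigma_subnormal +
  assumes core_free: "\<And>x. x \<in> carrier G \<Longrightarrow> (\<And>g. g \<in> carrier G \<Longrightarrow> g \<otimes> x \<otimes> inv g \<in> A) \<Longrightarrow> x = \<one>"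
begin

lemma core_free_swap: "core_free_modular G Q P A"
  by (rule core_free_modular.intro[OF swap core_free_modular_axioms.intro]) (rule core_free)

lemma tau_parts_Int:
  assumes "x \<in> tau_part P" "x \<in> tau_part Q" shows "x = \<one>"
proof (rule core_free)
  show "x \<in> carrier G" using assms(1) tau_part[of P] A_subset by blast
qed (use tau_parts_conj_in[OF assms] in blast)

lemma A_factorization:
  assumes "a \<in> A"
  obtains x y where "x \<in> tau_part Q" "y \<in> tau_part P" "a = x \<otimes> y"
proof -
  obtain i j :: nat where ij: "a = a [^] i \<otimes> a [^] j" "tau_elem G Q (a [^] i)" "tau_elem G P (a [^] j)"
    using tau_elem_factorization[OF complementary_sym[OF PQ] subsetD[OF A_subset assms]] by blast
  have "a [^] i \<in> tau_part Q" "a [^] j \<in> tau_part P"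
    using subgroup_pow_closed[OF A assms] ij(2,3) by (simp_all add: tau_part_incl)
  then show ?thesis using ij(1) by (rule that)
qed

lemma A_normalizes: "A \<subseteq> normalizing G (tau_part \<tau>)"
proof
  interpret A: subgroup A G by (rule A)
  fix a assume a: "a \<in> A"
  then show "a \<in> normalizing G (tau_part \<tau>)"
    unfolding tau_part_def
    by (intro normalizing_generateI) (auto intro!: generate.incl tau_elem_conj)
qed

lemma tau_parts_commute:
  assumes "x \<in> tau_part Q" "y \<in> tau_part P"
  shows "x \<otimes> y = y \<otimes> x"
proof -
  interpret X: subgroup "tau_part Q" G by (rule tau_part)
  interpret Y: subgroup "tau_part P" G by (rule tau_part)
  have A: "x \<in> A" "y \<in> A" using assms tau_part(2) by auto
  have c: "x \<in> carrier G" "y \<in> carrier G" using assms by auto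
  have "x \<otimes> y \<otimes> inv x \<in> tau_part P" using A_normalizes A(1) assms(2) by (blast intro: normalizingD)
  then have 1: "x \<otimes> y \<otimes> inv x \<otimes> inv y \<in> tau_part P" using assms by simp
  have "y \<otimes> inv x \<otimes> inv y \<in> tau_part Q"
    using A_normalizes A(2) X.m_inv_closed[OF assms(1)] by (blast intro: normalizingD)
  then have "x \<otimes> (y \<otimes> inv x \<otimes> inv y) \<in> tau_part Q" using assms by simp
  then have "x \<otimes> y \<otimes> inv x \<otimes> inv y \<in> tau_part Q" using c by (simp add: m_assoc)
  with 1 have "x \<otimes> y \<otimes> inv x \<otimes> inv y = \<one>" by (intro tau_parts_Int)
  then show ?thesis by (rule commutator_one_imp_commute[OF c])
qed

text \<open>
  The \<open>P\<close>-part of \<open>x\<close> is a power of \<open>x\<close>, so it lies in both parts of \<open>A\<close>, and these meet trivially.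
\<close>

lemma tau_part_elem:
  assumes x: "x \<in> tau_part Q"
  shows "tau_elem G Q x"
proof -
  have xA: "x \<in> A" using x tau_part(2) by blast
  have xG: "x \<in> carrier G" using xA A_subset by blast
  obtain i j :: nat where ij: "x = x [^] i \<otimes> x [^] j" "tau_elem G P (x [^] i)" "tau_elem G Q (x [^] j)"
    using tau_elem_factorization[OF PQ xG] by blast
  have "x [^] i \<in> tau_part Q" using tau_part(1) x by (rule subgroup_pow_closed)
  moreover have "x [^] i \<in> tau_part P"
    using subgroup_pow_closed[OF A xA] ij(2) by (rule tau_part_incl)
  ultimately have "x [^] i = \<one>" by (intro tau_parts_Int)
  then have "x = x [^] j" using ij(1) xG by simp
  then show ?thesis using ij(3) by simp
qed

abbreviation "Q_closure \<equiv> normal_closure G (tau_part Q)"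

lemma tau_part_subset: "tau_part \<tau> \<subseteq> carrier G"
  using tau_part(2) A_subset by blast

lemmas Q_closure_least = normal_closure_least[OF is_group tau_part_subset[of Q]]

lemma Q_closure_elem: "l \<in> Q_closure \<Longrightarrow> tau_elem G Q l"
  by (rule normal_closure_tau_elem[OF PQ tau_part(1) tau_part_elem tau_elem_normalizes_tau_part])

text \<open>
  Write \<open>X\<close>, \<open>Y\<close> for the two parts of \<open>A\<close>, \<open>L\<close> for the \<open>Q\<close>-group \<open>X\<^sup>G\<close> and \<open>H = \<langle>s\<rangle>\<close>. The \<open>Q\<close>-group \<open>H1 = H \<inter> L\<close>
  normalizes the \<open>P\<close>-groups \<open>V\<close> and \<open>Y\<close> and lies in \<open>L\<close>, so it centralizes both. By modularity \<open>\<langle>A, s\<rangle> \<inter> L Y\<close>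
  is generated by \<open>A\<close> and \<open>H1\<close>; hence \<open>s X s\<inverse>\<close>, being contained in it and in \<open>L\<close>, lies in \<open>U = \<langle>X, H1\<rangle>\<close>. By
  modularity again the normalizer \<open>X0\<close> of \<open>X\<close> in \<open>U\<close> is \<open>X (H \<inter> X0)\<close>, and \<open>v\<close> centralizes \<open>X0/X\<close>. For \<open>c \<in> U\<close> the
  commutator \<open>d = [v, c]\<close> lies in \<open>X0\<close>, because \<open>v\<close> normalizes \<open>U\<close>, and the \<open>P\<close>-elements \<open>v\<close> and \<open>c v\<inverse> c\<inverse>\<close>
  normalize \<open>X\<close>. So conjugating \<open>c\<close> by \<open>v ^ k\<close> multiplies it by \<open>d ^ k\<close> modulo \<open>X\<close>. With a \<open>P\<close>-number \<open>k\<close>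
  killing \<open>v\<close> this gives \<open>d ^ k \<in> X\<close>, and then \<open>d \<in> X\<close> since \<open>d\<close> is a \<open>Q\<close>-element.
\<close>

lemma commutator_in_tau_part:
  assumes V: "subgroup V G" "\<And>v. v \<in> V \<Longrightarrow> tau_elem G P v"
    and s: "tau_elem G Q s" "s \<in> normalizing G V"
    and v: "v \<in> V" and x: "x \<in> tau_part Q"
  shows "v \<otimes> (s \<otimes> x \<otimes> inv s) \<otimes> inv v \<otimes> inv (s \<otimes> x \<otimes> inv s) \<in> tau_part Q"
proof -
  interpret sw: core_free_modular G Q P A by (rule core_free_swap)
  define X where "X = tau_part Q"
  define Y where "Y = tau_part P"
  define L where "L = Q_closure"
  have YP: "\<And>y. y \<in> Y \<Longrightarrow> tau_elem G P y"
    using sw.tau_part_elem by (simp add: Y_def tau_part_def sw.tau_part_def)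
  have YQ: "\<And>q. tau_elem G Q q \<Longrightarrow> q \<in> normalizing G Y"
    using sw.tau_elem_normalizes_tau_part by (simp add: Y_def tau_part_def sw.tau_part_def)
  have XP: "\<And>q. tau_elem G P q \<Longrightarrow> q \<in> normalizing G X"
    unfolding X_def by (rule tau_elem_normalizes_tau_part)
  interpret V: subgroup V G by fact
  interpret X: subgroup X G unfolding X_def by (rule tau_part)
  interpret Y: subgroup Y G unfolding Y_def by (rule tau_part)
  interpret L: normal L G unfolding L_def by (rule Q_closure_least)
  have XL: "X \<subseteq> L" unfolding X_def L_def by (rule Q_closure_least)
  have XA: "X \<subseteq> A" and YA: "Y \<subseteq> A" unfolding X_def Y_def by (rule tau_part)+
  have LE: "\<And>l. l \<in> L \<Longrightarrow> tau_elem G Q l" unfolding L_def by (rule Q_closure_elem)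
  have LY1: "z = \<one>" if "z \<in> L" "z \<in> Y" for z
    using complementary_elem_one[OF PQ YP[OF that(2)] LE[OF that(1)]] .
  have LYQ: "z \<in> L" if "z = l \<otimes> y" "l \<in> L" "y \<in> Y" "tau_elem G Q z" for z l y
  proof (rule tau_elem_in_normal_factor[OF PQ L.normal_axioms])
    show "z \<in> L <#> Y" using that by (simp add: set_multI)
    show "tau_elem_mod G P L y" if "y \<in> Y" for y
      using YP[OF that] by (rule tau_elem_mod_mono) simp
  qed (fact that(4))
  have sG: "s \<in> carrier G" using s(1) by (rule tau_elem_mod_carrier)
  define H where "H = generate G {s}"
  have H: "subgroup H G" unfolding H_def using sG by (intro generate_is_subgroup) auto
  interpret H: subgroup H G by fact
  have HQ: "\<And>h. h \<in> H \<Longrightarrow> tau_elem G Q h" unfolding H_def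
    using s(1) by (rule generate_singleton_tau_elem)
  have HV: "H \<subseteq> normalizing G V"
    unfolding H_def using s(2) normalizing_subgroup[OF V.subset]
    by (intro generate_subgroup_incl) auto
  define H1 where "H1 = H \<inter> L"
  have H1: "subgroup H1 G" unfolding H1_def using H L.subgroup_axioms by (rule subgroups_Inter_pair)
  interpret H1: subgroup H1 G by fact
  have H1V: "h \<otimes> u = u \<otimes> h" if "h \<in> H1" "u \<in> V" for h u
    using that HV by (intro coprime_normal_commute[OF PQ L.normal_axioms LE V]) (auto simp: H1_def)
  have H1Y: "h \<otimes> y = y \<otimes> h" if "h \<in> H1" "y \<in> Y" for h y
    using that YQ[OF HQ]
    by (intro coprime_normal_commute[OF PQ L.normal_axioms LE Y.subgroup_axioms YP]) (auto simp: H1_def)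
  define U where "U = generate G (X \<union> H1)"
  have XH1: "X \<union> H1 \<subseteq> carrier G" by auto
  interpret U: subgroup U G unfolding U_def using XH1 by (rule generate_is_subgroup)
  have XU: "X \<subseteq> U" and HU: "H1 \<subseteq> U" unfolding U_def by (auto intro: generate.incl)
  have UL: "U \<subseteq> L"
    unfolding U_def using XL L.subgroup_axioms by (intro generate_subgroup_incl) (auto simp: H1_def)
  have UY: "u \<otimes> y = y \<otimes> u" if "u \<in> U" "y \<in> Y" for u y
  proof -
    have "X \<union> H1 \<subseteq> {u \<in> carrier G. \<forall>y\<in>Y. u \<otimes> y = y \<otimes> u}"
      using tau_parts_commute H1Y by (auto simp: X_def[symmetric] Y_def[symmetric])
    then have "U \<subseteq> {u \<in> carrier G. \<forall>y\<in>Y. u \<otimes> y = y \<otimes> u}"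
      unfolding U_def using commuting_subgroup[OF Y.subset] by (rule generate_subgroup_incl)
    with that show ?thesis by auto
  qed
  \<comment> \<open>To apply modularity to a subgroup \<open>W\<close> with \<open>X \<le> W \<le> U\<close>, it is enlarged to \<open>W Y\<close>, which
    contains \<open>A = X Y\<close>; intersecting with \<open>L\<close> recovers \<open>W\<close>.\<close>
  have prod: "subgroup (W <#> Y) G" "W \<subseteq> W <#> Y" "Y \<subseteq> W <#> Y" "A \<subseteq> W <#> Y"
    if W: "subgroup W G" "W \<subseteq> U" "X \<subseteq> W" for W
  proof -
    have "y \<otimes> w \<otimes> inv y \<in> W" if "y \<in> Y" "w \<in> W" for y w
    proof -
      have "w \<in> U" using that W(2) by blast
      then have "y \<otimes> w \<otimes> inv y = w \<otimes> y \<otimes> inv y" using UY[OF _ that(1)] by simp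
      also have "\<dots> = w" using \<open>w \<in> U\<close> that by (simp add: m_assoc)
      finally show ?thesis using that by simp
    qed
    then have "Y \<subseteq> normalizing G W" by (auto simp: normalizing_def)
    note WY = set_mult_normalized[OF W(1) Y.subgroup_axioms this]
    show "subgroup (W <#> Y) G" "W \<subseteq> W <#> Y" "Y \<subseteq> W <#> Y" using WY by simp_all
    show "A \<subseteq> W <#> Y"
    proof
      fix a assume "a \<in> A"
      then obtain x y where "x \<in> X" "y \<in> Y" "a = x \<otimes> y"
        unfolding X_def Y_def by (rule A_factorization)
      then show "a \<in> W <#> Y" using W(3) by (auto intro: set_multI)
    qed
  qed
  define T where "T = generate G (A \<union> H)"
  have T: "subgroup T G" "A \<subseteq> T" "H \<subseteq> T" unfolding T_def using join[OF H.subset] by auto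
  interpret T: subgroup T G by (rule T)
  define c where "c = s \<otimes> x \<otimes> inv s"
  have cG: "c \<in> carrier G" using x sG X.mem_carrier by (simp add: c_def X_def)
  have cL: "c \<in> L" using x XL L.inv_op_closed2[OF sG] by (auto simp: c_def X_def)
  have sH: "s \<in> H" by (auto simp: H_def intro: generate.incl)
  have cT: "c \<in> T" using x XA T(2,3) sH by (auto simp: c_def X_def intro!: T.m_closed)
  have cU: "c \<in> U"
  proof -
    have Yn: "Y \<subseteq> normalizing G L" using L.inv_op_closed2 by (auto simp: normalizing_def)
    note LY = set_mult_normalized[OF L.subgroup_axioms Y.subgroup_axioms Yn]
    have ALY: "A \<subseteq> L <#> Y"
    proof
      fix a assume "a \<in> A"
      then obtain x y where "x \<in> X" "y \<in> Y" "a = x \<otimes> y"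
        unfolding X_def Y_def by (rule A_factorization)
      then show "a \<in> L <#> Y" using XL by (auto intro: set_multI)
    qed
    define Z where "Z = T \<inter> (L <#> Y)"
    have Z: "subgroup Z G" unfolding Z_def using T(1) LY(1) by (rule subgroups_Inter_pair)
    have "Z \<subseteq> generate G (A \<union> (H \<inter> Z))"
      using T(2) ALY by (intro modular[OF H Z]) (auto simp: Z_def T_def)
    moreover have "H \<inter> Z \<subseteq> H1"
    proof
      fix h assume h: "h \<in> H \<inter> Z"
      then obtain l y where "h = l \<otimes> y" "l \<in> L" "y \<in> Y" by (auto simp: Z_def set_mult_def)
      then show "h \<in> H1" using LYQ HQ h by (auto simp: H1_def)
    qed
    then have "generate G (A \<union> (H \<inter> Z)) \<subseteq> U <#> Y"
      using prod[OF U.subgroup_axioms subset_refl XU] HU by (intro join_least) auto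
    moreover have "c \<in> Z" using cT cL LY(2) by (auto simp: Z_def)
    ultimately obtain u y where uy: "u \<in> U" "y \<in> Y" "c = u \<otimes> y" by (auto simp: set_mult_def)
    have uG: "u \<in> carrier G" "y \<in> carrier G" using uy by auto
    have "inv u \<otimes> c \<in> L" using uy(1) UL cL by auto
    moreover have "inv u \<otimes> c = y" using uG uy(3) by (simp add: cancel_left_inv)
    ultimately have "y = \<one>" using LY1 uy(2) by simp
    with uy uG show ?thesis by simp
  qed
  define X0 where "X0 = U \<inter> normalizing G X"
  have X0: "subgroup X0 G"
    unfolding X0_def using U.subgroup_axioms normalizing_subgroup[OF X.subset]
    by (rule subgroups_Inter_pair)
  interpret X0: subgroup X0 G by fact
  have XX0: "X \<subseteq> X0" using XU subgroup_normalizing[OF X.subgroup_axioms] by (auto simp: X0_def)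
  have X0U: "X0 \<subseteq> U" by (auto simp: X0_def)
  define H0 where "H0 = H \<inter> X0"
  have H0: "subgroup H0 G" unfolding H0_def using H X0 by (rule subgroups_Inter_pair)
  have H01: "H0 \<subseteq> H1" using X0U UL by (auto simp: H0_def H1_def)
  have H0n: "H0 \<subseteq> normalizing G X" by (auto simp: H0_def X0_def)
  note XH0 = set_mult_normalized[OF X.subgroup_axioms H0 H0n]
  have XH0U: "X <#> H0 \<subseteq> U" using XU HU H01 by (auto simp: set_mult_def intro!: U.m_closed)
  note p0 = prod[OF X0 X0U XX0] and p1 = prod[OF XH0(1) XH0U XH0(2)]
  have X0eq: "\<exists>x\<in>X. \<exists>h\<in>H1. z = x \<otimes> h" if z: "z \<in> X0" for z
  proof -
    have "U \<subseteq> T" unfolding U_def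
      using XA T by (intro generate_subgroup_incl T(1)) (auto simp: H1_def)
    then have "X0 <#> Y \<subseteq> T" using X0U YA T(2) by (auto simp: set_mult_def intro!: T.m_closed)
    then have "X0 <#> Y \<subseteq> generate G (A \<union> (H \<inter> (X0 <#> Y)))"
      using p0(4) unfolding T_def by (intro modular[OF H p0(1)])
    moreover have "H \<inter> (X0 <#> Y) \<subseteq> H0"
    proof
      fix h assume h: "h \<in> H \<inter> (X0 <#> Y)"
      then obtain l y where ly: "h = l \<otimes> y" "l \<in> X0" "y \<in> Y" by (auto simp: set_mult_def)
      have lL: "l \<in> L" using ly(2) X0U UL by blast
      have hL: "h \<in> L" using LYQ[OF ly(1) lL ly(3)] HQ h by simp
      have lyG: "l \<in> carrier G" "y \<in> carrier G" using ly by auto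
      have "inv l \<otimes> h \<in> L" using lL hL by simp
      moreover have "inv l \<otimes> h = y" using ly(1) lyG by (simp add: cancel_left_inv)
      ultimately have "y = \<one>" using LY1 ly(3) by simp
      then show "h \<in> H0" using ly h lyG by (simp add: H0_def)
    qed
    then have "generate G (A \<union> (H \<inter> (X0 <#> Y))) \<subseteq> (X <#> H0) <#> Y"
      using p1 XH0(3) by (intro join_least) auto
    moreover have "z \<in> X0 <#> Y" using p0(2) z by blast
    ultimately have "z \<in> (X <#> H0) <#> Y" by blast
    then obtain w y where wy: "w \<in> X <#> H0" "y \<in> Y" "z = w \<otimes> y"
      by (auto simp only: set_mult_def UN_iff singleton_iff)
    then obtain x h where xh: "x \<in> X" "h \<in> H0" "w = x \<otimes> h" by (auto simp: set_mult_def)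
    have wU: "w \<in> U" using wy(1) XH0U by blast
    have wyG: "w \<in> carrier G" "y \<in> carrier G" using wU wy(2) by auto
    have "inv w \<otimes> z \<in> L" using wU UL z X0U by auto
    moreover have "inv w \<otimes> z = y" using wy(3) wyG by (simp add: cancel_left_inv)
    ultimately have "y = \<one>" using LY1 wy(2) by simp
    then have "z = x \<otimes> h" using wy(3) wyG xh(3) by simp
    with xh H01 show ?thesis by blast
  qed
  have vG: "v \<in> carrier G" using v by simp
  have vX: "v \<otimes> y \<otimes> inv v \<in> X" if "y \<in> X" for y using XP[OF V(2)[OF v]] that by (rule normalizingD)
  have vU: "v \<otimes> u \<otimes> inv v \<in> U" if u: "u \<in> U" for u
  proof -
    have "v \<in> normalizing G U"
      unfolding U_def
    proof (rule normalizing_generateI[OF XH1 vG])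
      fix y assume "y \<in> X \<union> H1"
      then have "v \<otimes> y \<otimes> inv v \<in> X \<union> H1"
      proof
        assume y: "y \<in> H1"
        then have "v \<otimes> y \<otimes> inv v = y \<otimes> v \<otimes> inv v" using H1V v by simp
        also have "\<dots> = y" using y vG by (simp add: m_assoc)
        finally show ?thesis using y by simp
      qed (simp add: vX)
      then show "v \<otimes> y \<otimes> inv v \<in> generate G (X \<union> H1)" by (rule generate.incl)
    qed
    then show ?thesis using u by (rule normalizingD)
  qed
  define d where "d = v \<otimes> c \<otimes> inv v \<otimes> inv c"
  have dG: "d \<in> carrier G" using vG cG by (simp add: d_def)
  have dU: "d \<in> U" using vU[OF cU] cU by (simp add: d_def)
  have dn: "d \<in> normalizing G X"
  proof -
    have "tau_elem G P (c \<otimes> inv v \<otimes> inv c)"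
      using V(2)[OF V.m_inv_closed[OF v]] cG by (intro tau_elem_conj)
    then have "c \<otimes> inv v \<otimes> inv c \<in> normalizing G X" by (rule XP)
    with normalizing_subgroup[OF X.subset] XP[OF V(2)[OF v]]
    have "v \<otimes> (c \<otimes> inv v \<otimes> inv c) \<in> normalizing G X" by (rule subgroup.m_closed)
    then show ?thesis using vG cG by (simp add: d_def m_assoc)
  qed
  have dX0: "d \<in> X0" using dU dn by (simp add: X0_def)
  have vd: "\<exists>y\<in>X. v \<otimes> d \<otimes> inv v = y \<otimes> d"
  proof -
    obtain y h where yh: "y \<in> X" "h \<in> H1" "d = y \<otimes> h" using X0eq[OF dX0] by blast
    have G: "y \<in> carrier G" "h \<in> carrier G" using yh by auto
    have "v \<otimes> d \<otimes> inv v = v \<otimes> y \<otimes> (h \<otimes> inv v)" unfolding yh(3) using G vG by (simp add: m_assoc)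
    also have "h \<otimes> inv v = inv v \<otimes> h" using H1V[OF yh(2) V.m_inv_closed[OF v]] .
    also have "v \<otimes> y \<otimes> (inv v \<otimes> h) = (v \<otimes> y \<otimes> inv v \<otimes> inv y) \<otimes> d"
      unfolding yh(3) using G vG by (simp add: m_assoc cancel_left_inv)
    finally show ?thesis using vX[OF yh(1)] yh(1) by (intro bexI[of _ "v \<otimes> y \<otimes> inv v \<otimes> inv y"]) auto
  qed
  have iter: "\<exists>y\<in>X. v [^] k \<otimes> c \<otimes> inv (v [^] k) = y \<otimes> d [^] k \<otimes> c" for k :: nat
  proof (induction k)
    case 0
    show ?case using cG by (intro bexI[of _ \<one>]) auto
  next
    case (Suc k)
    then obtain y where y: "y \<in> X" "v [^] k \<otimes> c \<otimes> inv (v [^] k) = y \<otimes> d [^] k \<otimes> c" by blast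
    obtain z where z: "z \<in> X" "v \<otimes> d \<otimes> inv v = z \<otimes> d" using vd by blast
    obtain w where w: "w \<in> X" "(z \<otimes> d) [^] k = w \<otimes> d [^] k"
      using coset_pow[OF X.subgroup_axioms dn z(1)] by blast
    have G: "y \<in> carrier G" "z \<in> carrier G" "w \<in> carrier G" using y z w by auto
    have "v [^] Suc k = v \<otimes> v [^] k" by (rule nat_pow_Suc2[OF vG])
    then have "v [^] Suc k \<otimes> c \<otimes> inv (v [^] Suc k) = v \<otimes> (v [^] k \<otimes> c \<otimes> inv (v [^] k)) \<otimes> inv v"
      using vG cG by (simp add: m_assoc inv_mult_group)
    also have "\<dots> = v \<otimes> (y \<otimes> d [^] k \<otimes> c) \<otimes> inv v" unfolding y(2) ..
    also have "\<dots> = (v \<otimes> y \<otimes> inv v) \<otimes> (v \<otimes> d [^] k \<otimes> inv v) \<otimes> (v \<otimes> c \<otimes> inv v)"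
      using G vG cG dG by (simp add: m_assoc cancel_left_inv)
    also have "v \<otimes> d [^] k \<otimes> inv v = w \<otimes> d [^] k" using conj_pow[OF vG dG, of k] z(2) w(2) by simp
    also have "v \<otimes> c \<otimes> inv v = d \<otimes> c" using vG cG by (simp add: d_def m_assoc)
    also have "(v \<otimes> y \<otimes> inv v) \<otimes> (w \<otimes> d [^] k) \<otimes> (d \<otimes> c) = (v \<otimes> y \<otimes> inv v \<otimes> w) \<otimes> d [^] Suc k \<otimes> c"
      using G vG cG dG by (simp add: m_assoc)
    finally show ?case using vX[OF y(1)] w(1) by (intro bexI[of _ "v \<otimes> y \<otimes> inv v \<otimes> w"]) auto
  qed
  obtain k where k: "tau_number P k" "v [^] k = \<one>" using V(2)[OF v] by (auto simp: tau_elem_mod_def)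
  obtain y where y: "y \<in> X" "v [^] k \<otimes> c \<otimes> inv (v [^] k) = y \<otimes> d [^] k \<otimes> c" using iter by blast
  have yG: "y \<in> carrier G" using y by auto
  have "c = y \<otimes> d [^] k \<otimes> c" using y(2) k(2) cG by simp
  then have c: "y \<otimes> d [^] k \<otimes> c = c" by (rule sym)
  have "d [^] k = inv y \<otimes> (y \<otimes> d [^] k \<otimes> c) \<otimes> inv c"
    using cG dG yG by (simp add: m_assoc cancel_left_inv)
  also have "\<dots> = inv y" unfolding c using cG yG by (simp add: m_assoc)
  finally have "d [^] k = inv y" .
  then have "tau_elem_mod G P X d" using y(1) k(1) dG by (auto simp: tau_elem_mod_def)
  moreover have "tau_elem G Q d" using LE dU UL by blast
  ultimately have "d \<in> X" by (rule tau_elem_in[OF PQ X.subgroup_axioms])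
  then show ?thesis by (simp add: d_def c_def X_def)
qed

text \<open>
  All conjugates of \<open>[v, x]\<close> lie in \<open>X = tau_part Q\<close>, so \<open>[v, x] = 1\<close> as \<open>A\<close> is core-free. To see this,
  write the conjugating element as \<open>g = r n\<close> with \<open>r \<in> R\<close>, the subgroup generated by the \<open>P\<close>-elements,
  and \<open>n\<close> normalizing a Sylow subgroup of \<open>R\<close>. The \<open>P\<close>-part of \<open>n\<close> lies in \<open>R\<close>, and \<open>R\<close> is normal and
  normalizes \<open>X\<close>; so the \<open>Q\<close>-part of \<open>n\<close> conjugates \<open>X\<close> as \<open>g\<close> does.
\<close>

lemma tau_part_commutes_prime:
  assumes p: "prime p" "p \<in> P" and v: "tau_elem G {p} v" and x: "x \<in> tau_part Q"
  shows "v \<otimes> x = x \<otimes> v"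
proof -
  interpret X: subgroup "tau_part Q" G by (rule tau_part)
  define R where "R = generate G {v. tau_elem G P v}"
  interpret R: normal R G unfolding R_def by (rule tau_elems_generate_normal)
  have Rn: "R \<subseteq> normalizing G (tau_part Q)"
    unfolding R_def using tau_elem_normalizes_tau_part normalizing_subgroup[OF X.subset]
    by (intro generate_subgroup_incl) auto
  have RP: "u \<in> R" if "tau_elem G P u" for u using that by (auto simp: R_def intro: generate.incl)
  have pP: "tau_elem G P u" if "tau_elem G {p} u" for u
    using that by (rule tau_elem_in_subset) (simp add: p(2))
  have vG: "v \<in> carrier G" using v by (rule tau_elem_mod_carrier)
  have key: "u \<otimes> (g \<otimes> y \<otimes> inv g) \<otimes> inv u \<otimes> inv (g \<otimes> y \<otimes> inv g) \<in> tau_part Q"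
    if u: "tau_elem G {p} u" and g: "g \<in> carrier G" and y: "y \<in> tau_part Q" for u g y
  proof -
    obtain V where V: "subgroup V G" "V \<subseteq> R" "u \<in> V" "tau_number {p} (card V)"
      "\<And>g. g \<in> carrier G \<Longrightarrow> \<exists>r\<in>R. \<exists>n\<in>normalizing G V. g = r \<otimes> n"
      using frattini[OF R.normal_axioms p(1) RP[OF pP[OF u]] u] by blast
    have VP: "tau_elem G P w" if "w \<in> V" for w using pP[OF tau_elem_card[OF V(1,4) that]] .
    obtain r n where rn: "r \<in> R" "n \<in> normalizing G V" "g = r \<otimes> n" using V(5)[OF g] by blast
    have nG: "n \<in> carrier G" using rn(2) normalizing_subset by blast
    obtain i j :: nat where ij: "n = n [^] i \<otimes> n [^] j" "tau_elem G Q (n [^] i)" "tau_elem G P (n [^] j)"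
      using tau_elem_factorization[OF complementary_sym[OF PQ] nG] by blast
    define s where "s = n [^] i"
    define w where "w = n [^] j"
    have sG: "s \<in> carrier G" and wG: "w \<in> carrier G" using nG by (simp_all add: s_def w_def)
    have sV: "s \<in> normalizing G V"
      unfolding s_def using normalizing_subgroup[OF subgroup.subset[OF V(1)]] rn(2)
      by (rule subgroup_pow_closed)
    define t where "t = (inv s \<otimes> r \<otimes> s) \<otimes> w"
    have tR: "t \<in> R" unfolding t_def
      using R.inv_op_closed1[OF sG rn(1)] RP[of w] ij(3) by (simp add: w_def)
    have gs: "g = s \<otimes> t"
      using rn(1) sG wG ij(1)[folded s_def w_def] unfolding t_def rn(3)
      by (simp add: m_assoc cancel_left_inv)
    have "t \<otimes> y \<otimes> inv t \<in> tau_part Q" using Rn tR y by (blast intro: normalizingD)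
    then have "u \<otimes> (s \<otimes> (t \<otimes> y \<otimes> inv t) \<otimes> inv s) \<otimes> inv u \<otimes> inv (s \<otimes> (t \<otimes> y \<otimes> inv t) \<otimes> inv s) \<in> tau_part Q"
      using ij(2) by (intro commutator_in_tau_part[OF V(1) VP _ sV V(3)]) (simp_all add: s_def)
    moreover have "s \<otimes> (t \<otimes> y \<otimes> inv t) \<otimes> inv s = g \<otimes> y \<otimes> inv g"
      unfolding gs using sG tR y by (simp add: m_assoc inv_mult_group)
    ultimately show ?thesis by simp
  qed
  have xG: "x \<in> carrier G" using x by simp
  have "v \<otimes> x \<otimes> inv v \<otimes> inv x = \<one>"
  proof (rule core_free)
    fix g assume g: "g \<in> carrier G"
    have "g \<otimes> (v \<otimes> x \<otimes> inv v \<otimes> inv x) \<otimes> inv g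
        = (g \<otimes> v \<otimes> inv g) \<otimes> (g \<otimes> x \<otimes> inv g) \<otimes> inv (g \<otimes> v \<otimes> inv g) \<otimes> inv (g \<otimes> x \<otimes> inv g)"
      using g vG xG by (simp add: m_assoc inv_mult_group cancel_left_inv)
    also have "\<dots> \<in> A" using key[OF tau_elem_conj[OF g v] g x] tau_part(2) by blast
    finally show "g \<otimes> (v \<otimes> x \<otimes> inv v \<otimes> inv x) \<otimes> inv g \<in> A" .
  qed (use vG xG in simp)
  then show ?thesis by (rule commutator_one_imp_commute[OF vG xG])
qed

text \<open>
  The elements commuting with all \<open>P\<close>-elements form a normal subgroup, so it suffices to look at
  \<open>tau_part Q\<close>; there it suffices to look at \<open>P\<close>-elements of prime power order.
\<close>

lemma Q_closure_commutes:
  assumes l: "l \<in> Q_closure" and v: "tau_elem G P v"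
  shows "v \<otimes> l = l \<otimes> v"
proof -
  have tp: "v \<otimes> x = x \<otimes> v" if x: "x \<in> tau_part Q" and v: "tau_elem G P v" for x v
  proof -
    have xG: "x \<in> carrier G" using x tau_part_subset by blast
    have "v \<in> {u \<in> carrier G. \<forall>y\<in>{x}. u \<otimes> y = y \<otimes> u}"
      using v
    proof (rule tau_elem_by_prime_elems[rotated 2])
      show "subgroup {u \<in> carrier G. \<forall>y\<in>{x}. u \<otimes> y = y \<otimes> u} G"
        using xG by (intro commuting_subgroup) simp
      fix p u assume "prime p" "p \<in> P" "tau_elem G {p} u"
      then show "u \<in> {u \<in> carrier G. \<forall>y\<in>{x}. u \<otimes> y = y \<otimes> u}"
        using tau_part_commutes_prime[of p u x] x tau_elem_mod_carrier[of G "{p}" "{\<one>}" u] by simp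
    qed
    then show ?thesis by simp
  qed
  define C where "C = {u \<in> carrier G. \<forall>y\<in>{v. tau_elem G P v}. u \<otimes> y = y \<otimes> u}"
  have "C \<lhd> G"
  proof (rule normal_invI)
    show "subgroup C G" unfolding C_def by (rule commuting_subgroup) (auto simp: tau_elem_mod_def)
    fix g u assume g: "g \<in> carrier G" and u: "u \<in> C"
    have "g \<otimes> u \<otimes> inv g \<otimes> y = y \<otimes> (g \<otimes> u \<otimes> inv g)" if y: "tau_elem G P y" for y
    proof -
      have c: "y \<in> carrier G" "u \<in> carrier G" using y u by (auto simp: C_def tau_elem_mod_def)
      have "tau_elem G P (inv g \<otimes> y \<otimes> inv (inv g))" using y g by (intro tau_elem_conj) auto
      then have "u \<otimes> (inv g \<otimes> y \<otimes> g) = (inv g \<otimes> y \<otimes> g) \<otimes> u" using u g by (simp add: C_def)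
      then have "g \<otimes> (u \<otimes> (inv g \<otimes> y \<otimes> g)) \<otimes> inv g = g \<otimes> ((inv g \<otimes> y \<otimes> g) \<otimes> u) \<otimes> inv g" by simp
      then show ?thesis using g c by (simp add: m_assoc cancel_left_inv)
    qed
    with g u show "g \<otimes> u \<otimes> inv g \<in> C" by (simp add: C_def)
  qed
  moreover have "tau_part Q \<subseteq> C" using tp tau_part_subset by (auto simp: C_def)
  ultimately have "Q_closure \<subseteq> C" by (rule Q_closure_least(3))
  then have "l \<in> C" using l by blast
  then have "l \<otimes> v = v \<otimes> l" using v unfolding C_def by blast
  then show ?thesis by (rule sym)
qed

lemma normal_closure_A:
  "normal_closure G A = Q_closure <#> normal_closure G (tau_part P)"
proof
  let ?M = "normal_closure G (tau_part P)"
  note M = normal_closure_least[OF is_group tau_part_subset[of P]]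
  note nc = normal_closure_least[OF is_group A_subset]
  have "Q_closure <#> ?M \<lhd> G"
    using Q_closure_least(1) M(1) by (rule normal_subgroup_set_mult_closed)
  moreover have "A \<subseteq> Q_closure <#> ?M"
  proof
    fix a assume "a \<in> A"
    then obtain x y where "x \<in> tau_part Q" "y \<in> tau_part P" "a = x \<otimes> y" by (rule A_factorization)
    then show "a \<in> Q_closure <#> ?M" using Q_closure_least(2) M(2) by (auto intro: set_multI)
  qed
  ultimately show "normal_closure G A \<subseteq> Q_closure <#> ?M" by (rule nc(3))
  have "tau_part \<tau> \<subseteq> normal_closure G A" for \<tau> using tau_part(2) nc(2) by blast
  then have "Q_closure \<subseteq> normal_closure G A" "?M \<subseteq> normal_closure G A"
    using Q_closure_least(3)[OF nc(1)] M(3)[OF nc(1)] by auto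
  then show "Q_closure <#> ?M \<subseteq> normal_closure G A"
    using subgroup.m_closed[OF normal_imp_subgroup[OF nc(1)]] by (auto simp: set_mult_def)
qed

theorem core_free_structure:
  "\<exists>L M. L \<lhd> G \<and> M \<lhd> G \<and> normal_closure G A = L <#> M \<and>
    (\<forall>l\<in>L. tau_elem G Q l) \<and> (\<forall>m\<in>M. tau_elem G P m) \<and>
    (\<forall>l\<in>L. \<forall>v. tau_elem G P v \<longrightarrow> v \<otimes> l = l \<otimes> v) \<and>
    (\<forall>m\<in>M. \<forall>w. tau_elem G Q w \<longrightarrow> w \<otimes> m = m \<otimes> w)"
proof -
  interpret sw: core_free_modular G Q P A by (rule core_free_swap)
  show ?thesis
    using Q_closure_least(1) sw.Q_closure_least(1) normal_closure_A Q_closure_elem sw.Q_closure_elem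
      Q_closure_commutes sw.Q_closure_commutes
    by (intro exI[of _ Q_closure] exI[of _ sw.Q_closure]) simp
qed

end

section \<open>From the quotient by the core to the whole group\<close>

context finite_quotient
begin

lemma sigma_step_image:
  assumes "sigma_step G P Q S T"
  shows "sigma_step H P Q (h ` S) (h ` T)"
proof -
  have ST: "subgroup S G" "subgroup T G" "S \<subseteq> T" using assms by (auto simp: sigma_step_def)
  have sub: "subgroup (h ` S) H" "subgroup (h ` T) H" "h ` S \<subseteq> h ` T"
    using ST by (auto intro: subgroup_img_is_subgroup)
  have K: "\<exists>K'. subgroup K' H \<and> K' \<subseteq> h ` S \<and> h ` T \<subseteq> normalizing H K' \<and> (\<forall>x\<in>h ` T. tau_elem_mod H \<tau> K' x)"
    if "subgroup K G" "K \<subseteq> S" "T \<subseteq> normalizing G K" "\<And>x. x \<in> T \<Longrightarrow> tau_elem_mod G \<tau> K x" for K \<tau>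
    using subgroup_img_is_subgroup[OF that(1)] image_mono[OF that(2), of h]
      image_normalizing[OF that(3) subgroup.subset[OF that(1)]] tau_elem_mod_hom[OF that(4)]
    by (intro exI[of _ "h ` K"]) auto
  from assms show ?thesis
  proof (cases rule: sigma_step_cases)
    case normal
    then show ?thesis
      using sub image_normalizing[OF normal subgroup.subset[OF ST(1)]] by (simp add: sigma_step_def)
  next
    case (P_quotient K)
    from K[OF this] sub show ?thesis unfolding sigma_step_def by simp
  next
    case (Q_quotient K)
    from K[OF this] sub show ?thesis unfolding sigma_step_def by simp
  qed
qed

lemma sigma_subnormal_image:
  assumes "sigma_subnormal G P Q A T"
  shows "sigma_subnormal H P Q (h ` A) (h ` T)"
  using assms
proof (induction rule: sigma_subnormal.induct)
  case base
  then show ?case by (intro sigma_subnormal.base subgroup_img_is_subgroup)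
next
  case (step S T)
  show ?case using step.IH sigma_step_image[OF step.hyps(2)] by (rule sigma_subnormal.step)
qed

end

text \<open>
  The images of \<open>M\<close> and \<open>L\<close> lie in the two radicals, whose product is therefore everything; the
  radicals meet trivially because their elements have coprime orders.
\<close>

lemma (in finite_group) pi_decomposable_quotient:
  assumes PQ: "complementary \<pi> (all_primes - \<pi>)"
    and C: "C \<lhd> G" "M \<lhd> G" "L \<lhd> G" "C \<subseteq> M" "C \<subseteq> L" "carrier G \<subseteq> M <#> L"
    and M: "\<And>m. m \<in> M \<Longrightarrow> tau_elem_mod G \<pi> C m"
    and L: "\<And>l. l \<in> L \<Longrightarrow> tau_elem_mod G (all_primes - \<pi>) C l"
  shows "pi_decomposable \<pi> (G Mod C)"
proof -
  define F where "F = G Mod C"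
  define h where "h = (\<lambda>x. C #> x)"
  interpret F: finite_group F unfolding F_def using C(1) by (rule finite_group_Mod)
  interpret finite_quotient G F h C unfolding F_def h_def using C(1) by (rule quotient_hom)
  have G: "M \<subseteq> carrier G" "L \<subseteq> carrier G"
    using C(2,3)[THEN normal_imp_subgroup] by (simp_all add: subgroup.subset)
  let ?OP = "tau_radical \<pi> F" and ?OQ = "tau_radical (all_primes - \<pi>) F"
  note OP = tau_radical_greatest[OF F.is_group F.fin, where \<tau> = \<pi>]
  note OQ = tau_radical_greatest[OF F.is_group F.fin, where \<tau> = "all_primes - \<pi>"]
  have MP: "h ` M \<subseteq> ?OP"
  proof (rule OP(3))
    show n: "h ` M \<lhd> F" using C(2) by (rule image_normal)
    show "tau_group \<pi> (F\<lparr>carrier := h ` M\<rparr>)"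
      using F.tau_group_iff[OF normal_imp_subgroup[OF n]] M G tau_elem_iff by auto
  qed
  have LQ: "h ` L \<subseteq> ?OQ"
  proof (rule OQ(3))
    show n: "h ` L \<lhd> F" using C(3) by (rule image_normal)
    show "tau_group (all_primes - \<pi>) (F\<lparr>carrier := h ` L\<rparr>)"
      using F.tau_group_iff[OF normal_imp_subgroup[OF n]] L G tau_elem_iff by auto
  qed
  have s: "subgroup ?OP F" "subgroup ?OQ F" using OP(1) OQ(1) by (auto intro: normal_imp_subgroup)
  have "z = \<one>\<^bsub>F\<^esub>" if "z \<in> ?OP" "z \<in> ?OQ" for z
    using F.complementary_elem_one[OF PQ] F.tau_group_iff[OF s(1)] F.tau_group_iff[OF s(2)] OP(2) OQ(2) that
    by simp
  then have "?OP \<inter> ?OQ \<subseteq> {\<one>\<^bsub>F\<^esub>}" by blast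
  moreover have "\<one>\<^bsub>F\<^esub> \<in> ?OP \<inter> ?OQ"
    using subgroup.one_closed[OF s(1)] subgroup.one_closed[OF s(2)] by simp
  ultimately have "?OP \<inter> ?OQ = {\<one>\<^bsub>F\<^esub>}" by blast
  moreover have "?OP <#>\<^bsub>F\<^esub> ?OQ = carrier F"
  proof
    show "?OP <#>\<^bsub>F\<^esub> ?OQ \<subseteq> carrier F"
      using subgroup.subset[OF s(1)] subgroup.subset[OF s(2)] by (rule F.set_mult_closed)
    show "carrier F \<subseteq> ?OP <#>\<^bsub>F\<^esub> ?OQ"
    proof
      fix z assume "z \<in> carrier F"
      then obtain x where x: "x \<in> carrier G" "z = h x" by (auto simp flip: surj)
      then obtain m l where ml: "m \<in> M" "l \<in> L" "x = m \<otimes> l" using C(6) by (auto simp: set_mult_def)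
      then have "m \<in> carrier G" "l \<in> carrier G" using G by blast+
      then have "z = h m \<otimes>\<^bsub>F\<^esub> h l" unfolding x(2) ml(3) by (rule hom_mult)
      then show "z \<in> ?OP <#>\<^bsub>F\<^esub> ?OQ" using ml MP LQ by (auto intro!: F.set_multI)
    qed
  qed
  ultimately have "pi_decomposable \<pi> F"
    unfolding pi_decomposable_def internal_direct_product_def using OP(1) OQ(1) F.is_group by simp
  then show ?thesis unfolding F_def .
qed

lemma (in group) factor_centralizer_eq:
  assumes H: "H \<lhd> G" and K: "K \<lhd> G" "K \<subseteq> H"
  shows "factor_centralizer G H K = {g \<in> carrier G. \<forall>x\<in>H. g \<otimes> x \<otimes> inv g \<otimes> inv x \<in> K}"
proof -
  interpret H: normal H G by fact
  interpret K: normal K G by fact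
  let ?F = "G\<lparr>carrier := H\<rparr> Mod K"
  have cF: "carrier ?F = (\<lambda>x. K #> x) ` H"
    by (auto simp: FactGroup_def RCOSETS_def r_coset_def)
  have "conj_action G H K g = \<one>\<^bsub>AutoGroup ?F\<^esub> \<longleftrightarrow> (\<forall>x\<in>H. g \<otimes> x \<otimes> inv g \<otimes> inv x \<in> K)"
    if g: "g \<in> carrier G" for g
  proof -
    have "conj_action G H K g = \<one>\<^bsub>AutoGroup ?F\<^esub> \<longleftrightarrow>
        (\<forall>X\<in>carrier ?F. (g <# X) #> inv g = X)"
      by (simp add: conj_action_def AutoGroup_def BijGroup_def restrict_def fun_eq_iff) blast
    also have "\<dots> \<longleftrightarrow> (\<forall>x\<in>H. K #> (g \<otimes> x \<otimes> inv g) = K #> x)"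
      unfolding cF using conj_coset[OF K(1) g] by auto
    also have "\<dots> \<longleftrightarrow> (\<forall>x\<in>H. g \<otimes> x \<otimes> inv g \<otimes> inv x \<in> K)"
    proof (rule ball_cong[OF refl])
      fix x assume x: "x \<in> H"
      have "K #> (g \<otimes> x \<otimes> inv g) = K #> x \<longleftrightarrow> g \<otimes> x \<otimes> inv g \<in> K #> x"
        using g x repr_independence[of _ K x] rcos_self[of "g \<otimes> x \<otimes> inv g" K] K.subgroup_axioms
        by auto
      also have "\<dots> \<longleftrightarrow> g \<otimes> x \<otimes> inv g \<otimes> inv x \<in> K"
        using g x K.rcos_module[OF is_group, of x "g \<otimes> x \<otimes> inv g"] by simp
      finally show "K #> (g \<otimes> x \<otimes> inv g) = K #> x \<longleftrightarrow> g \<otimes> x \<otimes> inv g \<otimes> inv x \<in> K" .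
    qed
    finally show ?thesis .
  qed
  then show ?thesis by (auto simp: factor_centralizer_def kernel_def)
qed

lemma factor_centralizer_normal:
  assumes "group G" "H \<lhd> G" "K \<lhd> G" "K \<subseteq> H"
  shows "factor_centralizer G H K \<lhd> G"
  unfolding factor_centralizer_def using conj_action_hom[OF assms] by (rule group_hom.normal_kernel)

lemma tau_group_factor_semidirect:
  assumes "group G" "H \<lhd> G" "K \<lhd> G" "K \<subseteq> H"
    and "tau_group \<tau> (G\<lparr>carrier := H\<rparr> Mod K)" "tau_group \<tau> (G Mod factor_centralizer G H K)"
  shows "tau_group \<tau> (factor_semidirect G H K)"
  using factor_semidirect_group[OF assms(1-4)] assms(5,6)
  by (auto simp: tau_group_def factor_semidirect_def semidirect_product_def order_def
      card_cartesian_product prime_dvd_mult_iff)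

context modular_sigma_subnormal
begin

text \<open>
  With \<open>T = \<langle>A, V\<rangle>\<close>, the index of \<open>A\<close> in \<open>T\<close> is a \<open>P\<close>-number and the index of \<open>V\<close> in \<open>T\<close> is a \<open>Q\<close>-number.
  Subgroups of coprime indices have product \<open>T\<close>.
\<close>

lemma hall_permutes:
  assumes V: "hall_subgroup P G V"
  shows "A <#> V = V <#> A"
proof -
  have sV: "subgroup V G" and VP: "tau_group P (G\<lparr>carrier := V\<rparr>)"
    and idx: "\<And>p. p \<in> P \<Longrightarrow> prime p \<Longrightarrow> \<not> p dvd card (rcosets V)"
    using V by (auto simp: hall_subgroup_def)
  interpret V: subgroup V G by fact
  interpret A: subgroup A G by (rule A)
  define T where "T = generate G (A \<union> V)"
  have T: "subgroup T G" "A \<subseteq> T" "V \<subseteq> T" unfolding T_def using join[OF V.subset] by auto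
  obtain n where n: "tau_number P n" "card T = n * card A"
    using join_tau_subgroup[OF sV] VP tau_group_iff[OF sV] unfolding T_def by blast
  obtain m where m: "card T = card V * m" using card_subgroup_dvd[OF sV T(1,3)] by auto
  have pos: "card S > 0" if "subgroup S G" for S
    using card_subgroup_pos[OF that] .
  have "card V * card (rcosets V) = order G"
    using lagrange_finite[OF fin sV] by (simp add: mult.commute)
  moreover have "card T dvd order G"
    using card_subgroup_dvd[OF T(1) subgroup_self subgroup.subset[OF T(1)]] by (simp add: order_def)
  then obtain j where "order G = card T * j" by blast
  ultimately have "card V * card (rcosets V) = card V * (m * j)" using m by (simp only: mult.assoc)
  then have "card (rcosets V) = m * j" using pos[OF sV] by simp
  then have "m dvd card (rcosets V)" by simp
  then have "tau_number Q m"
    using idx PQ pos[OF T(1)] m by (auto simp: tau_number_def complementary_def dest: dvd_trans)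
  then have cop: "coprime n m" using tau_number_coprime[OF PQ n(1)] by simp
  have sI: "subgroup (A \<inter> V) G" using A sV by (rule subgroups_Inter_pair)
  obtain a where a: "card A = card (A \<inter> V) * a" using card_subgroup_dvd[OF sI A] by auto
  obtain b where b: "card V = card (A \<inter> V) * b" using card_subgroup_dvd[OF sI sV] by auto
  \<comment> \<open>With \<open>c = |A \<inter> V|\<close>, counting \<open>|T| = c a n = c b m\<close> gives \<open>n \<le> b\<close> by coprimality, so that \<open>|T| =
    c a n \<le> c a b = |A V|\<close>.\<close>
  have "a * n = b * m"
    using n(2) m pos[OF sI] unfolding a b by (simp add: mult.commute mult.left_commute)
  then have "n dvd b" using cop by (metis coprime_dvd_mult_left_iff dvd_triv_right)
  moreover have "b > 0" using b pos[OF sV] by (cases b) auto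
  ultimately have nb: "n \<le> b" by (rule dvd_imp_le)
  have le: "card T \<le> card W" if W: "card W * card (A \<inter> V) = card A * card V" for W :: "'a set"
  proof -
    have "card W = card (A \<inter> V) * a * b" using W pos[OF sI] unfolding b by (simp add: a)
    then show ?thesis using nb n(2) a by simp
  qed
  have "A <#> V \<subseteq> T" "V <#> A \<subseteq> T"
    using T subgroup.m_closed[OF T(1)] by (auto simp: set_mult_def)
  moreover have "card T \<le> card (A <#> V)" using card_subgroup_mult[OF A sV] by (rule le)
  moreover have "card T \<le> card (V <#> A)"
    using card_subgroup_mult[OF sV A] by (intro le) (simp add: Int_commute mult.commute)
  ultimately have "A <#> V = T" "V <#> A = T"
    using finite_subgroup[OF T(1)] by (simp_all add: card_seteq)
  then show ?thesis by simp
qed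

lemma normal_coreI:
  assumes x: "x \<in> carrier G" and "\<And>g. g \<in> carrier G \<Longrightarrow> g \<otimes> x \<otimes> inv g \<in> A"
  shows "x \<in> normal_core G A"
proof -
  have xG: "{x} \<subseteq> carrier G" using x by simp
  note nc = normal_closure_least[OF is_group xG]
  have "normal_closure G {x} \<subseteq> A"
    unfolding normal_closure_eq_generate[OF xG] using assms A by (intro generate_subgroup_incl) auto
  then have "normal_closure G {x} \<subseteq> normal_core G A"
    using normal_core_greatest(3)[OF is_group A nc(1)] by simp
  with nc(2) show ?thesis by blast
qed

text \<open>
  The core-free case applied to the image of \<open>A\<close> in the quotient by its core, pulled back to \<open>G\<close>. The
  modular law passes to the quotient because every subgroup that contains \<open>A\<close> contains the kernel.
\<close>

lemma normal_closure_structure: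
  "\<exists>L M. L \<lhd> G \<and> M \<lhd> G \<and> normal_core G A \<subseteq> L \<and> normal_core G A \<subseteq> M \<and> normal_closure G A = L <#> M \<and>
    (\<forall>l\<in>L. tau_elem_mod G Q (normal_core G A) l) \<and> (\<forall>m\<in>M. tau_elem_mod G P (normal_core G A) m) \<and>
    (\<forall>l\<in>L. \<forall>v. tau_elem G P v \<longrightarrow> v \<otimes> l \<otimes> inv v \<otimes> inv l \<in> normal_core G A) \<and>
    (\<forall>m\<in>M. \<forall>w. tau_elem G Q w \<longrightarrow> w \<otimes> m \<otimes> inv w \<otimes> inv m \<in> normal_core G A)"
proof -
  define N where "N = normal_core G A"
  note core = normal_core_greatest[OF is_group A, folded N_def]
  define F where "F = G Mod N"
  define h where "h = (\<lambda>x. N #> x)"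
  interpret F: finite_group F unfolding F_def using core(1) by (rule finite_group_Mod)
  interpret q: finite_quotient G F h N unfolding F_def h_def using core(1) by (rule quotient_hom)
  have img: "h ` generate G S = generate F (h ` S)" if "S \<subseteq> carrier G" for S
    using q.generate_img[OF that] by simp
  have sA: "subgroup (h ` A) F" using A by (rule q.subgroup_img_is_subgroup)
  interpret c: core_free_modular F P Q "h ` A"
  proof (intro core_free_modular.intro modular_sigma_subnormal.intro F.finite_group_axioms
      modular_sigma_subnormal_axioms.intro core_free_modular_axioms.intro PQ sA)
    show "sigma_subnormal F P Q (h ` A) (carrier F)"
      using q.sigma_subnormal_image[OF subnormal] by (simp add: q.surj)
  next
    fix H Z assume H: "subgroup H F" and Z: "subgroup Z F" and AZ: "h ` A \<subseteq> Z"
      and ZJ: "Z \<subseteq> generate F (h ` A \<union> H)"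
    let ?H = "q.preimage H" and ?Z = "q.preimage Z"
    have sH: "subgroup ?H G" and sZ: "subgroup ?Z G" using H Z by (auto intro: q.preimage_subgroup)
    have iH: "h ` ?H = H" and iZ: "h ` ?Z = Z"
      using H Z by (auto intro!: q.image_preimage dest: subgroup.subset)
    note J = join[OF subgroup.subset[OF sH]]
    have "h ` generate G (A \<union> ?H) = generate F (h ` A \<union> H)"
      using img[of "A \<union> ?H"] A_subset subgroup.subset[OF sH] by (simp add: image_Un iH)
    then have "?Z \<subseteq> generate G (A \<union> ?H)"
      using ZJ q.image_saturated[OF J(1)] core(2) J(2) by (auto simp: q.preimage_def)
    moreover have "A \<subseteq> ?Z" using AZ A_subset by (auto simp: q.preimage_def)
    ultimately have "?Z \<subseteq> generate G (A \<union> (?H \<inter> ?Z))" by (intro modular[OF sH sZ])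
    then have "h ` ?Z \<subseteq> h ` generate G (A \<union> (?H \<inter> ?Z))" by (rule image_mono)
    also have "\<dots> = generate F (h ` (A \<union> (?H \<inter> ?Z)))"
      using A_subset subgroup.subset[OF sH] by (intro img) auto
    also have "\<dots> \<subseteq> generate F (h ` A \<union> (H \<inter> Z))"
      by (rule F.mono_generate) (auto simp: q.preimage_def)
    finally show "Z \<subseteq> generate F (h ` A \<union> (H \<inter> Z))" by (simp add: iZ)
  next
    fix z assume z: "z \<in> carrier F" "\<And>g. g \<in> carrier F \<Longrightarrow> g \<otimes>\<^bsub>F\<^esub> z \<otimes>\<^bsub>F\<^esub> inv\<^bsub>F\<^esub> g \<in> h ` A"
    obtain x where x: "x \<in> carrier G" "z = h x" using z(1) by (auto simp flip: q.surj)
    have "g \<otimes> x \<otimes> inv g \<in> A" if g: "g \<in> carrier G" for g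
    proof (rule q.image_saturated[OF A core(2)])
      show "h (g \<otimes> x \<otimes> inv g) \<in> h ` A" using z(2)[of "h g"] g x by simp
    qed (use g x in simp)
    then have "x \<in> N" unfolding N_def using x(1) by (intro normal_coreI)
    then show "z = \<one>\<^bsub>F\<^esub>" using x q.ker by simp
  qed
  obtain L' M' where LM: "L' \<lhd> F" "M' \<lhd> F" "normal_closure F (h ` A) = L' <#>\<^bsub>F\<^esub> M'"
    "\<And>l. l \<in> L' \<Longrightarrow> tau_elem F Q l" "\<And>m. m \<in> M' \<Longrightarrow> tau_elem F P m"
    "\<And>l v. l \<in> L' \<Longrightarrow> tau_elem F P v \<Longrightarrow> v \<otimes>\<^bsub>F\<^esub> l = l \<otimes>\<^bsub>F\<^esub> v"
    "\<And>m w. m \<in> M' \<Longrightarrow> tau_elem F Q w \<Longrightarrow> w \<otimes>\<^bsub>F\<^esub> m = m \<otimes>\<^bsub>F\<^esub> w"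
    using c.core_free_structure by blast
  let ?L = "q.preimage L'" and ?M = "q.preimage M'"
  have s: "subgroup L' F" "subgroup M' F" using LM by (auto intro: normal_imp_subgroup)
  have n: "?L \<lhd> G" "?M \<lhd> G" using LM by (auto intro: q.preimage_normal)
  have mem: "x \<in> ?L \<Longrightarrow> x \<in> carrier G" "x \<in> ?L \<Longrightarrow> h x \<in> L'"
    "x \<in> ?M \<Longrightarrow> x \<in> carrier G" "x \<in> ?M \<Longrightarrow> h x \<in> M'" for x
    by (simp_all add: q.preimage_def)
  interpret L: normal ?L G by (rule n)
  interpret M: normal ?M G by (rule n)
  have NL: "N \<subseteq> ?L" "N \<subseteq> ?M" by (rule q.N_subset_preimage s)+
  note ncA = normal_closure_least[OF is_group A_subset]
  note ncF = normal_closure_least[OF F.is_group subgroup.subset[OF sA]]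
  have elF: "tau_elem F \<tau> (h v)" if "tau_elem G \<tau> v" for v \<tau>
    using q.tau_elem_iff[OF tau_elem_mod_carrier[OF that]] tau_elem_mod_mono[OF that, of N]
      subgroup.one_closed[OF normal_imp_subgroup[OF core(1)]] by simp
  have "normal_closure G A = ?L <#> ?M"
  proof
    have "A \<subseteq> ?L <#> ?M"
    proof
      fix a assume a: "a \<in> A"
      have aG: "a \<in> carrier G" using a A_subset by blast
      have "h a \<in> L' <#>\<^bsub>F\<^esub> M'" using a ncF(2) unfolding LM(3) by blast
      then obtain l m where "l \<in> L'" "m \<in> M'" "h a = l \<otimes>\<^bsub>F\<^esub> m" by (auto simp: set_mult_def)
      moreover obtain l0 where l0: "l0 \<in> ?L" "l = h l0"
        using \<open>l \<in> L'\<close> q.image_preimage[OF subgroup.subset[OF s(1)]] by blast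
      moreover obtain m0 where m0: "m0 \<in> ?M" "m = h m0"
        using \<open>m \<in> M'\<close> q.image_preimage[OF subgroup.subset[OF s(2)]] by blast
      ultimately have "h a = h (l0 \<otimes> m0)" by simp
      then obtain n where n: "n \<in> N" "a = n \<otimes> (l0 \<otimes> m0)"
        using q.eq_imp_mult[OF aG, of "l0 \<otimes> m0"] l0 m0 by auto
      then have "a = (n \<otimes> l0) \<otimes> m0" using l0 m0 NL by (auto simp: m_assoc subset_iff)
      moreover have "n \<otimes> l0 \<in> ?L" using n(1) NL(1) l0(1) by blast
      ultimately show "a \<in> ?L <#> ?M" using m0(1) by (simp add: set_multI)
    qed
    then show "normal_closure G A \<subseteq> ?L <#> ?M"
      using normal_subgroup_set_mult_closed[OF n] by (intro ncA(3))
    have NA: "N \<subseteq> normal_closure G A" using core(2) ncA(2) by blast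
    have snc: "subgroup (normal_closure G A) G" using ncA(1) by (rule normal_imp_subgroup)
    have "L' <#>\<^bsub>F\<^esub> M' \<subseteq> h ` normal_closure G A"
      unfolding LM(3)[symmetric] using ncA by (intro ncF(3) q.image_normal image_mono)
    moreover have "h (l \<otimes> m) \<in> L' <#>\<^bsub>F\<^esub> M'" if "l \<in> ?L" "m \<in> ?M" for l m
      unfolding q.hom_mult[OF mem(1)[OF that(1)] mem(3)[OF that(2)]]
      using mem(2)[OF that(1)] mem(4)[OF that(2)] by (rule F.set_multI)
    ultimately have "l \<otimes> m \<in> normal_closure G A" if "l \<in> ?L" "m \<in> ?M" for l m
      using that by (intro q.image_saturated[OF snc NA]) auto
    then show "?L <#> ?M \<subseteq> normal_closure G A" by (auto simp: set_mult_def)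
  qed
  moreover have "tau_elem_mod G Q N l" if "l \<in> ?L" for l
    using LM(4)[OF mem(2)[OF that]] q.tau_elem_iff[OF mem(1)[OF that]] by simp
  moreover have "tau_elem_mod G P N m" if "m \<in> ?M" for m
    using LM(5)[OF mem(4)[OF that]] q.tau_elem_iff[OF mem(3)[OF that]] by simp
  moreover have "v \<otimes> l \<otimes> inv v \<otimes> inv l \<in> N" if "l \<in> ?L" "tau_elem G P v" for l v
    using LM(6)[OF mem(2)[OF that(1)] elF[OF that(2)]]
    by (rule q.commutator_in[OF tau_elem_mod_carrier[OF that(2)] mem(1)[OF that(1)]])
  moreover have "v \<otimes> m \<otimes> inv v \<otimes> inv m \<in> N" if "m \<in> ?M" "tau_elem G Q v" for m v
    using LM(7)[OF mem(4)[OF that(1)] elF[OF that(2)]]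
    by (rule q.commutator_in[OF tau_elem_mod_carrier[OF that(2)] mem(3)[OF that(1)]])
  ultimately show ?thesis
    unfolding N_def[symmetric] using n NL by (intro exI[of _ ?L] exI[of _ ?M]) simp
qed

text \<open>
  For \<open>G/C\<^sub>G(A\<^sup>G/A\<^sub>G)\<close>: the centralizer of \<open>A\<^sup>G/A\<^sub>G\<close> is the intersection of those of \<open>L/A\<^sub>G\<close> and \<open>M/A\<^sub>G\<close>. The
  first contains all \<open>P\<close>-elements, the second all \<open>Q\<close>-elements. So their product is \<open>G\<close>, and modulo the
  intersection the first is a \<open>P\<close>-group and the second a \<open>Q\<close>-group.
\<close>

lemma closure_quotient_decomposable:
  assumes P: "P = \<pi>" and Q: "Q = all_primes - \<pi>"
  shows "pi_decomposable \<pi> (G\<lparr>carrier := normal_closure G A\<rparr> Mod normal_core G A)"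
    "pi_decomposable \<pi> (G Mod factor_centralizer G (normal_closure G A) (normal_core G A))"
proof -
  let ?N = "normal_core G A" and ?E = "normal_closure G A"
  note core = normal_core_greatest[OF is_group A]
  note nc = normal_closure_least[OF is_group A_subset]
  obtain L M where LM: "L \<lhd> G" "M \<lhd> G" "?N \<subseteq> L" "?N \<subseteq> M" "?E = L <#> M"
    "\<And>l. l \<in> L \<Longrightarrow> tau_elem_mod G Q ?N l" "\<And>m. m \<in> M \<Longrightarrow> tau_elem_mod G P ?N m"
    "\<And>l v. l \<in> L \<Longrightarrow> tau_elem G P v \<Longrightarrow> v \<otimes> l \<otimes> inv v \<otimes> inv l \<in> ?N"
    "\<And>m w. m \<in> M \<Longrightarrow> tau_elem G Q w \<Longrightarrow> w \<otimes> m \<otimes> inv w \<otimes> inv m \<in> ?N"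
    using normal_closure_structure by blast
  interpret L: normal L G by (rule LM)
  interpret M: normal M G by (rule LM)
  interpret E: normal ?E G by (rule nc(1))
  interpret N: normal ?N G by (rule core(1))
  have comm: "L <#> M = M <#> L"
    using LM(1) M.subgroup_axioms by (rule commut_normal[symmetric, rotated]) 
  have LE: "L \<subseteq> ?E" "M \<subseteq> ?E" 
    using set_mult_normalized(2,3)[OF L.subgroup_axioms M.subgroup_axioms] LM(1,5) M.subset
    by (auto simp: normal_normalizing)
  have NE: "?N \<subseteq> ?E" using core(2) nc(2) by blast
  interpret E': finite_group "G\<lparr>carrier := ?E\<rparr>"
    using E.subgroup_axioms by (rule finite_group_restrict)
  show "pi_decomposable \<pi> (G\<lparr>carrier := ?E\<rparr> Mod ?N)"
  proof (rule E'.pi_decomposable_quotient)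
    show "complementary \<pi> (all_primes - \<pi>)" using PQ P Q by simp
    show "?N \<lhd> G\<lparr>carrier := ?E\<rparr>" "M \<lhd> G\<lparr>carrier := ?E\<rparr>" "L \<lhd> G\<lparr>carrier := ?E\<rparr>"
      using normal_restrict_supergroup[OF E.subgroup_axioms] core(1) LM(1,2) NE LE by auto
    show "carrier (G\<lparr>carrier := ?E\<rparr>) \<subseteq> M <#>\<^bsub>G\<lparr>carrier := ?E\<rparr>\<^esub> L"
      using LM(5) comm by (simp add: set_mult_def)
    show "tau_elem_mod (G\<lparr>carrier := ?E\<rparr>) \<pi> ?N m" if "m \<in> M" for m
      using that LE(2) LM(7)[OF that] P tau_elem_mod_restrict[OF E.subset] by auto
    show "tau_elem_mod (G\<lparr>carrier := ?E\<rparr>) (all_primes - \<pi>) ?N l" if "l \<in> L" for l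
      using that LE(1) LM(6)[OF that] Q tau_elem_mod_restrict[OF E.subset] by auto
  qed (use LM in auto)
  let ?C = "factor_centralizer G"
  note fce = factor_centralizer_eq
  have C: "?C ?E ?N \<lhd> G" "?C L ?N \<lhd> G" "?C M ?N \<lhd> G"
    using factor_centralizer_normal[OF is_group] nc(1) core(1) LM(1-4) NE by auto
  have eq: "?C ?E ?N = ?C L ?N \<inter> ?C M ?N"
  proof
    show "?C ?E ?N \<subseteq> ?C L ?N \<inter> ?C M ?N"
      using LE by (auto simp: fce nc(1) core(1) LM(1-4) NE)
    show "?C L ?N \<inter> ?C M ?N \<subseteq> ?C ?E ?N"
    proof
      fix g assume "g \<in> ?C L ?N \<inter> ?C M ?N"
      then have g: "g \<in> carrier G" "\<And>x. x \<in> L \<Longrightarrow> g \<otimes> x \<otimes> inv g \<otimes> inv x \<in> ?N"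
        "\<And>x. x \<in> M \<Longrightarrow> g \<otimes> x \<otimes> inv g \<otimes> inv x \<in> ?N"
        by (auto simp: fce core(1) LM(1-4))
      have "g \<otimes> x \<otimes> inv g \<otimes> inv x \<in> ?N" if x: "x \<in> ?E" for x
      proof -
        obtain l m where lm: "l \<in> L" "m \<in> M" "x = l \<otimes> m" using x LM(5) by (auto simp: set_mult_def)
        have c: "l \<in> carrier G" "m \<in> carrier G" using lm by auto
        have "g \<otimes> x \<otimes> inv g \<otimes> inv x
            = (g \<otimes> l \<otimes> inv g \<otimes> inv l) \<otimes> (l \<otimes> (g \<otimes> m \<otimes> inv g \<otimes> inv m) \<otimes> inv l)"
          unfolding lm(3) using g(1) c by (simp add: m_assoc inv_mult_group cancel_left_inv)
        then show ?thesis using g(2)[OF lm(1)] N.inv_op_closed2[OF c(1) g(3)[OF lm(2)]] by simp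
      qed
      then show "g \<in> ?C ?E ?N" using g(1) by (simp add: fce nc(1) core(1) NE)
    qed
  qed
  have CP: "v \<in> ?C L ?N" if "tau_elem G P v" for v
    using that LM(8) tau_elem_mod_carrier by (auto simp: fce core(1) LM(1-4))
  have CQ: "v \<in> ?C M ?N" if "tau_elem G Q v" for v
    using that LM(9) tau_elem_mod_carrier by (auto simp: fce core(1) LM(1-4))
  show "pi_decomposable \<pi> (G Mod ?C ?E ?N)"
  proof (rule pi_decomposable_quotient[OF _ C])
    show "complementary \<pi> (all_primes - \<pi>)" using PQ P Q by simp
    show "carrier G \<subseteq> ?C L ?N <#> ?C M ?N"
    proof
      fix x assume x: "x \<in> carrier G"
      obtain i j :: nat where ij: "x = x [^] i \<otimes> x [^] j" "tau_elem G P (x [^] i)" "tau_elem G Q (x [^] j)"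
        using tau_elem_factorization[OF PQ x] by blast
      show "x \<in> ?C L ?N <#> ?C M ?N"
        using set_multI[OF CP[OF ij(2)] CQ[OF ij(3)]] by (simp only: ij(1)[symmetric])
    qed
    show "tau_elem_mod G \<pi> (?C ?E ?N) x" if x: "x \<in> ?C L ?N" for x
    proof -
      have "tau_elem_mod G P (?C M ?N) x"
        using x subgroup.mem_carrier[OF normal_imp_subgroup[OF C(2)]]
        by (intro tau_elem_mod_of_complement[OF PQ normal_imp_subgroup[OF C(3)] CQ]) auto
      then show ?thesis
        using subgroup_pow_closed[OF normal_imp_subgroup[OF C(2)] x] unfolding eq P tau_elem_mod_def
        by blast
    qed
    show "tau_elem_mod G (all_primes - \<pi>) (?C ?E ?N) x" if x: "x \<in> ?C M ?N" for x
    proof -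
      have "tau_elem_mod G Q (?C L ?N) x"
        using x subgroup.mem_carrier[OF normal_imp_subgroup[OF C(3)]]
        by (intro tau_elem_mod_of_complement[OF complementary_sym[OF PQ] normal_imp_subgroup[OF C(2)] CP]) auto
      then show ?thesis
        using subgroup_pow_closed[OF normal_imp_subgroup[OF C(3)] x] unfolding eq Q tau_elem_mod_def
        by blast
    qed
  qed (simp_all add: eq)
qed

text \<open>
  As \<open>H/K\<close> is a chief factor, \<open>H = K (H \<inter> L)\<close>. The elements of \<open>L\<close> are \<open>Q\<close>-elements modulo the core of \<open>A\<close>,
  hence modulo \<open>K\<close>, and modulo \<open>K\<close> they commute with all \<open>P\<close>-elements of \<open>G\<close>. So \<open>H/K\<close> is a \<open>Q\<close>-group, and
  \<open>C\<^sub>G(H/K)\<close> contains all \<open>P\<close>-elements, whence \<open>G/C\<^sub>G(H/K)\<close> is a \<open>Q\<close>-group too.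
\<close>

lemma chief_factor_of_complement:
  assumes chief: "chief_factor G H K" and N: "normal_core G A \<subseteq> K"
    and L: "L \<lhd> G" "\<And>l. l \<in> L \<Longrightarrow> tau_elem_mod G Q (normal_core G A) l"
      "\<And>l v. l \<in> L \<Longrightarrow> tau_elem G P v \<Longrightarrow> v \<otimes> l \<otimes> inv v \<otimes> inv l \<in> normal_core G A"
    and nK: "\<not> H \<inter> L \<subseteq> K"
  shows "tau_group Q (factor_semidirect G H K)"
proof -
  have HK: "H \<lhd> G" "K \<lhd> G" "K \<subseteq> H"
    and min: "\<And>N. N \<lhd> G \<Longrightarrow> K \<subseteq> N \<Longrightarrow> N \<subseteq> H \<Longrightarrow> N = K \<or> N = H"
    using chief by (auto simp: chief_factor_def)
  interpret H: normal H G by (rule HK)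
  interpret K: normal K G by (rule HK)
  interpret L: normal L G by (rule L)
  have HL: "H \<inter> L \<lhd> G" using HK(1) L(1) by (rule normal_subgroup_intersect)
  interpret HL: normal "H \<inter> L" G by (rule HL)
  note s = set_mult_normalized[OF K.subgroup_axioms HL.subgroup_axioms]
  have n: "H \<inter> L \<subseteq> normalizing G K" using HK(2) H.subset by (auto simp: normal_normalizing)
  have "K <#> (H \<inter> L) \<lhd> G" using HK(2) HL by (rule normal_subgroup_set_mult_closed)
  moreover have "K <#> (H \<inter> L) \<subseteq> H" using HK(3) by (auto simp: set_mult_def)
  ultimately have KHL: "K <#> (H \<inter> L) = H" using min[of "K <#> (H \<inter> L)"] s(2,3)[OF n] nK by auto
  have fac: "\<exists>k l. k \<in> K \<and> l \<in> L \<and> x = k \<otimes> l" if "x \<in> H" for x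
  proof -
    have "x \<in> K <#> (H \<inter> L)" using that by (simp only: KHL)
    then show ?thesis by (auto simp: set_mult_def)
  qed
  let ?C = "factor_centralizer G H K"
  have C: "?C \<lhd> G" using is_group HK by (rule factor_centralizer_normal)
  have CP: "v \<in> ?C" if v: "tau_elem G P v" for v
  proof -
    have vG: "v \<in> carrier G" using v by (rule tau_elem_mod_carrier)
    have "v \<otimes> x \<otimes> inv v \<otimes> inv x \<in> K" if x: "x \<in> H" for x
    proof -
      obtain k l where kl: "k \<in> K" "l \<in> L" "x = k \<otimes> l" using fac[OF x] by blast
      have c: "k \<in> carrier G" "l \<in> carrier G" using kl by auto
      have 1: "v \<otimes> l \<otimes> inv v \<otimes> inv l \<in> K" using L(3)[OF kl(2) v] N by blast
      have "v \<otimes> x \<otimes> inv v \<otimes> inv x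
          = (v \<otimes> k \<otimes> inv v) \<otimes> (v \<otimes> l \<otimes> inv v \<otimes> inv l) \<otimes> inv k"
        unfolding kl(3) using vG c by (simp add: m_assoc inv_mult_group cancel_left_inv)
      then show ?thesis using K.inv_op_closed2[OF vG kl(1)] 1 kl(1) by simp
    qed
    then show ?thesis using vG by (simp add: factor_centralizer_eq HK)
  qed
  have "tau_elem_mod G Q ?C x" if "x \<in> carrier G" for x
    using that by (intro tau_elem_mod_of_complement[OF complementary_sym[OF PQ] normal_imp_subgroup[OF C] CP])
  then have 1: "tau_group Q (G Mod ?C)" using tau_group_Mod_iff[OF C] by simp
  interpret H': finite_group "G\<lparr>carrier := H\<rparr>"
    using H.subgroup_axioms by (rule finite_group_restrict)
  have KH: "K \<lhd> G\<lparr>carrier := H\<rparr>"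
    using normal_restrict_supergroup[OF H.subgroup_axioms HK(2,3)] .
  have "tau_elem_mod G Q K x" if x: "x \<in> H" for x
  proof -
    obtain k l where kl: "k \<in> K" "l \<in> L" "x = k \<otimes> l" using fac[OF x] by blast
    have "l \<in> normalizing G K" using HK(2) kl(2) by (auto simp: normal_normalizing)
    moreover have "tau_elem_mod G Q K l" using L(2)[OF kl(2)] N by (rule tau_elem_mod_mono)
    ultimately show ?thesis unfolding kl(3)
      using kl(1) by (rule tau_elem_mod_mult[OF K.subgroup_axioms])
  qed
  then have 2: "tau_group Q (G\<lparr>carrier := H\<rparr> Mod K)"
    using H'.tau_group_Mod_iff[OF KH] tau_elem_mod_restrict[OF H.subset] by simp
  show ?thesis using is_group HK 2 1 by (rule tau_group_factor_semidirect)
qed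

text \<open>
  The \<open>Q\<close>-elements of \<open>A\<^sup>G = L M\<close> lie in \<open>L\<close> and the \<open>P\<close>-elements in \<open>M\<close>. If \<open>K\<close> contained both \<open>H \<inter> L\<close> and \<open>H \<inter> M\<close>,
  it would contain both parts of every element of \<open>H\<close>.
\<close>

lemma chief_factor_semidirect:
  assumes chief: "chief_factor G H K" and N: "normal_core G A \<subseteq> K" and E: "H \<subseteq> normal_closure G A"
  shows "tau_group P (factor_semidirect G H K) \<or> tau_group Q (factor_semidirect G H K)"
proof -
  interpret sw: modular_sigma_subnormal G Q P A by (rule swap)
  let ?N = "normal_core G A" and ?E = "normal_closure G A"
  obtain L M where LM: "L \<lhd> G" "M \<lhd> G" "?N \<subseteq> L" "?N \<subseteq> M" "?E = L <#> M"
    "\<And>l. l \<in> L \<Longrightarrow> tau_elem_mod G Q ?N l" "\<And>m. m \<in> M \<Longrightarrow> tau_elem_mod G P ?N m"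
    "\<And>l v. l \<in> L \<Longrightarrow> tau_elem G P v \<Longrightarrow> v \<otimes> l \<otimes> inv v \<otimes> inv l \<in> ?N"
    "\<And>m w. m \<in> M \<Longrightarrow> tau_elem G Q w \<Longrightarrow> w \<otimes> m \<otimes> inv w \<otimes> inv m \<in> ?N"
    using normal_closure_structure by blast
  interpret L: normal L G by (rule LM)
  interpret M: normal M G by (rule LM)
  have sH: "subgroup H G" and sK: "subgroup K G" and ne: "\<not> H \<subseteq> K"
    using chief by (auto simp: chief_factor_def normal_imp_subgroup)
  have eL: "v \<in> L" if "v \<in> ?E" "tau_elem G Q v" for v
    using tau_elem_mod_mono[OF LM(7) LM(3)] that
    unfolding LM(5) by (rule tau_elem_in_normal_factor[OF PQ LM(1)])
  have "?E = M <#> L" using LM(5) commut_normal[OF M.subgroup_axioms LM(1)] by simp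
  then have eM: "v \<in> M" if "v \<in> ?E" "tau_elem G P v" for v
    using that tau_elem_mod_mono[OF LM(6) LM(4)]
    by (intro tau_elem_in_normal_factor[OF complementary_sym[OF PQ] LM(2), of L]) auto
  have "\<not> (H \<inter> L \<subseteq> K \<and> H \<inter> M \<subseteq> K)"
  proof
    assume a: "H \<inter> L \<subseteq> K \<and> H \<inter> M \<subseteq> K"
    have "x \<in> K" if x: "x \<in> H" for x
    proof -
      obtain i j :: nat where ij: "x = x [^] i \<otimes> x [^] j" "tau_elem G P (x [^] i)" "tau_elem G Q (x [^] j)"
        using tau_elem_factorization[OF PQ subgroup.mem_carrier[OF sH x]] by blast
      have "x [^] i \<in> H" "x [^] j \<in> H" using subgroup_pow_closed[OF sH x] by auto
      then have "x [^] i \<in> K" "x [^] j \<in> K" using a eL[OF _ ij(3)] eM[OF _ ij(2)] E by auto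
      then have "x [^] i \<otimes> x [^] j \<in> K" by (rule subgroup.m_closed[OF sK])
      then show ?thesis by (simp only: ij(1)[symmetric])
    qed
    with ne show False by blast
  qed
  then consider "\<not> H \<inter> L \<subseteq> K" | "\<not> H \<inter> M \<subseteq> K" by blast
  then show ?thesis
  proof cases
    case 1
    then have "tau_group Q (factor_semidirect G H K)"
      using LM(1,6,8) by (intro chief_factor_of_complement[OF chief N, of L])
    then show ?thesis ..
  next
    case 2
    then have "tau_group P (factor_semidirect G H K)"
      using LM(2,7,9) by (intro sw.chief_factor_of_complement[OF chief N, of M])
    then show ?thesis ..
  qed
qed

end

theorem corollary1p3:
  fixes G :: "('a, 'b) monoid_scheme"
    and \<pi> :: "nat set"
    and A :: "'a set"
    and B :: "nat \<Rightarrow> 'a set"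
    and m :: nat
  assumes "finite \<pi>" and "\<pi> \<subseteq> all_primes"
    and "Group.group G" and "finite (carrier G)"
    and "modular_subgroup G A"
    and "B 0 = A" and "B m = carrier G"
    and "\<forall>i\<le>m. subgroup (B i) G"
    and "\<forall>i\<in>{1..m}. B (i - 1) \<subseteq> B i"
    and "\<forall>i\<in>{1..m}.
           B (i - 1) \<lhd> G\<lparr>carrier := B i\<rparr> \<or>
           (\<exists>\<pi>\<^sub>0\<in>{\<pi>, all_primes - \<pi>}.
              tau_group \<pi>\<^sub>0
                (G\<lparr>carrier := B i\<rparr> Mod normal_core (G\<lparr>carrier := B i\<rparr>) (B (i - 1))))"
  shows "(\<forall>\<pi>\<^sub>0\<in>{\<pi>, all_primes - \<pi>}.
            (\<exists>V. hall_subgroup \<pi>\<^sub>0 G V) \<longrightarrow>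
            (\<forall>V. hall_subgroup \<pi>\<^sub>0 G V \<longrightarrow> A <#>\<^bsub>G\<^esub> V = V <#>\<^bsub>G\<^esub> A))
       \<and> (pi_decomposable \<pi> (G\<lparr>carrier := normal_closure G A\<rparr> Mod normal_core G A)
          \<and> pi_decomposable \<pi>
              (G Mod factor_centralizer G (normal_closure G A) (normal_core G A)))
       \<and> (\<forall>H K. chief_factor G H K \<longrightarrow> normal_core G A \<subseteq> K \<longrightarrow> H \<subseteq> normal_closure G A \<longrightarrow>
            tau_group \<pi> (factor_semidirect G H K)
            \<or> tau_group (all_primes - \<pi>) (factor_semidirect G H K))"
proof -
  let ?\<pi>' = "all_primes - \<pi>"
  interpret finite_group G
    using assms(3,4) by (simp add: finite_group_def finite_group_axioms_def)
  have step: "sigma_step G \<pi> ?\<pi>' (B i) (B (Suc i))" if i: "Suc i \<le> m" for i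
  proof -
    have S: "subgroup (B i) G" and T: "subgroup (B (Suc i)) G" and ST: "B i \<subseteq> B (Suc i)"
      using assms(8) bspec[OF assms(9), of "Suc i"] i by simp_all
    let ?T = "G\<lparr>carrier := B (Suc i)\<rparr>"
    interpret T: finite_group ?T using T by (rule finite_group_restrict)
    have "B i \<lhd> ?T \<or> (\<exists>\<pi>\<^sub>0\<in>{\<pi>, ?\<pi>'}. tau_group \<pi>\<^sub>0 (?T Mod normal_core ?T (B i)))"
      using bspec[OF assms(10), of "Suc i"] i by simp
    then show ?thesis
    proof
      assume "B i \<lhd> ?T"
      then show ?thesis using S T ST normal_restrict_iff[OF T] by (simp add: sigma_step_def)
    next
      assume "\<exists>\<pi>\<^sub>0\<in>{\<pi>, ?\<pi>'}. tau_group \<pi>\<^sub>0 (?T Mod normal_core ?T (B i))"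
      then obtain \<tau> where \<tau>: "\<tau> \<in> {\<pi>, ?\<pi>'}" "tau_group \<tau> (?T Mod normal_core ?T (B i))" by blast
      have SK: "subgroup (B i) ?T" using S T ST by (rule subgroup_incl)
      let ?K = "normal_core ?T (B i)"
      note K = normal_core_greatest[OF T.is_group SK]
      have "subgroup ?K G" "B (Suc i) \<subseteq> normalizing G ?K"
        using K(1) normal_restrict_iff[OF T] by auto
      moreover have "tau_elem_mod G \<tau> ?K x" if "x \<in> B (Suc i)" for x
        using \<tau>(2) T.tau_group_Mod_iff[OF K(1)] tau_elem_mod_restrict[OF subgroup.subset[OF T]] that
        by simp
      ultimately have "\<exists>K. subgroup K G \<and> K \<subseteq> B i \<and> B (Suc i) \<subseteq> normalizing G K \<and>
          (\<forall>x\<in>B (Suc i). tau_elem_mod G \<tau> K x)"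
        using K(2) by blast
      with S T ST \<tau>(1) show ?thesis unfolding sigma_step_def by blast
    qed
  qed
  have A: "subgroup A G" using assms(5) by (simp add: modular_subgroup_def)
  have "sigma_subnormal G \<pi> ?\<pi>' A (B i)" if "i \<le> m" for i
    using that
  proof (induction i)
    case 0
    show ?case unfolding assms(6) using A by (rule sigma_subnormal.base)
  next
    case (Suc i)
    have "sigma_subnormal G \<pi> ?\<pi>' A (B i)" using Suc by simp
    then show ?case using step[OF Suc.prems] by (rule sigma_subnormal.step)
  qed
  from this[of m] have sn: "sigma_subnormal G \<pi> ?\<pi>' A (carrier G)" by (simp add: assms(7))
  have compl: "complementary \<pi> ?\<pi>'" by (auto simp: complementary_def all_primes_def)
  interpret modular_sigma_subnormal G \<pi> ?\<pi>' A
  proof (intro modular_sigma_subnormal.intro modular_sigma_subnormal_axioms.intro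
      finite_group_axioms compl A sn)
    fix H Z assume HZ: "subgroup H G" "subgroup Z G" "A \<subseteq> Z" "Z \<subseteq> generate G (A \<union> H)"
    have "generate G (A \<union> (H \<inter> Z)) = generate G (A \<union> H) \<inter> Z"
      using assms(5) HZ(1-3) by (simp add: modular_subgroup_def)
    with HZ(4) show "Z \<subseteq> generate G (A \<union> (H \<inter> Z))" by blast
  qed
  interpret sw: modular_sigma_subnormal G ?\<pi>' \<pi> A by (rule swap)
  show ?thesis
    using hall_permutes sw.hall_permutes closure_quotient_decomposable[OF HOL.refl HOL.refl]
      chief_factor_semidirect
    by simp
qed

end
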